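(* Let $E$ be a complex separable Hilbert space carrying a unitary representation of the dihedral group $D_n$ with generators $\mathcal R,\mathcal S$, and let $\mathcal A\in C^0([0,1];\mathcal F^{\mathrm{sa}}(E))$ be a $D_n$-equivariant path, i.e. $\mathcal A(\lambda)$ commutes with $\mathcal R$ and $\mathcal S$ for every $\lambda\in[0,1]$. Then: (i) if $n$ is odd, $\operatorname{sf}(\mathcal A;[0,1])\equiv\operatorname{sf}(\mathcal A|_{E_0};[0,1])\pmod 2$; (ii) if $n$ is even, $\operatorname{sf}(\mathcal A;[0,1])\equiv\operatorname{sf}(\mathcal A|_{E_0};[0,1])+\operatorname{sf}(\mathcal A|_{E_{n/2}};[0,1])\pmod 2$.
   Context: $n\ge 1$ is an integer. The unitary representation of $D_n$ in $E$ is given by unitary operators $\mathcal R,\mathcal S$ on $E$ with $\mathcal R^n=\mathcal S^2=(\mathcal S\mathcal R)^2=\mathrm{Id}_E$. Let $\zeta_n=e^{2\pi i/n}$ and $E_k=\ker(\mathcal R-\zeta_n^k\mathrm{Id}_E)$. $\mathcal F^{\mathrm{sa}}(E)$ is the space of bounded selfadjoint Fredholm operators on $E$ with the norm topology. Spectral flow: for a continuous path $\mathcal A:[a,b]\to\mathcal F^{\mathrm{sa}}(E)$ there are a partition $a=t_0<\dots<t_N=b$ and numbers $a_i>0$ such that, for $t\in[t_{i-1},t_i]$, $\pm a_i\notin\sigma(\mathcal A_t)$ and the spectral subspace $E_{[-a_i,a_i]}(\mathcal A_t)$ has finite dimension independent of $t$. Then $\operatorname{sf}(\mathcal A;[a,b])=\sum_{i=1}^N\big(\dim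 E_{[0,a_i]}(\mathcal A_{t_i})-\dim E_{[0,a_i]}(\mathcal A_{t_{i-1}})\big)$, where $E_{[c,d]}(T)$ is the spectral subspace of $T$ for $[c,d]$; this is independent of the choices. *)

theory Defs
  imports "HOL-Analysis.Analysis" "HOL-Number_Theory.Cong"
begin

section \<open>Complex Hilbert spaces\<close>

text \<open>
  The inner product is linear in its first argument. Completeness comes from the class
  \<^class>\<open>banach\<close>, whose norm is required to be the one induced by the inner product
  (which makes the inner product positive definite).
\<close>

class complex_hilbert = banach +
  fixes scaleC :: "complex \<Rightarrow> 'a \<Rightarrow> 'a" (infixr "*\<^sub>C" 75)
    and cinner :: "'a \<Rightarrow> 'a \<Rightarrow> complex"
  assumes scaleC_add_right: "a *\<^sub>C (x + y) = a *\<^sub>C x + a *\<^sub>C y"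
    and scaleC_add_left: "(a + b) *\<^sub>C x = a *\<^sub>C x + b *\<^sub>C x"
    and scaleC_scaleC: "a *\<^sub>C b *\<^sub>C x = (a * b) *\<^sub>C x"
    and scaleR_scaleC: "r *\<^sub>R x = complex_of_real r *\<^sub>C x"
    and cinner_commute: "cinner x y = cnj (cinner y x)"
    and cinner_add_left: "cinner (x + y) z = cinner x z + cinner y z"
    and cinner_scaleC_left: "cinner (a *\<^sub>C x) y = a * cinner x y"
    and cinner_self: "cinner x x = complex_of_real ((norm x)\<^sup>2)"

lemma scaleC_one: "1 *\<^sub>C x = (x :: 'a::complex_hilbert)"
  using scaleR_scaleC[of 1 x] by simp

text \<open>Complex spans and dimensions; \<^const>\<open>span\<close> and \<^const>\<open>dim\<close> are the real ones.\<close>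

global_interpretation complex_vector: vector_space "scaleC :: complex \<Rightarrow> 'a \<Rightarrow> 'a::complex_hilbert"
  defines cdependent = complex_vector.dependent
    and crepresentation = complex_vector.representation
    and csubspace = complex_vector.subspace
    and cspan = complex_vector.span
    and cextend_basis = complex_vector.extend_basis
    and cdim = complex_vector.dim
  by unfold_locales (simp_all add: scaleC_add_right scaleC_add_left scaleC_scaleC scaleC_one)

definition cfinite_dim :: "'a::complex_hilbert set \<Rightarrow> bool" where
  "cfinite_dim V \<longleftrightarrow> (\<exists>B. finite B \<and> V \<subseteq> cspan B)"

section \<open>Operators\<close>

text \<open>
  Bounded operators are elements of \<^typ>\<open>'a \<Rightarrow>\<^sub>L 'a\<close>, which carries the operator norm topology;
  its elements are only real-linear, so complex linearity is required separately.
\<close>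

definition clinear_op :: "('a::complex_hilbert \<Rightarrow> 'a) \<Rightarrow> bool" where
  "clinear_op T \<longleftrightarrow> (\<forall>x y. T (x + y) = T x + T y) \<and> (\<forall>c x. T (c *\<^sub>C x) = c *\<^sub>C T x)"

definition selfadjoint :: "('a::complex_hilbert \<Rightarrow>\<^sub>L 'a) \<Rightarrow> bool" where
  "selfadjoint T \<longleftrightarrow> clinear_op T \<and> (\<forall>x y. cinner (T x) y = cinner x (T y))"

definition fredholm :: "('a::complex_hilbert \<Rightarrow>\<^sub>L 'a) \<Rightarrow> bool" where
  "fredholm T \<longleftrightarrow> clinear_op T \<and> cfinite_dim {x. T x = 0} \<and> closed (range T) \<and>
     (\<exists>B. finite B \<and> cspan (range T \<union> B) = UNIV)"

definition unitary :: "('a::complex_hilbert \<Rightarrow> 'a) \<Rightarrow> bool" where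
  "unitary U \<longleftrightarrow> clinear_op U \<and> surj U \<and> (\<forall>x y. cinner (U x) (U y) = cinner x y)"

section \<open>Spectrum and spectral subspaces of a restricted operator\<close>

text \<open>
  Below, \<open>V\<close> is a closed complex subspace invariant under \<open>T\<close>, and all notions are those of the
  operator \<open>V \<rightarrow> V\<close> obtained by restricting \<open>T\<close>; for \<open>V = UNIV\<close> they are those of \<open>T\<close> itself.

  In the next definition, a bounded inverse on \<open>V\<close> is represented by an operator on the whole space
  whose values outside \<open>V\<close> are irrelevant (every bounded operator on \<open>V\<close> extends, by means of the
  orthogonal projection onto \<open>V\<close>).
\<close>

definition spectrum_on :: "'a::complex_hilbert set \<Rightarrow> ('a \<Rightarrow>\<^sub>L 'a) \<Rightarrow> complex set" where
  "spectrum_on V T = {z. \<not> (\<exists>B :: 'a \<Rightarrow>\<^sub>L 'a. \<forall>x\<in>V.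
     B x \<in> V \<and> B (T x - z *\<^sub>C x) = x \<and> T (B x) - z *\<^sub>C B x = x)}"

text \<open>Symmetric idempotent maps of \<open>V\<close> are automatically linear and bounded.\<close>

definition orthogonal_projection_on :: "'a::complex_hilbert set \<Rightarrow> ('a \<Rightarrow> 'a) \<Rightarrow> bool" where
  "orthogonal_projection_on V Q \<longleftrightarrow>
     (\<forall>x\<in>V. Q x \<in> V \<and> Q (Q x) = Q x) \<and> (\<forall>x\<in>V. \<forall>y\<in>V. cinner (Q x) y = cinner x (Q y))"

text \<open>
  The resolution of the identity \<open>P s = \<chi>\<^bsub>(-\<infinity>,s]\<^esub>(T)\<close> of a bounded selfadjoint operator on \<open>V\<close>:
  an increasing, strongly right-continuous family of orthogonal projections, constant outside a
  bounded interval, with \<open>T = \<integral> s dP(s)\<close>. The integral is meant in the weak sense, on the diagonal: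
  \<open>s \<mapsto> \<langle>P s x, x\<rangle> = \<parallel>P s x\<parallel>\<^sup>2\<close> is the distribution function of the spectral measure of \<open>T\<close> at \<open>x\<close>.
\<close>

definition resolution_of_identity ::
    "'a::complex_hilbert set \<Rightarrow> ('a \<Rightarrow>\<^sub>L 'a) \<Rightarrow> (real \<Rightarrow> 'a \<Rightarrow> 'a) \<Rightarrow> bool" where
  "resolution_of_identity V T P \<longleftrightarrow>
     (\<forall>s. orthogonal_projection_on V (P s)) \<and>
     (\<forall>s s'. s \<le> s' \<longrightarrow> (\<forall>x\<in>V. P s (P s' x) = P s x)) \<and>
     (\<forall>x\<in>V. \<forall>s. continuous (at_right s) (\<lambda>r. P r x)) \<and>
     (\<exists>M. \<forall>x\<in>V. (\<forall>s < -M. P s x = 0) \<and> (\<forall>s \<ge> M. P s x = x)) \<and>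
     (\<forall>x\<in>V. cinner (T x) x =
        complex_of_real (\<integral>s. s \<partial>interval_measure (\<lambda>s. (norm (P s x))\<^sup>2)))"

text \<open>
  The spectral subspace \<open>E\<^bsub>[c,d]\<^esub>(T)\<close>, for \<open>c \<le> d\<close>, is the range of \<open>\<chi>\<^bsub>[c,d]\<^esub>(T) = P d - P (c-)\<close>, that is,
  the intersection of the range of \<open>P d\<close> with the kernels of all \<open>P s\<close>, \<open>s < c\<close>. By the spectral
  theorem, \<open>P\<close> exists and its values on \<open>V\<close> are determined by \<open>T\<close>; its values off \<open>V\<close> are arbitrary,
  which is why the choice operator is used.
\<close>

definition spectral_subspace_on ::
    "'a::complex_hilbert set \<Rightarrow> ('a \<Rightarrow>\<^sub>L 'a) \<Rightarrow> real \<Rightarrow> real \<Rightarrow> 'a set" where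
  "spectral_subspace_on V T c d =
     (let P = (SOME P. resolution_of_identity V T P)
      in {x\<in>V. P d x = x \<and> (\<forall>s<c. P s x = 0)})"

section \<open>Spectral flow\<close>

text \<open>\<open>t 0 < \<dots> < t N\<close> is the partition, and \<open>\<alpha> i\<close> belongs to the interval \<open>[t (i - 1), t i]\<close>.\<close>

definition spectral_flow_partition ::
    "'a::complex_hilbert set \<Rightarrow> (real \<Rightarrow> 'a \<Rightarrow>\<^sub>L 'a) \<Rightarrow> real \<Rightarrow> real \<Rightarrow>
     nat \<Rightarrow> (nat \<Rightarrow> real) \<Rightarrow> (nat \<Rightarrow> real) \<Rightarrow> bool" where
  "spectral_flow_partition V A a b N t \<alpha> \<longleftrightarrow>
     t 0 = a \<and> t N = b \<and> (\<forall>i\<in>{1..N}. t (i - 1) < t i) \<and>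
     (\<forall>i\<in>{1..N}. \<alpha> i > 0 \<and>
        (\<exists>d. \<forall>s\<in>{t (i - 1)..t i}.
           complex_of_real (\<alpha> i) \<notin> spectrum_on V (A s) \<and>
           complex_of_real (- \<alpha> i) \<notin> spectrum_on V (A s) \<and>
           cfinite_dim (spectral_subspace_on V (A s) (- \<alpha> i) (\<alpha> i)) \<and>
           cdim (spectral_subspace_on V (A s) (- \<alpha> i) (\<alpha> i)) = d))"

text \<open>
  The spectral flow over \<open>[a,b]\<close> of the path of restrictions \<open>A s|\<^bsub>V\<^esub>\<close>, as the common value of the
  sums associated with all admissible choices.
\<close>

definition spectral_flow_on ::
    "'a::complex_hilbert set \<Rightarrow> (real \<Rightarrow> 'a \<Rightarrow>\<^sub>L 'a) \<Rightarrow> real \<Rightarrow> real \<Rightarrow> int" where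
  "spectral_flow_on V A a b =
     (THE m. \<exists>N t \<alpha>. spectral_flow_partition V A a b N t \<alpha> \<and>
        m = (\<Sum>i=1..N. int (cdim (spectral_subspace_on V (A (t i)) 0 (\<alpha> i)))
                     - int (cdim (spectral_subspace_on V (A (t (i - 1))) 0 (\<alpha> i)))))"

abbreviation spectral_flow :: "(real \<Rightarrow> 'a::complex_hilbert \<Rightarrow>\<^sub>L 'a) \<Rightarrow> real \<Rightarrow> real \<Rightarrow> int" where
  "spectral_flow \<equiv> spectral_flow_on UNIV"

section \<open>Dihedral symmetry\<close>

definition dihedral_unitary_rep ::
    "nat \<Rightarrow> ('a::complex_hilbert \<Rightarrow> 'a) \<Rightarrow> ('a \<Rightarrow> 'a) \<Rightarrow> bool" where
  "dihedral_unitary_rep n R S \<longleftrightarrow> unitary R \<and> unitary S \<and>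
     R ^^ n = id \<and> S ^^ 2 = id \<and> (S \<circ> R) ^^ 2 = id"

definition rotation_eigenspace :: "nat \<Rightarrow> ('a::complex_hilbert \<Rightarrow> 'a) \<Rightarrow> nat \<Rightarrow> 'a set" where
  "rotation_eigenspace n R k = {x. R x - (exp (2 * of_real pi * \<i> / of_nat n)) ^ k *\<^sub>C x = 0}"

end

theory Submission
  imports Defs
begin

text \<open>
  Why the congruence holds: for one operator \<open>T\<close> commuting with the representation, the spectral
  subspace \<open>W = E\<^bsub>[0,a]\<^esub>(T)\<close> is a finite-dimensional representation of the dihedral group. It is the
  direct sum of the eigenspaces \<open>W\<^sub>k\<close> of \<open>R\<close> for \<open>\<zeta>\<^sup>k\<close>, and \<open>S\<close> exchanges \<open>W\<^sub>k\<close> with \<open>W\<^bsub>n-k\<^esub>\<close> because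
  \<open>S R S = R\<^sup>-\<^sup>1\<close>. Modulo 2 only the indices fixed by \<open>k \<mapsto> n - k\<close> survive, namely \<open>0\<close> and, for even
  \<open>n\<close>, \<open>n/2\<close> (\<open>cdim_mod_2\<close>). The spectral flow is a sum of differences of such dimensions, and one
  partition computes the flows of the path and of its restrictions to the eigenspaces of \<open>R\<close>
  (\<open>common_partition_exists\<close>), so the congruences can be summed.

  This presupposes that the spectral flow is a well-defined number for which spectral subspaces can
  be computed, and most of the text is devoted to that.

  The spectral theorem is obtained from iterates. For a selfadjoint operator \<open>D\<close> the vectors with
  \<open>\<parallel>D\<^sup>k x\<parallel> \<le> r\<^sup>k \<parallel>x\<parallel>\<close> for all \<open>k\<close> form a closed subspace, the growth space, which is the spectral
  subspace for \<open>|D| \<le> r\<close>. On its orthogonal complement \<open>D\<close> is bounded below by \<open>r\<close>, which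
  is seen by splitting \<open>D\<^sup>2\<close> at \<open>r\<^sup>2\<close> with the help of an absolute value of \<open>D\<^sup>2 - r\<^sup>2\<close>; a norm-convergent
  iteration constructs absolute values (\<open>spectral_splitting\<close>). The projections onto growth spaces of
  \<open>T + \<parallel>T\<parallel>\<close> form a resolution of the identity (\<open>resolution_of_identity_exists\<close>). Conversely, every
  resolution of the identity of \<open>T\<close> commutes with \<open>T\<close>, whence its spectral subspace for \<open>[c,d]\<close>
  must be a growth space of \<open>T - (c+d)/2\<close> (\<open>spectral_subspace_eq\<close>). This description makes no reference to a choice of
  projections: it is visibly compatible with restriction to invariant subspaces and with unitaries
  that commute with \<open>T\<close>.

  Dimensions of spectral subspaces whose end points lie outside the spectrum are lower semicontinuous
  under small perturbations: a nonzero vector on which \<open>T - (c+d)/2\<close> is small cannot be orthogonal to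
  the spectral subspace of the perturbed operator. Two such dimensions with a constant sum are
  therefore locally constant, which shows that two windows around \<open>0\<close> on the same interval count the
  same change of dimension (\<open>window_difference\<close>). Windows exist because near a Fredholm operator the
  spectral subspaces for a small interval around \<open>0\<close> can be compared with its kernel in the same way
  (\<open>fredholm_window\<close>). The partial sums of two partitions then differ by a locally
  constant function on \<open>[0,1]\<close>, so the spectral flow does not depend on the partition
  (\<open>spectral_flow_eq\<close>).
\<close>

section \<open>Geometry of the inner product\<close>

lemma cinner_add_right: "cinner x (y + z) = cinner x y + cinner x (z :: 'a::complex_hilbert)"
  by (metis cinner_add_left cinner_commute complex_cnj_add)

lemma cinner_scaleC_right: "cinner x (a *\<^sub>C y) = cnj a * cinner x (y :: 'a::complex_hilbert)"
  by (metis cinner_scaleC_left cinner_commute complex_cnj_mult)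

lemma cinner_scaleR_left: "cinner (r *\<^sub>R x) y = of_real r * cinner x (y :: 'a::complex_hilbert)"
  by (simp add: scaleR_scaleC cinner_scaleC_left)

lemma cinner_scaleR_right: "cinner x (r *\<^sub>R y) = of_real r * cinner x (y :: 'a::complex_hilbert)"
  by (simp add: scaleR_scaleC cinner_scaleC_right)

lemma cinner_zero_left [simp]: "cinner 0 (x :: 'a::complex_hilbert) = 0"
  using cinner_add_left[of 0 0 x] by simp

lemma cinner_zero_right [simp]: "cinner (x :: 'a::complex_hilbert) 0 = 0"
  using cinner_add_right[of x 0 0] by simp

lemma cinner_minus_left: "cinner (- x) y = - cinner x (y :: 'a::complex_hilbert)"
  using cinner_add_left[of x "-x" y] by (simp add: add_eq_0_iff)

lemma cinner_minus_right: "cinner x (- y) = - cinner x (y :: 'a::complex_hilbert)"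
  using cinner_add_right[of x y "-y"] by (simp add: add_eq_0_iff)

lemma cinner_diff_left: "cinner (x - y) z = cinner x z - cinner y (z :: 'a::complex_hilbert)"
  using cinner_add_left[of x "-y" z] by (simp add: cinner_minus_left)

lemma cinner_diff_right: "cinner x (y - z) = cinner x y - cinner x (z :: 'a::complex_hilbert)"
  using cinner_add_right[of x y "-z"] by (simp add: cinner_minus_right)

lemmas cinner_algebra = cinner_add_left cinner_add_right cinner_diff_left cinner_diff_right
  cinner_scaleR_left cinner_scaleR_right cinner_minus_left cinner_minus_right

lemma scaleC_scaleR: "complex_of_real r *\<^sub>C x = r *\<^sub>R (x :: 'a::complex_hilbert)"
  by (simp add: scaleR_scaleC)

lemma scaleC_scaleR_commute: "c *\<^sub>C (r *\<^sub>R x) = r *\<^sub>R (c *\<^sub>C (x :: 'a::complex_hilbert))"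
  by (simp add: scaleR_scaleC scaleC_scaleC mult.commute)

lemma scaleC_diff_right: "a *\<^sub>C (x - y) = a *\<^sub>C x - a *\<^sub>C (y :: 'a::complex_hilbert)"
  by (rule complex_vector.scale_right_diff_distrib)

lemma Re_cinner_self: "Re (cinner x x) = (norm (x :: 'a::complex_hilbert))\<^sup>2"
  by (simp add: cinner_self)

lemma cinner_self_eq_0_iff: "cinner x x = 0 \<longleftrightarrow> (x :: 'a::complex_hilbert) = 0"
  by (simp add: cinner_self)

lemma Re_cinner_commute: "Re (cinner x y) = Re (cinner y (x :: 'a::complex_hilbert))"
  by (metis cinner_commute cnj.simps(1))

lemma cinner_eq_0_commute: "cinner x y = 0 \<longleftrightarrow> cinner y (x :: 'a::complex_hilbert) = 0"
  by (metis cinner_commute complex_cnj_zero)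

lemma norm_add_square:
  "(norm (x + y))\<^sup>2 = (norm x)\<^sup>2 + 2 * Re (cinner x y) + (norm (y :: 'a::complex_hilbert))\<^sup>2"
  by (simp add: Re_cinner_self[symmetric] cinner_algebra Re_cinner_commute[of y x])

lemma norm_diff_square:
  "(norm (x - y))\<^sup>2 = (norm x)\<^sup>2 - 2 * Re (cinner x y) + (norm (y :: 'a::complex_hilbert))\<^sup>2"
  by (simp add: Re_cinner_self[symmetric] cinner_algebra Re_cinner_commute[of y x])

lemma pythagoras:
  "cinner x y = 0 \<Longrightarrow> (norm (x + y))\<^sup>2 = (norm x)\<^sup>2 + (norm (y :: 'a::complex_hilbert))\<^sup>2"
  by (simp add: norm_add_square)

lemma norm_scaleC: "norm (c *\<^sub>C x) = cmod c * norm (x :: 'a::complex_hilbert)"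
proof -
  have "complex_of_real ((norm (c *\<^sub>C x))\<^sup>2) = c * cnj c * of_real ((norm x)\<^sup>2)"
    by (simp only: cinner_self[symmetric] cinner_scaleC_left cinner_scaleC_right mult_ac)
  also have "\<dots> = of_real ((cmod c * norm x)\<^sup>2)"
    by (simp add: complex_norm_square[symmetric] power_mult_distrib)
  finally have "(norm (c *\<^sub>C x))\<^sup>2 = (cmod c * norm x)\<^sup>2"
    by (simp only: of_real_eq_iff)
  then show ?thesis
    by (rule power2_eq_imp_eq) auto
qed

lemma Re_cinner_le: "Re (cinner x y) \<le> norm x * norm (y :: 'a::complex_hilbert)"
proof (cases "x = 0 \<or> y = 0")
  case False
  have "0 \<le> (norm (norm y *\<^sub>R x - norm x *\<^sub>R y))\<^sup>2" by simp
  also have "\<dots> = 2 * (norm x * norm y) * (norm x * norm y - Re (cinner x y))"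
    unfolding norm_diff_square by (simp add: cinner_algebra power2_eq_square algebra_simps)
  finally show ?thesis
    using False by (metis zero_le_mult_iff diff_ge_0_iff_ge mult_pos_pos not_le zero_less_norm_iff zero_less_numeral)
qed auto

lemma cauchy_schwarz: "cmod (cinner x y) \<le> norm x * norm (y :: 'a::complex_hilbert)"
proof (cases "cinner x y = 0")
  case False
  define c where "c = cnj (cinner x y) / cmod (cinner x y)"
  have "cinner (c *\<^sub>C x) y = complex_of_real (cmod (cinner x y))"
    using False complex_norm_square[of "cinner x y"] unfolding c_def cinner_scaleC_left
    by (simp add: field_simps power2_eq_square)
  moreover have "cmod c = 1" using False by (simp add: c_def norm_divide)
  ultimately show ?thesis
    using Re_cinner_le[of "c *\<^sub>C x" y] by (simp add: norm_scaleC)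
qed auto

lemma bounded_bilinear_cinner: "bounded_bilinear (cinner :: 'a::complex_hilbert \<Rightarrow> _)"
proof
  show "\<exists>K. \<forall>(a::'a) b. norm (cinner a b) \<le> norm a * norm b * K"
    using cauchy_schwarz by (intro exI[of _ 1]) auto
qed (simp_all add: cinner_algebra scaleR_conv_of_real)

lemmas tendsto_cinner = bounded_bilinear.tendsto[OF bounded_bilinear_cinner]
lemmas continuous_on_cinner = bounded_bilinear.continuous_on[OF bounded_bilinear_cinner]

lemma bounded_linear_scaleC: "bounded_linear ((*\<^sub>C) c :: 'a::complex_hilbert \<Rightarrow> 'a)"
  by (rule bounded_linear_intro[of _ "cmod c"])
     (simp_all add: scaleC_add_right scaleC_scaleR_commute norm_scaleC mult.commute)

lemmas tendsto_scaleC = bounded_linear.tendsto[OF bounded_linear_scaleC]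

lemma csubspace_scaleR: "csubspace V \<Longrightarrow> x \<in> V \<Longrightarrow> r *\<^sub>R x \<in> V"
  by (simp add: scaleR_scaleC complex_vector.subspace_scale)

lemmas csubspace_simps = complex_vector.subspace_0 complex_vector.subspace_add
  complex_vector.subspace_diff complex_vector.subspace_scale csubspace_scaleR

section \<open>Orthogonal projections\<close>

definition orthogonal_to :: "'a::complex_hilbert \<Rightarrow> 'a set \<Rightarrow> bool" (infix "\<bottom>\<^sub>s" 50) where
  "x \<bottom>\<^sub>s V \<longleftrightarrow> (\<forall>v\<in>V. cinner x v = 0)"

text \<open>A vanishing real part suffices, because \<open>V\<close> is stable under multiplication by \<open>\<i>\<close>.\<close>

lemma orthogonal_toI_Re:
  assumes "csubspace V" "\<And>v. v \<in> V \<Longrightarrow> Re (cinner x v) = 0"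
  shows "x \<bottom>\<^sub>s V"
  unfolding orthogonal_to_def
proof
  fix v assume v: "v \<in> V"
  have "Re (cinner x (\<i> *\<^sub>C v)) = 0" using assms v complex_vector.subspace_scale by blast
  then have "Im (cinner x v) = 0" by (simp add: cinner_scaleC_right)
  with assms(2)[OF v] show "cinner x v = 0" by (simp add: complex_eq_iff)
qed

text \<open>
  A minimizing sequence for the distance from \<open>x\<close> to \<open>V\<close> is Cauchy by the parallelogram law, and
  at the limit \<open>u\<close> the first variation of the distance vanishes.
\<close>

lemma orthogonal_projection_exists:
  fixes V :: "'a::complex_hilbert set"
  assumes V: "closed V" "csubspace V"
  shows "\<exists>u\<in>V. (x - u) \<bottom>\<^sub>s V"
proof -
  define d where "d = (INF v\<in>V. (norm (x - v))\<^sup>2)"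
  have V0: "0 \<in> V" using V complex_vector.subspace_0 by blast
  have bdd: "bdd_below ((\<lambda>v. (norm (x - v))\<^sup>2) ` V)" by (auto intro!: bdd_belowI[of _ 0])
  have d_le: "d \<le> (norm (x - v))\<^sup>2" if "v \<in> V" for v
    unfolding d_def using bdd that by (rule cINF_lower)
  have "\<exists>v\<in>V. (norm (x - v))\<^sup>2 < d + inverse (real (Suc n))" for n
    using cINF_less_iff[OF _ bdd, of "d + inverse (real (Suc n))"] V0
    unfolding d_def by fastforce
  then obtain v where v: "\<And>n. v n \<in> V" "\<And>n. (norm (x - v n))\<^sup>2 < d + inverse (real (Suc n))"
    by metis
  have par: "(norm (v m - v n))\<^sup>2 \<le> 2 * (inverse (real (Suc m)) + inverse (real (Suc n)))" for m n
  proof -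
    define p q where "p = x - v m" and "q = x - v n"
    have "(norm (q - p))\<^sup>2 + (norm (q + p))\<^sup>2 = 2 * (norm p)\<^sup>2 + 2 * (norm q)\<^sup>2"
      unfolding norm_add_square norm_diff_square by simp
    moreover have "(norm (q + p))\<^sup>2 = 4 * (norm (x - (1/2) *\<^sub>R (v m + v n)))\<^sup>2"
    proof -
      have "q + p = 2 *\<^sub>R (x - (1/2) *\<^sub>R (v m + v n))"
        by (simp add: p_def q_def scaleR_2 algebra_simps)
      then show ?thesis by (simp add: power_mult_distrib)
    qed
    moreover have "d \<le> (norm (x - (1/2) *\<^sub>R (v m + v n)))\<^sup>2"
      by (intro d_le csubspace_simps V v)
    moreover have "q - p = v m - v n" by (simp add: p_def q_def)
    ultimately show ?thesis using v(2)[of m] v(2)[of n] by (simp add: p_def q_def)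
  qed
  have "Cauchy v"
  proof (rule metric_CauchyI)
    fix e :: real assume e: "0 < e"
    obtain N where N: "inverse (real (Suc N)) < e\<^sup>2 / 4" using e reals_Archimedean[of "e\<^sup>2 / 4"] by auto
    show "\<exists>M. \<forall>m\<ge>M. \<forall>n\<ge>M. dist (v m) (v n) < e"
    proof (intro exI allI impI)
      fix m n assume mn: "N \<le> m" "N \<le> n"
      have "inverse (real (Suc m)) \<le> inverse (real (Suc N))" "inverse (real (Suc n)) \<le> inverse (real (Suc N))"
        using mn by (auto intro!: le_imp_inverse_le)
      then have "(norm (v m - v n))\<^sup>2 < e\<^sup>2" using order_trans[OF par[of m n]] par[of m n] N by argo
      then show "dist (v m) (v n) < e" using e by (simp add: dist_norm power_less_imp_less_base)
    qed
  qed
  then obtain u where u: "v \<longlonglongrightarrow> u" using Cauchy_convergent_iff convergent_def by blast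
  have uV: "u \<in> V" using V(1) v(1) u closed_sequentially by blast
  have "(\<lambda>n. (norm (x - v n))\<^sup>2) \<longlonglongrightarrow> (norm (x - u))\<^sup>2" by (intro tendsto_intros u)
  moreover have "(\<lambda>n. d + inverse (real (Suc n))) \<longlonglongrightarrow> d + 0"
    by (intro tendsto_intros LIMSEQ_inverse_real_of_nat)
  ultimately have min: "(norm (x - u))\<^sup>2 \<le> d"
    using v(2) by (intro LIMSEQ_le[of _ _ "\<lambda>n. d + inverse (real (Suc n))"]) (auto intro: less_imp_le)
  have "(x - u) \<bottom>\<^sub>s V"
  proof (rule orthogonal_toI_Re[OF V(2)])
    fix w assume w: "w \<in> V"
    define b where "b = Re (cinner (x - u) w)"
    define t where "t = b / (1 + (norm w)\<^sup>2)"
    have pos: "0 < 1 + (norm w)\<^sup>2" by (smt (verit) zero_le_power2)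
    have "d \<le> (norm (x - (u + t *\<^sub>R w)))\<^sup>2"
      by (intro d_le csubspace_simps V uV w)
    also have "x - (u + t *\<^sub>R w) = (x - u) - t *\<^sub>R w" by simp
    also have "(norm ((x - u) - t *\<^sub>R w))\<^sup>2 = (norm (x - u))\<^sup>2 - 2 * t * b + t\<^sup>2 * (norm w)\<^sup>2"
      unfolding norm_diff_square b_def by (simp add: cinner_scaleR_right power_mult_distrib)
    finally have "2 * t * b \<le> t\<^sup>2 * (norm w)\<^sup>2" using min by simp
    also have "\<dots> \<le> t\<^sup>2 * (1 + (norm w)\<^sup>2)" by (simp add: mult_left_mono)
    also have "\<dots> = t * b" using pos by (simp add: t_def power2_eq_square)
    finally have "t * b \<le> 0" by (simp add: mult_ac)
    moreover have "t * b = b\<^sup>2 / (1 + (norm w)\<^sup>2)" by (simp add: t_def power2_eq_square)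
    ultimately show "Re (cinner (x - u) w) = 0"
      using pos by (simp add: b_def divide_le_0_iff)
  qed
  with uV show ?thesis by blast
qed

definition proj :: "'a::complex_hilbert set \<Rightarrow> 'a \<Rightarrow> 'a" where
  "proj V x = (SOME u. u \<in> V \<and> (x - u) \<bottom>\<^sub>s V)"

locale closed_csubspace =
  fixes V :: "'a::complex_hilbert set"
  assumes closed: "closed V" and csubspace: "csubspace V"
begin

lemmas mem_simps = csubspace_simps[OF csubspace]

lemma proj_in: "proj V x \<in> V" and proj_orthogonal: "(x - proj V x) \<bottom>\<^sub>s V"
proof -
  have "proj V x \<in> V \<and> (x - proj V x) \<bottom>\<^sub>s V"
    unfolding proj_def by (rule someI_ex) (use orthogonal_projection_exists[OF closed csubspace] in blast)
  then show "proj V x \<in> V" "(x - proj V x) \<bottom>\<^sub>s V" by auto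
qed

lemma proj_unique:
  assumes "u \<in> V" "(x - u) \<bottom>\<^sub>s V"
  shows "proj V x = u"
proof -
  define w where "w = proj V x - u"
  have w: "w \<in> V" unfolding w_def by (intro mem_simps proj_in assms)
  have "cinner (x - u) w - cinner (x - proj V x) w = 0"
    using assms(2) proj_orthogonal[of x] w by (auto simp: orthogonal_to_def)
  moreover have "cinner (x - u) w - cinner (x - proj V x) w = cinner w w"
    unfolding w_def by (simp flip: cinner_diff_left)
  ultimately have "cinner w w = 0" by simp
  then show ?thesis by (simp add: cinner_self_eq_0_iff w_def)
qed

lemma proj_id: "x \<in> V \<Longrightarrow> proj V x = x"
  by (rule proj_unique) (auto simp: orthogonal_to_def)

lemma proj_eq_0_iff: "proj V x = 0 \<longleftrightarrow> x \<bottom>\<^sub>s V"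
  using proj_unique[of 0 x] proj_orthogonal[of x] mem_simps(1) by auto

lemma proj_add: "proj V (x + y) = proj V x + proj V y"
proof (rule proj_unique)
  show "proj V x + proj V y \<in> V" by (intro mem_simps proj_in)
  have "x + y - (proj V x + proj V y) = (x - proj V x) + (y - proj V y)" by simp
  then show "x + y - (proj V x + proj V y) \<bottom>\<^sub>s V"
    using proj_orthogonal[of x] proj_orthogonal[of y] unfolding orthogonal_to_def
    by (simp only: cinner_add_left) simp
qed

lemma proj_scaleC: "proj V (c *\<^sub>C x) = c *\<^sub>C proj V x"
proof (rule proj_unique)
  show "c *\<^sub>C proj V x \<in> V" by (intro mem_simps proj_in)
  have "c *\<^sub>C x - c *\<^sub>C proj V x = c *\<^sub>C (x - proj V x)" by (simp add: scaleC_diff_right)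
  then show "c *\<^sub>C x - c *\<^sub>C proj V x \<bottom>\<^sub>s V"
    using proj_orthogonal[of x] by (simp add: orthogonal_to_def cinner_scaleC_left)
qed

lemma proj_diff: "proj V (x - y) = proj V x - proj V y"
  using proj_add[of "x - y" y] by (simp add: algebra_simps)

lemma proj_pythagoras: "(norm x)\<^sup>2 = (norm (proj V x))\<^sup>2 + (norm (x - proj V x))\<^sup>2"
  using pythagoras[of "x - proj V x" "proj V x"] proj_orthogonal[of x] proj_in[of x]
  by (simp add: orthogonal_to_def)

lemma norm_proj_le: "norm (proj V x) \<le> norm x"
  using proj_pythagoras[of x] by (metis add_increasing2 power2_le_imp_le norm_ge_zero order_refl zero_le_power2)

lemma cinner_proj_left: "cinner (proj V x) y = cinner (proj V x) (proj V y)"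
  using proj_orthogonal[of y] proj_in[of x] cinner_eq_0_commute[of "proj V x" "y - proj V y"]
  by (simp add: orthogonal_to_def cinner_diff_right)

lemma cinner_proj_right: "cinner x (proj V y) = cinner (proj V x) (proj V y)"
  using proj_orthogonal[of x] proj_in[of y] by (simp add: orthogonal_to_def cinner_diff_left)

lemma cinner_proj_of_mem: "x \<in> V \<Longrightarrow> cinner x (proj V y) = cinner x y"
  using proj_orthogonal[of y] cinner_eq_0_commute[of x "y - proj V y"]
  by (simp add: orthogonal_to_def cinner_diff_right)

lemma proj_commute:
  assumes add: "\<And>x y. f (x - y) = f x - f y"
    and V: "\<And>x. x \<in> V \<Longrightarrow> f x \<in> V" and perp: "\<And>x. x \<bottom>\<^sub>s V \<Longrightarrow> f x \<bottom>\<^sub>s V"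
  shows "proj V (f x) = f (proj V x)"
proof (rule proj_unique)
  show "f (proj V x) \<in> V" using V proj_in by blast
  show "f x - f (proj V x) \<bottom>\<^sub>s V" using perp[OF proj_orthogonal[of x]] by (simp add: add)
qed

end

section \<open>Finite-dimensional subspaces\<close>

global_interpretation complex_pair: vector_space_pair
  "scaleC :: complex \<Rightarrow> 'a \<Rightarrow> 'a::complex_hilbert" "scaleC :: complex \<Rightarrow> 'b \<Rightarrow> 'b::complex_hilbert"
  by unfold_locales

lemma cfinite_dim_subset: "cfinite_dim W \<Longrightarrow> V \<subseteq> W \<Longrightarrow> cfinite_dim V"
  unfolding cfinite_dim_def by blast

lemma cfinite_dim_basis:
  assumes "cfinite_dim V" "csubspace V"
  obtains B where "finite B" "B \<subseteq> V" "\<not> cdependent B" "cspan B = V" "card B = cdim V"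
proof -
  obtain B where B: "B \<subseteq> V" "\<not> cdependent B" "V \<subseteq> cspan B" "card B = cdim V"
    using complex_vector.basis_exists[of V] by blast
  obtain C where C: "finite C" "V \<subseteq> cspan C" using assms(1) unfolding cfinite_dim_def by blast
  have "finite B" using complex_vector.independent_span_bound[OF C(1) B(2)] B(1) C(2) by blast
  moreover have "cspan B = V" by (rule complex_vector.span_subspace) (use B assms(2) in auto)
  ultimately show thesis using B that by blast
qed

lemma cdim_le_of_injective:
  fixes f :: "'a::complex_hilbert \<Rightarrow> 'a"
  assumes f: "clinear_op f" and X: "csubspace X" and Y: "csubspace Y" "cfinite_dim Y"
    and fXY: "\<And>x. x \<in> X \<Longrightarrow> f x \<in> Y" and inj: "\<And>x. x \<in> X \<Longrightarrow> f x = 0 \<Longrightarrow> x = 0"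
  shows "cfinite_dim X" "cdim X \<le> cdim Y"
proof -
  obtain B where B: "B \<subseteq> X" "\<not> cdependent B" "X \<subseteq> cspan B" "card B = cdim X"
    using complex_vector.basis_exists[of X] by blast
  have sB: "cspan B = X" by (rule complex_vector.span_subspace) (use B X in auto)
  obtain C where C: "finite C" "C \<subseteq> Y" "cspan C = Y" "card C = cdim Y"
    using cfinite_dim_basis[OF Y(2,1)] by metis
  have lin: "Vector_Spaces.linear scaleC scaleC f"
    using f unfolding clinear_op_def Vector_Spaces.linear_iff
    by (simp add: complex_vector.vector_space_axioms)
  have injX: "inj_on f X"
  proof (rule inj_onI)
    fix x y assume xy: "x \<in> X" "y \<in> X" "f x = f y"
    have "f x = f (x - y) + f y" using f by (metis clinear_op_def diff_add_cancel)
    then have "f (x - y) = 0" using xy by simp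
    then show "x = y" using inj[of "x - y"] xy complex_vector.subspace_diff[OF X] by auto
  qed
  have ind: "\<not> cdependent (f ` B)"
    by (rule complex_pair.linear_independent_injective_image[OF lin B(2)]) (simp add: sB injX)
  have "f ` B \<subseteq> cspan C" using B(1) fXY C(3) by auto
  then have fin: "finite (f ` B)" "card (f ` B) \<le> card C"
    using complex_vector.independent_span_bound[OF C(1) ind] by auto
  have injB: "inj_on f B" using injX B(1) inj_on_subset by blast
  have "finite B" using finite_imageD[OF fin(1) injB] .
  then show "cfinite_dim X" using B(3) unfolding cfinite_dim_def by blast
  show "cdim X \<le> cdim Y" using fin(2) card_image[OF injB] B(4) C(4) by simp
qed

text \<open>
  The projection onto \<open>Y\<close> is injective on \<open>X\<close>. This comparison of dimensions is behind every
  continuity statement for spectral subspaces.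
\<close>

lemma cdim_le_of_no_orthogonal:
  assumes X: "csubspace X" and Y: "closed Y" "csubspace Y" "cfinite_dim Y"
    and none: "\<And>x. x \<in> X \<Longrightarrow> x \<bottom>\<^sub>s Y \<Longrightarrow> x = 0"
  shows "cfinite_dim X" "cdim X \<le> cdim Y"
proof -
  interpret Y: closed_csubspace Y by unfold_locales (use Y in auto)
  have "clinear_op (proj Y)" by (simp add: clinear_op_def Y.proj_add Y.proj_scaleC)
  from cdim_le_of_injective[OF this X Y(2,3)] none Y.proj_in Y.proj_eq_0_iff
  show "cfinite_dim X" "cdim X \<le> cdim Y" by auto
qed

lemma cdim_eq_of_bijection:
  fixes f :: "'a::complex_hilbert \<Rightarrow> 'a"
  assumes f: "clinear_op f" "clinear_op g"
    and X: "csubspace X" "cfinite_dim X" and Y: "csubspace Y" "cfinite_dim Y"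
    and fXY: "\<And>x. x \<in> X \<Longrightarrow> f x \<in> Y" "\<And>x. x \<in> X \<Longrightarrow> f x = 0 \<Longrightarrow> x = 0"
    and gYX: "\<And>y. y \<in> Y \<Longrightarrow> g y \<in> X" "\<And>y. y \<in> Y \<Longrightarrow> g y = 0 \<Longrightarrow> y = 0"
  shows "cdim X = cdim Y"
  by (rule antisym) (use cdim_le_of_injective(2) assms in blast)+

lemma cdim_direct_sum:
  assumes X: "csubspace X" "cfinite_dim X" and Y: "csubspace Y" "cfinite_dim Y"
    and disj: "\<And>x. x \<in> X \<Longrightarrow> x \<in> Y \<Longrightarrow> x = 0"
    and Z: "\<And>x y. x \<in> X \<Longrightarrow> y \<in> Y \<Longrightarrow> x + y \<in> Z" "\<And>z. z \<in> Z \<Longrightarrow> \<exists>x\<in>X. \<exists>y\<in>Y. z = x + y"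
  shows "cdim Z = cdim X + cdim Y"
proof -
  obtain B where B: "finite B" "B \<subseteq> X" "\<not> cdependent B" "cspan B = X" "card B = cdim X"
    using cfinite_dim_basis[OF X(2,1)] by metis
  obtain C where C: "finite C" "C \<subseteq> Y" "\<not> cdependent C" "cspan C = Y" "card C = cdim Y"
    using cfinite_dim_basis[OF Y(2,1)] by metis
  have BC: "B \<inter> C = {}"
    using disj B(2,3) C(2) complex_vector.dependent_zero by blast
  have "\<not> cdependent (B \<union> C)"
  proof (rule complex_vector.independent_if_scalars_zero)
    fix u v assume sum0: "(\<Sum>x\<in>B \<union> C. u x *\<^sub>C x) = 0" and v: "v \<in> B \<union> C"
    define b where "b = (\<Sum>x\<in>B. u x *\<^sub>C x)"
    define c where "c = (\<Sum>x\<in>C. u x *\<^sub>C x)"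
    have bX: "b \<in> X" unfolding b_def
      by (intro complex_vector.subspace_sum[OF X(1)] complex_vector.subspace_scale[OF X(1)]) (use B(2) in auto)
    have cY: "c \<in> Y" unfolding c_def
      by (intro complex_vector.subspace_sum[OF Y(1)] complex_vector.subspace_scale[OF Y(1)]) (use C(2) in auto)
    have bc: "b + c = 0" using sum0 unfolding sum.union_disjoint[OF B(1) C(1) BC] by (simp add: b_def c_def)
    then have "b = 0" using disj[of b] bX cY complex_vector.subspace_neg[OF Y(1) cY] by (simp add: add_eq_0_iff2)
    with bc have "c = 0" by simp
    show "u v = 0"
      using v complex_vector.independentD[OF B(3,1) subset_refl, of u v] \<open>b = 0\<close>
        complex_vector.independentD[OF C(3,1) subset_refl, of u v] \<open>c = 0\<close>
      by (auto simp: b_def c_def)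
  qed (use B C in auto)
  moreover have "B \<union> C \<subseteq> Z"
  proof
    fix x assume "x \<in> B \<union> C"
    then show "x \<in> Z"
      using Z(1)[of x 0] Z(1)[of 0 x] B(2) C(2) complex_vector.subspace_0[OF X(1)]
        complex_vector.subspace_0[OF Y(1)] by auto
  qed
  moreover have "Z \<subseteq> cspan (B \<union> C)"
  proof
    fix z assume "z \<in> Z"
    then obtain x y where "x \<in> cspan B" "y \<in> cspan C" "z = x + y" using Z(2) B(4) C(4) by blast
    then show "z \<in> cspan (B \<union> C)" unfolding complex_vector.span_Un by blast
  qed
  ultimately have "card (B \<union> C) = cdim Z" by (intro complex_vector.basis_card_eq_dim)
  then show ?thesis using card_Un_disjoint[OF B(1) C(1) BC] B(5) C(5) by simp
qed

lemma cdim_zero_subspace: "cdim {0 :: 'a::complex_hilbert} = 0"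
  using complex_vector.dim_eq_card_independent[of "{} :: 'a set"] complex_vector.dim_span[of "{} :: 'a set"]
  by (simp add: complex_vector.independent_empty)

section \<open>Stieltjes integrals of the identity\<close>

text \<open>
  For increasing \<open>F\<close> these inequalities say that \<open>J v - J u\<close> is the integral of the identity over
  \<open>(u,v]\<close> with respect to \<open>dF\<close>.
\<close>

definition stieltjes_primitive :: "(real \<Rightarrow> real) \<Rightarrow> (real \<Rightarrow> real) \<Rightarrow> bool" where
  "stieltjes_primitive F J \<longleftrightarrow>
     (\<forall>u v. u \<le> v \<longrightarrow> u * (F v - F u) \<le> J v - J u \<and> J v - J u \<le> v * (F v - F u))"

lemma stieltjes_primitive_add:
  "stieltjes_primitive F J \<Longrightarrow> stieltjes_primitive G K \<Longrightarrow>
    stieltjes_primitive (\<lambda>s. F s + G s) (\<lambda>s. J s + K s)"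
  unfolding stieltjes_primitive_def by (fastforce simp: algebra_simps)

text \<open>
  Two primitives differ by a function whose increment over an interval of length \<open>h\<close> is at most \<open>h\<close>
  times the increment of \<open>F\<close>; cutting an interval into \<open>m\<close> equal pieces gains a factor \<open>1/m\<close>.
\<close>

lemma stieltjes_primitive_unique:
  assumes J: "stieltjes_primitive F J" and K: "stieltjes_primitive F K" and uv: "u \<le> v"
  shows "J v - J u = K v - K u"
proof -
  define D where "D s = J s - K s" for s
  have D: "\<bar>D q - D p\<bar> \<le> (q - p) * (F q - F p)" if "p \<le> q" for p q
    using J K that unfolding stieltjes_primitive_def D_def
    by (smt (verit, ccfv_SIG) left_diff_distrib)
  define c where "c = (v - u) * (F v - F u)"
  have le: "\<bar>D v - D u\<bar> * real m \<le> c" if m: "m > 0" for m :: nat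
  proof -
    define h where "h = (v - u) / m"
    define p where "p i = u + real i * h" for i :: nat
    have h: "h \<ge> 0" using uv by (simp add: h_def)
    have ends: "p 0 = u" "p m = v" using m by (simp_all add: p_def h_def)
    have step: "\<bar>D (p (Suc i)) - D (p i)\<bar> \<le> h * (F (p (Suc i)) - F (p i))" for i
      using D[of "p i" "p (Suc i)"] h by (simp add: p_def algebra_simps)
    have "\<bar>D v - D u\<bar> = \<bar>\<Sum>i<m. D (p (Suc i)) - D (p i)\<bar>"
      using sum_lessThan_telescope[of "\<lambda>i. D (p i)" m] by (simp add: ends)
    also have "\<dots> \<le> (\<Sum>i<m. h * (F (p (Suc i)) - F (p i)))"
      by (rule order_trans[OF sum_abs sum_mono]) (rule step)
    also have "\<dots> = h * (F v - F u)"
      using sum_lessThan_telescope[of "\<lambda>i. F (p i)" m] by (simp add: sum_distrib_left[symmetric] ends)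
    finally show ?thesis using m by (simp add: h_def c_def field_simps)
  qed
  have "D v - D u = 0"
  proof (rule ccontr)
    assume "D v - D u \<noteq> 0"
    then have pos: "0 < \<bar>D v - D u\<bar>" by simp
    obtain m :: nat where m: "c < real m * \<bar>D v - D u\<bar>" using ex_less_of_nat_mult[OF pos] by blast
    show False using m le[of m] le[of "Suc m"] pos by (cases "m = 0") (auto simp: algebra_simps)
  qed
  then show ?thesis by (simp add: D_def)
qed

text \<open>
  The measure lives on a bounded interval, so \<open>J s\<close> can be taken to be the integral of the identity
  over \<open>(-\<infinity>,s]\<close>.
\<close>

lemma stieltjes_primitive_integral:
  fixes F :: "real \<Rightarrow> real"
  assumes mono: "\<And>u v. u \<le> v \<Longrightarrow> F u \<le> F v" and right: "\<And>s. continuous (at_right s) F"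
    and low: "\<And>s. s < - M \<Longrightarrow> F s = 0" and high: "\<And>s. s \<ge> M \<Longrightarrow> F s = F M"
  obtains J where "stieltjes_primitive F J" "\<And>s. s < - M \<Longrightarrow> J s = 0"
    "\<And>s. s \<ge> M \<Longrightarrow> J s = (\<integral>s. s \<partial>interval_measure F)"
proof -
  define \<mu> where "\<mu> = interval_measure F"
  have em: "emeasure \<mu> {a<..b} = ennreal (F b - F a)" if "a \<le> b" for a b
    unfolding \<mu>_def using that mono right by (intro emeasure_interval_measure_Ioc) auto
  have sets: "sets \<mu> = sets borel" by (simp add: \<mu>_def)
  have space: "space \<mu> = UNIV" by (simp add: \<mu>_def)
  have nulllow: "{..c} \<in> null_sets \<mu>" if "c < - M" for c
  proof -
    have "{..c} = (\<Union>n::nat. {c - real n - 1 <..c})"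
    proof (intro equalityI subsetI)
      fix x assume "x \<in> {..c}"
      moreover obtain n :: nat where "c - x < real n" using reals_Archimedean2 by blast
      ultimately have "x \<in> {c - real n - 1 <..c}" by auto
      then show "x \<in> (\<Union>n::nat. {c - real n - 1 <..c})" by blast
    qed auto
    moreover have "{c - real n - 1 <..c} \<in> null_sets \<mu>" for n
      using em[of "c - real n - 1" c] low[of c] low[of "c - real n - 1"] that
      by (auto simp: null_sets_def sets)
    ultimately show ?thesis using null_sets_UN[of "\<lambda>n::nat. {c - real n - 1 <..c}" \<mu>] by simp
  qed
  have nullhigh: "{M<..} \<in> null_sets \<mu>"
  proof -
    have "{M<..} = (\<Union>n::nat. {M<..M + real n})"
    proof (intro equalityI subsetI)
      fix x assume "x \<in> {M<..}"
      moreover obtain n :: nat where "x - M < real n" using reals_Archimedean2 by blast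
      ultimately have "x \<in> {M<..M + real n}" by auto
      then show "x \<in> (\<Union>n::nat. {M<..M + real n})" by blast
    qed auto
    moreover have "{M<..M + real n} \<in> null_sets \<mu>" for n
      using em[of M "M + real n"] high[of "M + real n"] by (auto simp: null_sets_def sets)
    ultimately show ?thesis using null_sets_UN[of "\<lambda>n::nat. {M<..M + real n}" \<mu>] by simp
  qed
  \<comment> \<open>The minimum matters because \<open>M\<close> may be negative, in which case \<open>F = 0\<close>.\<close>
  define m where "m = min (- M - 1) M"
  have AE: "AE s in \<mu>. s \<in> {m<..M}"
  proof (rule AE_I')
    show "{..m} \<union> {M<..} \<in> null_sets \<mu>"
      using nullhigh nulllow[of m] by (intro null_sets.Un) (auto simp: m_def)
  qed auto
  have mM: "m \<le> M" "m < - M" by (auto simp: m_def)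
  interpret finite_measure \<mu>
  proof
    have "emeasure \<mu> (space \<mu>) = emeasure \<mu> {m<..M}"
      by (rule emeasure_eq_AE) (use AE in \<open>auto simp: space sets\<close>)
    then show "emeasure \<mu> (space \<mu>) \<noteq> \<infinity>" using em[OF mM(1)] by simp
  qed
  have int: "integrable \<mu> (\<lambda>s. indicator S s * s)" if "S \<in> sets borel" for S
  proof (rule integrable_const_bound[of _ "\<bar>m\<bar> + \<bar>M\<bar>"])
    show "AE s in \<mu>. norm (indicator S s * s) \<le> \<bar>m\<bar> + \<bar>M\<bar>"
      using AE by eventually_elim (auto simp: indicator_def)
    show "(\<lambda>s. indicator S s * s) \<in> borel_measurable \<mu>"
      using that by (simp add: measurable_cong_sets[OF sets refl])
  qed
  define J where "J s = (\<integral>r. indicator {..s} r * r \<partial>\<mu>)" for s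
  have "stieltjes_primitive F J"
    unfolding stieltjes_primitive_def
  proof (intro allI impI)
    fix u v :: real assume uv: "u \<le> v"
    have "J v - J u = (\<integral>r. indicator {..v} r * r - indicator {..u} r * r \<partial>\<mu>)"
      unfolding J_def by (rule Bochner_Integration.integral_diff[symmetric]) (auto intro!: int)
    also have "\<dots> = (\<integral>r. indicator {u<..v} r * r \<partial>\<mu>)"
      by (intro Bochner_Integration.integral_cong) (use uv in \<open>auto simp: indicator_def\<close>)
    finally have eq: "J v - J u = \<dots>" .
    have meas: "measure \<mu> {u<..v} = F v - F u"
      using em[OF uv] mono[OF uv] by (simp add: measure_def)
    have ic: "integrable \<mu> (\<lambda>r. indicator {u<..v} r * c)" for c :: real
      by (intro integrable_mult_left integrable_real_indicator) (auto simp: sets less_top[symmetric])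
    have cc: "(\<integral>r. indicator {u<..v} r * c \<partial>\<mu>) = c * (F v - F u)" for c :: real
      using meas by (simp add: space)
    show "u * (F v - F u) \<le> J v - J u \<and> J v - J u \<le> v * (F v - F u)"
      unfolding eq cc[symmetric]
      by (intro conjI integral_mono ic int) (auto simp: indicator_def)
  qed
  moreover have "J s = 0" if "s < - M" for s
  proof -
    have "AE r in \<mu>. indicator {..s} r * r = 0"
      using AE_not_in[OF nulllow[OF that]] by eventually_elim (auto simp: indicator_def)
    then show ?thesis unfolding J_def by (rule integral_eq_zero_AE)
  qed
  moreover have "J s = (\<integral>s. s \<partial>interval_measure F)" if "s \<ge> M" for s
    unfolding J_def \<mu>_def[symmetric]
  proof (rule integral_cong_AE)
    show "AE x in \<mu>. indicator {..s} x * x = x"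
      using AE_not_in[OF nullhigh] by eventually_elim (use that in \<open>auto simp: indicator_def\<close>)
  qed (simp_all add: measurable_cong_sets[OF sets refl])
  ultimately show thesis using that by blast
qed

section \<open>Absolute values of selfadjoint operators\<close>

lemma selfadjoint_scaleC: "selfadjoint T \<Longrightarrow> blinfun_apply T (c *\<^sub>C x) = c *\<^sub>C T x"
  unfolding selfadjoint_def clinear_op_def by blast

lemma selfadjoint_cinner: "selfadjoint T \<Longrightarrow> cinner (blinfun_apply T x) y = cinner x (T y)"
  unfolding selfadjoint_def by blast

lemma selfadjointI:
  assumes "\<And>c x. blinfun_apply T (c *\<^sub>C x) = c *\<^sub>C T x"
    and "\<And>x y. cinner (blinfun_apply T x) y = cinner x (T y)"
  shows "selfadjoint T"
  using assms by (auto simp: selfadjoint_def clinear_op_def blinfun.add_right)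

lemma cinner_form_real:
  assumes "selfadjoint T"
  shows "cinner (blinfun_apply T x) x = of_real (Re (cinner (T x) x))"
proof -
  have "cnj (cinner (T x) x) = cinner (T x) x"
    using cinner_commute[of "blinfun_apply T x" x] by (simp add: selfadjoint_cinner[OF assms])
  then show ?thesis by (simp add: complex_eq_iff)
qed

lemma selfadjoint_id: "selfadjoint id_blinfun"
  by (rule selfadjointI) auto

lemma selfadjoint_zero: "selfadjoint 0"
  by (rule selfadjointI) (auto simp: complex_vector.scale_zero_right)

lemma selfadjoint_add: "selfadjoint T \<Longrightarrow> selfadjoint U \<Longrightarrow> selfadjoint (T + U)"
  by (rule selfadjointI)
    (simp_all add: blinfun.add_left selfadjoint_scaleC selfadjoint_cinner scaleC_add_right cinner_algebra)

lemma selfadjoint_diff: "selfadjoint T \<Longrightarrow> selfadjoint U \<Longrightarrow> selfadjoint (T - U)"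
  by (rule selfadjointI)
    (simp_all add: blinfun.diff_left selfadjoint_scaleC selfadjoint_cinner scaleC_diff_right cinner_algebra)

lemma selfadjoint_scaleR: "selfadjoint T \<Longrightarrow> selfadjoint (r *\<^sub>R T)"
  by (rule selfadjointI)
    (simp_all add: blinfun.scaleR_left selfadjoint_scaleC selfadjoint_cinner scaleC_scaleR_commute cinner_algebra)

lemma selfadjoint_square: "selfadjoint T \<Longrightarrow> selfadjoint (T o\<^sub>L T)"
  by (rule selfadjointI) (simp_all add: selfadjoint_scaleC selfadjoint_cinner)

lemma tendsto_blinfun_at: "Y \<longlonglongrightarrow> Z \<Longrightarrow> (\<lambda>n. blinfun_apply (Y n) x) \<longlonglongrightarrow> blinfun_apply Z x"
  by (intro blinfun.tendsto tendsto_const)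

lemma selfadjoint_limit:
  assumes "\<And>n. selfadjoint (Y n)" "Y \<longlonglongrightarrow> Z"
  shows "selfadjoint Z"
proof (rule selfadjointI)
  fix c x y
  have "(\<lambda>n. Y n (c *\<^sub>C x)) \<longlonglongrightarrow> c *\<^sub>C Z x"
    using tendsto_scaleC[OF tendsto_blinfun_at[OF assms(2)]] by (simp add: selfadjoint_scaleC[OF assms(1)])
  then show "Z (c *\<^sub>C x) = c *\<^sub>C Z x"
    using LIMSEQ_unique tendsto_blinfun_at[OF assms(2)] by blast
  have "(\<lambda>n. cinner (Y n x) y) \<longlonglongrightarrow> cinner (Z x) y" "(\<lambda>n. cinner x (Y n y)) \<longlonglongrightarrow> cinner x (Z y)"
    by (intro tendsto_cinner tendsto_blinfun_at assms tendsto_const)+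
  then show "cinner (Z x) y = cinner x (Z y)"
    using LIMSEQ_unique by (simp add: selfadjoint_cinner[OF assms(1)])
qed

text \<open>
  If \<open>Y = (X + Y\<^sup>2)/2\<close>, then \<open>1 - Y\<close> is a square root of \<open>1 - X\<close>. The fixed point iteration is
  dominated by the scalar iteration for \<open>X = 1\<close>, which increases to \<open>1\<close>; this makes it converge in
  norm without any functional calculus.
\<close>

primrec sqrt_iterate :: "('a::complex_hilbert \<Rightarrow>\<^sub>L 'a) \<Rightarrow> nat \<Rightarrow> 'a \<Rightarrow>\<^sub>L 'a" where
  "sqrt_iterate X 0 = 0"
| "sqrt_iterate X (Suc n) = (1/2) *\<^sub>R (X + (sqrt_iterate X n o\<^sub>L sqrt_iterate X n))"

primrec sqrt_majorant :: "nat \<Rightarrow> real" where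
  "sqrt_majorant 0 = 0"
| "sqrt_majorant (Suc n) = (1 + (sqrt_majorant n)\<^sup>2) / 2"

lemma sqrt_majorant_bounds: "0 \<le> sqrt_majorant n" "sqrt_majorant n \<le> 1"
  by (induction n) (auto simp: power_le_one)

lemma sqrt_majorant_mono: "sqrt_majorant n \<le> sqrt_majorant (Suc n)"
  using zero_le_power2[of "1 - sqrt_majorant n"] by (simp add: power2_diff)

lemma norm_sqrt_iterate:
  assumes "norm X \<le> 1"
  shows "norm (sqrt_iterate X n) \<le> sqrt_majorant n"
proof (induction n)
  case (Suc n)
  have "norm (sqrt_iterate X n o\<^sub>L sqrt_iterate X n) \<le> sqrt_majorant n * sqrt_majorant n"
    by (rule order_trans[OF norm_blinfun_compose mult_mono]) (use Suc in \<open>auto simp: sqrt_majorant_bounds\<close>)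
  then show ?case
    using norm_triangle_ineq[of X "(sqrt_iterate X n o\<^sub>L sqrt_iterate X n)"] assms
    by (simp add: power2_eq_square)
qed simp

lemma norm_sqrt_iterate_step:
  assumes "norm X \<le> 1"
  shows "norm (sqrt_iterate X (Suc n) - sqrt_iterate X n) \<le> sqrt_majorant (Suc n) - sqrt_majorant n"
proof (induction n)
  case 0
  then show ?case using assms by simp
next
  case (Suc n)
  let ?Y = "sqrt_iterate X" and ?y = sqrt_majorant
  have "?Y (Suc (Suc n)) - ?Y (Suc n) =
      (1/2) *\<^sub>R ((?Y (Suc n) o\<^sub>L (?Y (Suc n) - ?Y n)) + ((?Y (Suc n) - ?Y n) o\<^sub>L ?Y n))"
  proof -
    have eq: "(1/2) *\<^sub>R (X + (P o\<^sub>L P)) - (1/2) *\<^sub>R (X + (Q o\<^sub>L Q)) =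
        (1/2) *\<^sub>R ((P o\<^sub>L (P - Q)) + ((P - Q) o\<^sub>L Q))" for P Q
      by (rule blinfun_eqI) (simp add: blinfun.diff_left blinfun.add_left blinfun.scaleR_left
        blinfun.diff_right scaleR_add_right scaleR_diff_right)
    show ?thesis unfolding eq[symmetric] by (simp only: sqrt_iterate.simps(2))
  qed
  also have "norm \<dots> \<le> (1/2) * (?y (Suc n) * (?y (Suc n) - ?y n) + (?y (Suc n) - ?y n) * ?y n)"
  proof -
    have "norm (?Y (Suc n) o\<^sub>L (?Y (Suc n) - ?Y n)) \<le> ?y (Suc n) * (?y (Suc n) - ?y n)"
      by (rule order_trans[OF norm_blinfun_compose mult_mono])
        (use Suc norm_sqrt_iterate[OF assms, of "Suc n"] sqrt_majorant_bounds[of "Suc n"] in auto)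
    moreover have "norm ((?Y (Suc n) - ?Y n) o\<^sub>L ?Y n) \<le> (?y (Suc n) - ?y n) * ?y n"
      by (rule order_trans[OF norm_blinfun_compose mult_mono])
        (use Suc norm_sqrt_iterate[OF assms, of n] sqrt_majorant_mono[of n] in auto)
    ultimately show ?thesis
      using norm_triangle_ineq[of "?Y (Suc n) o\<^sub>L (?Y (Suc n) - ?Y n)" "(?Y (Suc n) - ?Y n) o\<^sub>L ?Y n"]
      by simp
  qed
  also have "\<dots> = ?y (Suc (Suc n)) - ?y (Suc n)"
  proof -
    have "?y (Suc (Suc n)) - ?y (Suc n) = ((?y (Suc n))\<^sup>2 - (?y n)\<^sup>2) / 2"
      unfolding sqrt_majorant.simps(2)[of "Suc n"] by (subst (2) sqrt_majorant.simps(2)) (simp add: field_simps)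
    then show ?thesis by (simp only: power2_eq_square) (simp add: algebra_simps)
  qed
  finally show ?case .
qed

lemma sqrt_iterate_commute:
  fixes X :: "'a::complex_hilbert \<Rightarrow>\<^sub>L 'a"
  assumes "\<And>x. blinfun_apply U (X x) = X (U x)"
  shows "U (sqrt_iterate X n x) = sqrt_iterate X n (U x)"
  by (induction n arbitrary: x)
    (simp_all add: assms blinfun.scaleR_left blinfun.scaleR_right blinfun.add_left blinfun.add_right)

lemma square_root_exists:
  assumes X: "selfadjoint X" "norm X \<le> 1"
  obtains Y where "selfadjoint Y" "norm Y \<le> 1"
    "\<And>x. blinfun_apply X x + Y (Y x) = 2 *\<^sub>R Y x"
    "\<And>U x. (\<And>x. blinfun_apply U (X x) = X (U x)) \<Longrightarrow> U (Y x) = Y (U x)"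
proof -
  let ?Y = "sqrt_iterate X" and ?y = sqrt_majorant
  have inc: "incseq ?y" by (rule incseq_SucI) (rule sqrt_majorant_mono)
  have "convergent ?y"
    by (rule Bseq_mono_convergent)
      (use sqrt_majorant_bounds inc in \<open>auto intro!: BseqI'[of _ 1] simp: incseq_def abs_of_nonneg\<close>)
  then have "Cauchy ?y" by (simp add: Cauchy_convergent_iff)
  have dom: "norm (?Y (n + k) - ?Y n) \<le> ?y (n + k) - ?y n" for n k
  proof (induction k)
    case (Suc k)
    have "?Y (n + Suc k) - ?Y n = (?Y (Suc (n + k)) - ?Y (n + k)) + (?Y (n + k) - ?Y n)" by simp
    then have "norm (?Y (n + Suc k) - ?Y n) \<le> norm (?Y (Suc (n + k)) - ?Y (n + k)) + norm (?Y (n + k) - ?Y n)"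
      by (metis norm_triangle_ineq)
    then show ?case using Suc norm_sqrt_iterate_step[OF X(2), of "n + k"] by simp
  qed simp
  have "Cauchy ?Y"
  proof (rule CauchyI')
    fix e :: real assume "0 < e"
    with \<open>Cauchy ?y\<close> obtain M where M: "\<And>m n. m \<ge> M \<Longrightarrow> n \<ge> M \<Longrightarrow> norm (?y m - ?y n) < e"
      using CauchyD by blast
    show "\<exists>M. \<forall>m\<ge>M. \<forall>n>m. dist (?Y m) (?Y n) < e"
    proof (intro exI allI impI)
      fix m n assume mn: "M \<le> m" "m < n"
      then have "norm (?Y n - ?Y m) \<le> ?y n - ?y m" using dom[of m "n - m"] by simp
      then show "dist (?Y m) (?Y n) < e" using M[of n m] mn by (simp add: dist_norm norm_minus_commute)
    qed
  qed
  then obtain Y where Y: "?Y \<longlonglongrightarrow> Y" using Cauchy_convergent_iff convergent_def by blast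
  have sa: "selfadjoint (?Y n)" for n
    by (induction n) (auto intro!: selfadjoint_zero selfadjoint_scaleR selfadjoint_add X selfadjoint_square)
  show thesis
  proof
    show "selfadjoint Y" by (rule selfadjoint_limit[OF sa Y])
    show "norm Y \<le> 1"
      by (rule LIMSEQ_le_const2[OF tendsto_norm[OF Y]])
        (use norm_sqrt_iterate[OF X(2)] sqrt_majorant_bounds(2) order_trans in blast)
    fix x
    have "(\<lambda>n. ?Y (Suc n) x) \<longlonglongrightarrow> (1/2) *\<^sub>R (X x + Y (Y x))"
      by (simp add: blinfun.scaleR_left blinfun.add_left) (intro tendsto_intros Y blinfun.tendsto)
    moreover have "(\<lambda>n. ?Y (Suc n) x) \<longlonglongrightarrow> Y x"
      by (rule LIMSEQ_Suc[OF tendsto_blinfun_at[OF Y]])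
    ultimately have "(1/2) *\<^sub>R (X x + Y (Y x)) = Y x" by (rule LIMSEQ_unique)
    then show "X x + Y (Y x) = 2 *\<^sub>R Y x" by (metis scaleR_half_double scaleR_2 scaleR_add_right scaleR_scaleR)
  next
    fix U x assume U: "\<And>x. blinfun_apply U (X x) = X (U x)"
    have "(\<lambda>n. U (?Y n x)) \<longlonglongrightarrow> U (Y x)" by (intro blinfun.tendsto tendsto_const Y)
    moreover have "(\<lambda>n. U (?Y n x)) \<longlonglongrightarrow> Y (U x)"
      by (simp add: sqrt_iterate_commute[OF U] tendsto_blinfun_at[OF Y])
    ultimately show "U (Y x) = Y (U x)" by (rule LIMSEQ_unique)
  qed
qed

text \<open>
  Scaling \<open>D\<close> to a contraction \<open>C\<close> makes \<open>1 - C\<^sup>2\<close> a contraction, so \<open>C\<^sup>2\<close> has a square root \<open>1 - Y\<close>;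
  it is nonnegative because \<open>\<parallel>Y\<parallel> \<le> 1\<close>.
\<close>

lemma absolute_value_exists:
  assumes D: "selfadjoint D"
  obtains A where "selfadjoint A" "\<And>x. 0 \<le> Re (cinner (blinfun_apply A x) x)"
    "\<And>x. blinfun_apply A (A x) = D (D x)"
    "\<And>U x. (\<And>x. blinfun_apply U (D x) = D (U x)) \<Longrightarrow> U (A x) = A (U x)"
proof -
  define k where "k = norm D + 1"
  have k: "k > 0" by (simp add: k_def add_nonneg_pos)
  define C where "C = inverse k *\<^sub>R D"
  have C: "selfadjoint C" unfolding C_def by (intro selfadjoint_scaleR D)
  have normC: "norm (C x) \<le> norm x" for x
  proof -
    have "norm (C x) = inverse k * norm (D x)" using k by (simp add: C_def blinfun.scaleR_left)
    also have "\<dots> \<le> inverse k * (norm D * norm x)" using k by (intro mult_left_mono norm_blinfun) auto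
    also have "\<dots> \<le> inverse k * (k * norm x)" using k by (intro mult_left_mono mult_right_mono) (auto simp: k_def)
    also have "\<dots> = norm x" using k by simp
    finally show ?thesis .
  qed
  define X where "X = id_blinfun - (C o\<^sub>L C)"
  have X: "selfadjoint X" unfolding X_def by (intro selfadjoint_diff selfadjoint_id selfadjoint_square C)
  have "norm X \<le> 1"
  proof (rule norm_blinfun_bound)
    fix x
    have "Re (cinner x (C (C x))) = (norm (C x))\<^sup>2"
      using selfadjoint_cinner[OF C, of x "C x"] Re_cinner_self[of "C x"] by simp
    then have "(norm (X x))\<^sup>2 = (norm x)\<^sup>2 - 2 * (norm (C x))\<^sup>2 + (norm (C (C x)))\<^sup>2"
      by (simp add: X_def blinfun.diff_left norm_diff_square)
    moreover have "(norm (C (C x)))\<^sup>2 \<le> (norm (C x))\<^sup>2" by (intro power_mono normC) auto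
    ultimately have "(norm (X x))\<^sup>2 \<le> (norm x)\<^sup>2" using zero_le_power2[of "norm (C x)"] by linarith
    then show "norm (X x) \<le> 1 * norm x" using power2_le_imp_le[of "norm (X x)" "norm x"] by simp
  qed simp
  from square_root_exists[OF X this] obtain Y where Y: "selfadjoint Y" "norm Y \<le> 1"
    "\<And>x. X x + Y (Y x) = 2 *\<^sub>R Y x"
    "\<And>U x. (\<And>x. blinfun_apply U (X x) = X (U x)) \<Longrightarrow> U (Y x) = Y (U x)" by blast
  define A where "A = k *\<^sub>R (id_blinfun - Y)"
  show thesis
  proof
    show "selfadjoint A" unfolding A_def by (intro selfadjoint_scaleR selfadjoint_diff selfadjoint_id Y)
    fix x
    have "Re (cinner (Y x) x) \<le> norm (Y x) * norm x" by (rule Re_cinner_le)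
    also have "\<dots> \<le> (1 * norm x) * norm x"
      by (intro mult_right_mono order_trans[OF norm_blinfun] Y(2)) auto
    finally show "0 \<le> Re (cinner (A x) x)"
      using k by (simp add: A_def blinfun.scaleR_left blinfun.diff_left cinner_algebra cinner_self power2_eq_square)
    have "(id_blinfun - Y) ((id_blinfun - Y) x) = x - 2 *\<^sub>R Y x + Y (Y x)"
      by (simp add: blinfun.diff_left blinfun.diff_right scaleR_2)
    also have "\<dots> = C (C x)"
      unfolding Y(3)[of x, symmetric] by (simp add: X_def blinfun.diff_left)
    finally have "A (A x) = (k * k) *\<^sub>R C (C x)"
      by (simp add: A_def blinfun.scaleR_left blinfun.scaleR_right)
    moreover have "(k * k * (inverse k * inverse k)) = 1" using k by (simp add: field_simps)
    ultimately show "A (A x) = D (D x)"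
      by (simp add: C_def blinfun.scaleR_left blinfun.scaleR_right)
  next
    fix U x assume U: "\<And>x. blinfun_apply U (D x) = D (U x)"
    have "U (X x) = X (U x)" for x
      by (simp add: X_def C_def blinfun.diff_left blinfun.diff_right blinfun.scaleR_left
          blinfun.scaleR_right U)
    then have "U (Y x) = Y (U x)" using Y(4) by blast
    then show "U (A x) = A (U x)"
      by (simp add: A_def blinfun.diff_left blinfun.diff_right blinfun.scaleR_left blinfun.scaleR_right)
  qed
qed

text \<open>
  With \<open>D = T - s\<close>, the kernel of \<open>|D| + D\<close> carries the part of \<open>T\<close> below \<open>s\<close>: there \<open>D = - |D|\<close>.
  On its orthogonal complement \<open>D = |D|\<close>, because \<open>|D| - D\<close> takes values in that kernel.
\<close>

lemma spectral_splitting: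
  assumes T: "selfadjoint T"
  obtains N where "closed N" "csubspace N"
    "\<forall>U. (\<forall>x. blinfun_apply U (T x) = T (U x)) \<longrightarrow> (\<forall>x\<in>N. U x \<in> N)"
    "\<forall>x\<in>N. Re (cinner (T x) x) \<le> s * (norm x)\<^sup>2"
    "\<forall>x. x \<bottom>\<^sub>s N \<longrightarrow> s * (norm x)\<^sup>2 \<le> Re (cinner (T x) x)"
proof -
  define D where "D = T - s *\<^sub>R id_blinfun"
  have D: "selfadjoint D" unfolding D_def by (intro selfadjoint_diff T selfadjoint_scaleR selfadjoint_id)
  have Dform: "Re (cinner (D x) x) = Re (cinner (T x) x) - s * (norm x)\<^sup>2" for x
    by (simp add: D_def blinfun.diff_left blinfun.scaleR_left cinner_algebra cinner_self)
  from absolute_value_exists[OF D] obtain A where A: "selfadjoint A"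
    "\<And>x. 0 \<le> Re (cinner (blinfun_apply A x) x)" "\<And>x. blinfun_apply A (A x) = D (D x)"
    "\<And>U x. (\<And>x. blinfun_apply U (D x) = D (U x)) \<Longrightarrow> U (A x) = A (U x)" by blast
  define N where "N = {x. A x + D x = 0}"
  have sub: "csubspace N"
    using selfadjoint_scaleC[OF A(1)] selfadjoint_scaleC[OF D]
    by (auto simp: N_def complex_vector.subspace_def blinfun.add_right add_eq_0_iff2
        complex_vector.scale_minus_right)
  have AD: "D (A x) = A (D x)" for x using A(4)[of D] by blast
  show thesis
  proof
    show "csubspace N" by fact
    show "closed N" unfolding N_def by (intro closed_Collect_eq continuous_intros)
    show "\<forall>U. (\<forall>x. blinfun_apply U (T x) = T (U x)) \<longrightarrow> (\<forall>x\<in>N. U x \<in> N)"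
    proof (intro allI impI ballI)
      fix U x assume U: "\<forall>x. blinfun_apply U (T x) = T (U x)" and x: "x \<in> N"
      have UD: "U (D x) = D (U x)" for x
        by (simp add: D_def U blinfun.diff_left blinfun.diff_right blinfun.scaleR_left blinfun.scaleR_right)
      have "A (U x) + D (U x) = U (A x + D x)" using A(4)[of U, OF UD] UD by (simp add: blinfun.add_right)
      then show "U x \<in> N" using x by (simp add: N_def)
    qed
    show "\<forall>x\<in>N. Re (cinner (T x) x) \<le> s * (norm x)\<^sup>2"
    proof
      fix x assume "x \<in> N"
      then have "D x = - A x" by (simp add: N_def add_eq_0_iff)
      then have "Re (cinner (D x) x) \<le> 0" using A(2)[of x] by (simp add: cinner_algebra)
      then show "Re (cinner (T x) x) \<le> s * (norm x)\<^sup>2" by (simp add: Dform)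
    qed
    show "\<forall>x. x \<bottom>\<^sub>s N \<longrightarrow> s * (norm x)\<^sup>2 \<le> Re (cinner (T x) x)"
    proof (intro allI impI)
      fix x assume x: "x \<bottom>\<^sub>s N"
      define z where "z = A x - D x"
      have "z \<in> N" by (simp add: N_def z_def blinfun.diff_right AD A(3))
      then have zN: "A z - D z \<in> N"
        by (simp add: N_def blinfun.diff_right AD A(3))
      have "cinner z z = cinner x (A z - D z)"
        by (subst z_def) (simp add: cinner_algebra selfadjoint_cinner[OF A(1)] selfadjoint_cinner[OF D])
      then have "z = 0" using x zN by (simp add: orthogonal_to_def cinner_self_eq_0_iff)
      then have "D x = A x" by (simp add: z_def)
      then have "0 \<le> Re (cinner (D x) x)" using A(2)[of x] by simp
      then show "s * (norm x)\<^sup>2 \<le> Re (cinner (T x) x)" by (simp add: Dform)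
    qed
  qed
qed

section \<open>Growth of iterates\<close>

lemma eq_0_of_geometric_growth:
  fixes a q r :: real
  assumes "0 \<le> r" "r < q" "0 \<le> a" "\<And>k. q ^ k * a \<le> C * r ^ k"
  shows "a = 0"
proof (rule ccontr)
  assume "a \<noteq> 0"
  with assms have a: "a > 0" by simp
  have q: "q > 0" using assms by linarith
  have "(\<lambda>k. C * (r / q) ^ k) \<longlonglongrightarrow> C * 0"
    by (intro tendsto_mult tendsto_const LIMSEQ_power_zero) (use assms q in auto)
  moreover have "a \<le> C * (r / q) ^ k" for k
    using assms(4)[of k] q by (simp add: power_divide field_simps)
  ultimately have "a \<le> C * 0" by (intro LIMSEQ_le_const) auto
  with a show False by simp
qed

text \<open>For selfadjoint \<open>D\<close> this is the range of the spectral projection of \<open>|D|\<close> for \<open>[0,r]\<close>.\<close>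

definition growth_space :: "('a::complex_hilbert \<Rightarrow>\<^sub>L 'a) \<Rightarrow> real \<Rightarrow> 'a set" where
  "growth_space D r = {x. \<forall>k. norm ((blinfun_apply D ^^ k) x) \<le> r ^ k * norm x}"

lemma iterate_add:
  fixes D :: "'a::complex_hilbert \<Rightarrow>\<^sub>L 'a"
  shows "(blinfun_apply D ^^ k) (x + y) = (blinfun_apply D ^^ k) x + (blinfun_apply D ^^ k) y"
  by (induction k) (auto simp: blinfun.add_right)

lemma iterate_scaleC: "selfadjoint D \<Longrightarrow> (blinfun_apply D ^^ k) (c *\<^sub>C x) = c *\<^sub>C (blinfun_apply D ^^ k) x"
  by (induction k) (auto simp: selfadjoint_scaleC)

lemma iterate_commute:
  assumes "\<And>x. f (blinfun_apply D x) = D (f x)"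
  shows "f ((blinfun_apply D ^^ k) x) = (blinfun_apply D ^^ k) (f x)"
  by (induction k) (auto simp: assms)

lemma norm_square_le_neighbours:
  assumes "selfadjoint D"
  shows "(norm (blinfun_apply D x))\<^sup>2 \<le> norm x * norm (D (D x))"
  using Re_cinner_le[of x "D (D x)"]
  by (simp add: Re_cinner_self[symmetric] selfadjoint_cinner[OF assms])

text \<open>
  By the preceding inequality the quotients of successive norms increase, so none of them can exceed
  the exponential growth rate: a bound \<open>C r\<^sup>k\<close> with any constant implies the one with \<open>C = \<parallel>x\<parallel>\<close>.
  Hence a growth space is a subspace, by the former bound, and closed, by the latter.
\<close>

lemma growth_spaceI:
  assumes D: "selfadjoint D" and r: "0 \<le> r" and C: "\<And>k. norm ((blinfun_apply D ^^ k) x) \<le> C * r ^ k"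
  shows "x \<in> growth_space D r"
proof -
  have step: "norm (D y) \<le> r * norm y" if C: "\<And>k. norm ((blinfun_apply D ^^ k) y) \<le> C * r ^ k" for y C
  proof (rule ccontr)
    assume neg: "\<not> norm (D y) \<le> r * norm y"
    then have y: "norm y > 0" by (auto simp: blinfun.zero_right)
    define q where "q = norm (D y) / norm y"
    have rq: "r < q" using neg y by (simp add: q_def field_simps)
    have ratio: "q * norm ((blinfun_apply D ^^ k) y) \<le> norm ((blinfun_apply D ^^ Suc k) y)" for k
    proof (induction k)
      case 0
      then show ?case using y by (simp add: q_def)
    next
      case (Suc k)
      define a b c where "a = norm ((blinfun_apply D ^^ k) y)" and "b = norm ((blinfun_apply D ^^ Suc k) y)"
        and "c = norm ((blinfun_apply D ^^ Suc (Suc k)) y)"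
      have conv: "b\<^sup>2 \<le> a * c"
        using norm_square_le_neighbours[OF D, of "(blinfun_apply D ^^ k) y"] by (simp add: a_def b_def c_def)
      have qb: "q * a \<le> b" using Suc by (simp add: a_def b_def)
      have nn: "0 \<le> a" "0 \<le> b" "0 \<le> c" by (simp_all add: a_def b_def c_def)
      have "q * b \<le> c"
      proof (cases "b = 0")
        case False
        then have b: "b > 0" using nn by simp
        have "b * (q * b) = q * b\<^sup>2" by (simp add: power2_eq_square)
        also have "\<dots> \<le> q * (a * c)" using conv rq r by (intro mult_left_mono) auto
        also have "\<dots> = (q * a) * c" by simp
        also have "\<dots> \<le> b * c" using qb nn by (intro mult_right_mono) auto
        finally show ?thesis using b by simp
      qed (use nn in simp)
      then show ?case by (simp add: b_def c_def)
    qed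
    have "q ^ k * norm y \<le> norm ((blinfun_apply D ^^ k) y)" for k
    proof (induction k)
      case (Suc k)
      have "q ^ Suc k * norm y = q * (q ^ k * norm y)" by simp
      also have "\<dots> \<le> q * norm ((blinfun_apply D ^^ k) y)" using Suc rq r by (intro mult_left_mono) auto
      also have "\<dots> \<le> norm ((blinfun_apply D ^^ Suc k) y)" by (rule ratio)
      finally show ?case .
    qed simp
    then have "q ^ k * norm y \<le> C * r ^ k" for k using order_trans[OF _ C[of k]] by blast
    from eq_0_of_geometric_growth[OF r rq _ this] y show False by simp
  qed
  have "norm ((blinfun_apply D ^^ k) x) \<le> r ^ k * norm x" for k
  proof (induction k)
    case (Suc k)
    have "norm ((blinfun_apply D ^^ j) ((blinfun_apply D ^^ k) x)) \<le> (C * r ^ k) * r ^ j" for j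
    proof -
      have "(blinfun_apply D ^^ j) ((blinfun_apply D ^^ k) x) = (blinfun_apply D ^^ (j + k)) x" by (simp add: funpow_add)
      then show ?thesis using C[of "j + k"] by (simp add: power_add mult_ac)
    qed
    from step[OF this] have "norm ((blinfun_apply D ^^ Suc k) x) \<le> r * norm ((blinfun_apply D ^^ k) x)" by simp
    also have "\<dots> \<le> r * (r ^ k * norm x)" by (intro mult_left_mono Suc r)
    finally show ?case by simp
  qed simp
  then show ?thesis by (simp add: growth_space_def)
qed

lemma growth_space_iterate: "x \<in> growth_space D r \<Longrightarrow> norm ((blinfun_apply D ^^ k) x) \<le> norm x * r ^ k"
  by (simp add: growth_space_def mult.commute)

lemma growth_space_norm: "x \<in> growth_space D r \<Longrightarrow> norm (blinfun_apply D x) \<le> r * norm x"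
  unfolding growth_space_def by (auto dest: spec[of _ "Suc 0"])

lemma closed_growth_space: "closed (growth_space D r)"
proof -
  have "continuous_on UNIV (blinfun_apply D ^^ k)" for k
    by (induction k) (auto intro!: continuous_intros continuous_on_id simp: o_def id_def)
  then show ?thesis
    unfolding growth_space_def by (intro closed_Collect_all closed_Collect_le continuous_intros)
qed

lemma csubspace_growth_space:
  assumes D: "selfadjoint D" and r: "0 \<le> r"
  shows "csubspace (growth_space D r)"
  unfolding complex_vector.subspace_def
proof (intro conjI ballI allI)
  have "(blinfun_apply D ^^ k) 0 = 0" for k by (induction k) (auto simp: blinfun.zero_right)
  then show "0 \<in> growth_space D r" by (simp add: growth_space_def)
next
  fix x y assume "x \<in> growth_space D r" "y \<in> growth_space D r"
  then have "norm ((blinfun_apply D ^^ k) (x + y)) \<le> (norm x + norm y) * r ^ k" for k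
    unfolding iterate_add distrib_right by (intro order_trans[OF norm_triangle_ineq] add_mono growth_space_iterate)
  then show "x + y \<in> growth_space D r" by (rule growth_spaceI[OF D r])
next
  fix c x assume "x \<in> growth_space D r"
  then have "norm ((blinfun_apply D ^^ k) (c *\<^sub>C x)) \<le> (cmod c * norm x) * r ^ k" for k
    unfolding iterate_scaleC[OF D] norm_scaleC mult.assoc by (intro mult_left_mono growth_space_iterate) auto
  then show "c *\<^sub>C x \<in> growth_space D r" by (rule growth_spaceI[OF D r])
qed

lemma growth_space_invariant:
  assumes D: "selfadjoint D" and r: "0 \<le> r"
    and f: "\<And>x. f (blinfun_apply D x) = D (f x)" "\<And>x. norm (f x) \<le> K * norm x" "0 \<le> K"
    and x: "x \<in> growth_space D r"
  shows "f x \<in> growth_space D r"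
proof (rule growth_spaceI[OF D r])
  fix k
  have "norm ((blinfun_apply D ^^ k) (f x)) = norm (f ((blinfun_apply D ^^ k) x))" by (simp add: iterate_commute[of f, OF f(1)])
  also have "\<dots> \<le> K * (norm x * r ^ k)"
    by (rule order_trans[OF f(2) mult_left_mono]) (use f(3) growth_space_iterate[OF x] in auto)
  finally show "norm ((blinfun_apply D ^^ k) (f x)) \<le> (K * norm x) * r ^ k" by simp
qed

lemma subset_growth_space:
  assumes "0 \<le> r" "\<And>x. x \<in> N \<Longrightarrow> blinfun_apply D x \<in> N" "\<And>x. x \<in> N \<Longrightarrow> norm (D x) \<le> r * norm x"
  shows "N \<subseteq> growth_space D r"
proof
  fix x assume x: "x \<in> N"
  have "(blinfun_apply D ^^ k) x \<in> N \<and> norm ((blinfun_apply D ^^ k) x) \<le> r ^ k * norm x" for k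
  proof (induction k)
    case (Suc k)
    then have "norm (D ((blinfun_apply D ^^ k) x)) \<le> r * (r ^ k * norm x)"
      by (intro order_trans[OF assms(3)] mult_left_mono assms(1)) auto
    then show ?case using Suc assms(2) by simp
  qed (use x in simp)
  then show "x \<in> growth_space D r" by (simp add: growth_space_def)
qed

lemma eq_0_of_expanding:
  assumes r: "0 \<le> r" "r < q"
    and N: "\<And>x. x \<in> N \<Longrightarrow> blinfun_apply D x \<in> N" "\<And>x. x \<in> N \<Longrightarrow> q * norm x \<le> norm (D x)"
    and x: "x \<in> N" "\<And>k. norm ((blinfun_apply D ^^ k) x) \<le> C * r ^ k"
  shows "x = 0"
proof -
  have "(blinfun_apply D ^^ k) x \<in> N \<and> q ^ k * norm x \<le> norm ((blinfun_apply D ^^ k) x)" for k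
  proof (induction k)
    case (Suc k)
    then have "q * (q ^ k * norm x) \<le> norm (D ((blinfun_apply D ^^ k) x))"
      using r by (intro order_trans[OF mult_left_mono N(2)]) auto
    then show ?case using Suc N(1) by simp
  qed (use x in simp)
  then have "q ^ k * norm x \<le> C * r ^ k" for k using order_trans[OF _ x(2)[of k]] by blast
  from eq_0_of_geometric_growth[OF r _ this] show ?thesis by simp
qed

text \<open>Splitting \<open>D\<^sup>2\<close> at \<open>r\<^sup>2\<close> yields a subspace of the growth space.\<close>

lemma norm_ge_of_orthogonal_growth_space:
  assumes D: "selfadjoint D" and r: "0 \<le> r" and x: "x \<bottom>\<^sub>s growth_space D r"
  shows "r * norm x \<le> norm (blinfun_apply D x)"
proof -
  have form: "Re (cinner ((D o\<^sub>L D) x) x) = (norm (D x))\<^sup>2" for x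
    by (simp add: selfadjoint_cinner[OF D] Re_cinner_self[symmetric])
  obtain N where "closed N" "csubspace N" and N:
    "\<forall>U. (\<forall>x. blinfun_apply U ((D o\<^sub>L D) x) = (D o\<^sub>L D) (U x)) \<longrightarrow> (\<forall>x\<in>N. U x \<in> N)"
    "\<forall>x\<in>N. Re (cinner ((D o\<^sub>L D) x) x) \<le> r\<^sup>2 * (norm x)\<^sup>2"
    "\<forall>x. x \<bottom>\<^sub>s N \<longrightarrow> r\<^sup>2 * (norm x)\<^sup>2 \<le> Re (cinner ((D o\<^sub>L D) x) x)"
    by (rule spectral_splitting[OF selfadjoint_square[OF D], of "r\<^sup>2"])
  have "N \<subseteq> growth_space D r"
  proof (rule subset_growth_space[OF r])
    fix y assume y: "y \<in> N"
    show "D y \<in> N" using N(1) y by simp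
    have "(norm (D y))\<^sup>2 \<le> (r * norm y)\<^sup>2"
      using bspec[OF N(2) y] unfolding form power_mult_distrib .
    then show "norm (D y) \<le> r * norm y" by (rule power2_le_imp_le) (use r in simp)
  qed
  then have "x \<bottom>\<^sub>s N" using x by (auto simp: orthogonal_to_def)
  then have "(r * norm x)\<^sup>2 \<le> (norm (D x))\<^sup>2"
    using N(3) unfolding form power_mult_distrib by blast
  then show ?thesis by (rule power2_le_imp_le) simp
qed

section \<open>Existence of the resolution of the identity\<close>

text \<open>
  \<open>T \<in> [c,d]\<close> means that the distance of \<open>T\<close> from the midpoint is at most the half-length; this turns
  the growth space into the spectral subspace for \<open>[c,d]\<close>.
\<close>

definition spectral_space :: "('a::complex_hilbert \<Rightarrow>\<^sub>L 'a) \<Rightarrow> real \<Rightarrow> real \<Rightarrow> 'a set" where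
  "spectral_space T c d = growth_space (T - ((c + d) / 2) *\<^sub>R id_blinfun) ((d - c) / 2)"

lemma shift_apply [simp]: "blinfun_apply (T - m *\<^sub>R id_blinfun) x = T x - m *\<^sub>R x"
  by (simp add: blinfun.diff_left blinfun.scaleR_left)

lemma selfadjoint_shift: "selfadjoint T \<Longrightarrow> selfadjoint (T - m *\<^sub>R id_blinfun)"
  by (intro selfadjoint_diff selfadjoint_scaleR selfadjoint_id)

text \<open>
  If \<open>c \<le> T \<le> d\<close> as quadratic forms on an invariant subspace, then \<open>(T - c)(d - T) \<ge> 0\<close>, because
  \<open>(d - c)(T - c)(d - T) = (T - c)(d - T)(T - c) + (d - T)(T - c)(d - T)\<close>, and
  \<open>h\<^sup>2 - (T - m)\<^sup>2 = (T - c)(d - T)\<close> for the midpoint \<open>m\<close> and the half-length \<open>h\<close> of \<open>[c,d]\<close>.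
\<close>

lemma norm_le_of_form_bounds:
  assumes T: "selfadjoint T" and N: "csubspace N" "\<And>x. x \<in> N \<Longrightarrow> blinfun_apply T x \<in> N" and cd: "c < d"
    and low: "\<And>x. x \<in> N \<Longrightarrow> c * (norm x)\<^sup>2 \<le> Re (cinner (T x) x)"
    and high: "\<And>x. x \<in> N \<Longrightarrow> Re (cinner (T x) x) \<le> d * (norm x)\<^sup>2"
    and x: "x \<in> N"
  shows "norm (T x - ((c + d) / 2) *\<^sub>R x) \<le> (d - c) / 2 * norm x"
proof -
  define u v where "u = T x - c *\<^sub>R x" and "v = d *\<^sub>R x - T x"
  have uN: "u \<in> N" and vN: "v \<in> N"
    unfolding u_def v_def by (intro csubspace_simps N x)+
  have uv: "u + v = (d - c) *\<^sub>R x" by (simp add: u_def v_def algebra_simps)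
  have sym: "Re (cinner (T u) v) = Re (cinner (T v) u)"
    by (metis selfadjoint_cinner[OF T] Re_cinner_commute)
  have swap: "Re (cinner (T v) (T x)) = Re (cinner (T (T x)) v)"
    by (metis selfadjoint_cinner[OF T] Re_cinner_commute)
  have "(d - c) * Re (cinner u v) = Re (cinner u v) * (d - c)" by simp
  also have "\<dots> = Re (cinner (d *\<^sub>R u - T u) u) + Re (cinner (T v - c *\<^sub>R v) v)"
  proof -
    have 1: "d *\<^sub>R u - T u = T v - c *\<^sub>R v"
      by (simp add: u_def v_def blinfun.diff_right blinfun.scaleR_right algebra_simps)
    have 2: "Re (cinner (T v - c *\<^sub>R v) (u + v)) = (d - c) * Re (cinner (T v - c *\<^sub>R v) x)"
      by (simp add: uv cinner_scaleR_right)
    have 3: "cinner (T v - c *\<^sub>R v) x = cinner v u"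
      by (simp add: u_def cinner_algebra selfadjoint_cinner[OF T])
    show ?thesis using 2 3 Re_cinner_commute[of u v] by (simp add: 1 cinner_add_right)
  qed
  also have "\<dots> \<ge> 0"
    using low[OF vN] high[OF uN] by (simp add: cinner_algebra cinner_self)
  finally have "0 \<le> Re (cinner u v)" using cd by (simp add: zero_le_mult_iff)
  moreover have "(norm (u - v))\<^sup>2 = (norm (u + v))\<^sup>2 - 4 * Re (cinner u v)"
    by (simp add: norm_add_square norm_diff_square)
  ultimately have "(norm (u - v))\<^sup>2 \<le> (norm (u + v))\<^sup>2" by simp
  then have "norm (u - v) \<le> norm (u + v)" by (rule power2_le_imp_le) simp
  moreover have "u - v = 2 *\<^sub>R (T x - ((c + d) / 2) *\<^sub>R x)"
  proof -
    have "2 *\<^sub>R ((c + d) / 2) *\<^sub>R x = c *\<^sub>R x + d *\<^sub>R x"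
      unfolding scaleR_scaleR scaleR_add_left[symmetric] by (rule arg_cong2[of _ _ x x scaleR]) simp_all
    then show ?thesis unfolding scaleR_diff_right by (simp add: u_def v_def scaleR_2)
  qed
  ultimately show ?thesis using cd by (simp add: uv)
qed

lemma norm_ge_of_form_ge:
  assumes "d * (norm x)\<^sup>2 \<le> Re (cinner (blinfun_apply T x) x)"
  shows "(d - m) * norm x \<le> norm (T x - m *\<^sub>R x)"
proof (cases "x = 0")
  case False
  have "(d - m) * norm x * norm x \<le> Re (cinner (T x - m *\<^sub>R x) x)"
    using assms by (simp add: cinner_algebra cinner_self power2_eq_square algebra_simps)
  also have "\<dots> \<le> norm (T x - m *\<^sub>R x) * norm x" by (rule Re_cinner_le)
  finally show ?thesis using False by simp
qed simp

lemma norm_ge_of_form_le: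
  assumes "Re (cinner (blinfun_apply T x) x) \<le> c * (norm x)\<^sup>2"
  shows "(m - c) * norm x \<le> norm (T x - m *\<^sub>R x)"
proof (cases "x = 0")
  case False
  have "(m - c) * norm x * norm x \<le> Re (cinner (m *\<^sub>R x - T x) x)"
    using assms by (simp add: cinner_algebra cinner_self power2_eq_square algebra_simps)
  also have "\<dots> \<le> norm (m *\<^sub>R x - T x) * norm x" by (rule Re_cinner_le)
  finally show ?thesis using False by (simp add: norm_minus_commute)
qed simp

lemma form_le_norm: "\<bar>Re (cinner (blinfun_apply T x) x)\<bar> \<le> norm T * (norm x)\<^sup>2"
proof -
  have "\<bar>Re (cinner (T x) x)\<bar> \<le> norm (T x) * norm x"
    by (rule order_trans[OF abs_Re_le_cmod cauchy_schwarz])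
  also have "\<dots> \<le> (norm T * norm x) * norm x" by (intro mult_right_mono norm_blinfun) auto
  finally show ?thesis by (simp add: power2_eq_square)
qed

text \<open>
  By Pythagoras' theorem the squared distances of the projections are the increments of the monotone
  function \<open>s \<mapsto> \<parallel>proj (L s) x\<parallel>\<^sup>2\<close>; so the projections converge, and the limit lies in every \<open>L r\<close>.
\<close>

lemma proj_right_continuous:
  fixes L :: "real \<Rightarrow> 'a::complex_hilbert set"
  assumes L: "\<And>s. closed_csubspace (L s)" and mono: "\<And>r s. r \<le> s \<Longrightarrow> L r \<subseteq> L s"
    and inter: "\<And>x. (\<And>r. r > s \<Longrightarrow> x \<in> L r) \<Longrightarrow> x \<in> L s"
  shows "continuous (at_right s) (\<lambda>r. proj (L r) x)"
proof -
  have pyth: "(norm (proj (L r) x))\<^sup>2 = (norm (proj (L q) x))\<^sup>2 + (norm (proj (L r) x - proj (L q) x))\<^sup>2"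
    if "q \<le> r" for q r
  proof -
    interpret q: closed_csubspace "L q" by (rule L)
    interpret r: closed_csubspace "L r" by (rule L)
    have "proj (L q) (proj (L r) x) = proj (L q) x"
    proof (rule q.proj_unique[symmetric])
      show "proj (L q) (proj (L r) x) \<in> L q" by (rule q.proj_in)
      have "x - proj (L q) (proj (L r) x) = (x - proj (L r) x) + (proj (L r) x - proj (L q) (proj (L r) x))"
        by simp
      then show "x - proj (L q) (proj (L r) x) \<bottom>\<^sub>s L q"
        using q.proj_orthogonal[of "proj (L r) x"] r.proj_orthogonal[of x] mono[OF that]
        unfolding orthogonal_to_def by (simp only: cinner_add_left) auto
    qed
    then show ?thesis using q.proj_pythagoras[of "proj (L r) x"] by simp
  qed
  define \<phi> where "\<phi> r = (norm (proj (L r) x))\<^sup>2" for r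
  have dist: "(dist (proj (L r) x) (proj (L q) x))\<^sup>2 = \<phi> r - \<phi> q" if "q \<le> r" for q r
    using pyth[OF that] by (simp add: \<phi>_def dist_norm)
  have \<phi>_mono: "\<phi> q \<le> \<phi> r" if "q \<le> r" for q r
    using dist[OF that] by (smt (verit) zero_le_power2)
  define t where "t n = s + inverse (real (Suc n))" for n
  have t: "s < t n" "m \<le> n \<Longrightarrow> t n \<le> t m" for m n
    by (auto simp: t_def intro!: le_imp_inverse_le)
  have "decseq (\<lambda>n. \<phi> (t n))" by (auto simp: decseq_def intro: \<phi>_mono t)
  moreover have "0 \<le> \<phi> (t n)" for n by (simp add: \<phi>_def)
  ultimately obtain l where l: "(\<lambda>n. \<phi> (t n)) \<longlonglongrightarrow> l"
    using decseq_convergent[of "\<lambda>n. \<phi> (t n)" 0] by blast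
  have "Cauchy (\<lambda>n. proj (L (t n)) x)"
  proof (rule CauchyI')
    fix e :: real assume e: "0 < e"
    then obtain M where M: "\<And>m n. M \<le> m \<Longrightarrow> M \<le> n \<Longrightarrow> norm (\<phi> (t m) - \<phi> (t n)) < e\<^sup>2"
      using CauchyD[OF LIMSEQ_imp_Cauchy[OF l], of "e\<^sup>2"] by auto
    show "\<exists>M. \<forall>m\<ge>M. \<forall>n>m. dist (proj (L (t m)) x) (proj (L (t n)) x) < e"
    proof (intro exI allI impI)
      fix m n assume mn: "M \<le> m" "m < n"
      have "(dist (proj (L (t m)) x) (proj (L (t n)) x))\<^sup>2 < e\<^sup>2"
        using dist[of "t n" "t m"] M[of m n] mn t(2)[of m n] by auto
      then show "dist (proj (L (t m)) x) (proj (L (t n)) x) < e"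
        by (rule power_less_imp_less_base) (use e in simp)
    qed
  qed
  then obtain z where z: "(\<lambda>n. proj (L (t n)) x) \<longlonglongrightarrow> z" using Cauchy_convergent_iff convergent_def by blast
  interpret s: closed_csubspace "L s" by (rule L)
  have "z \<in> L r" if r: "r > s" for r
  proof -
    interpret r: closed_csubspace "L r" by (rule L)
    have "eventually (\<lambda>n. inverse (real (Suc n)) < r - s) sequentially"
      using order_tendstoD(2)[OF LIMSEQ_inverse_real_of_nat, of "r - s"] r by simp
    then have "eventually (\<lambda>n. proj (L (t n)) x \<in> L r) sequentially"
    proof eventually_elim
      case (elim n)
      then have "L (t n) \<subseteq> L r" by (intro mono) (simp add: t_def)
      moreover have "proj (L (t n)) x \<in> L (t n)" by (rule closed_csubspace.proj_in[OF L])
      ultimately show ?case by blast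
    qed
    then show ?thesis using Lim_in_closed_set[OF r.closed _ _ z] by simp
  qed
  then have zs: "z \<in> L s" by (rule inter)
  have "proj (L s) x = z"
  proof (rule s.proj_unique[OF zs])
    show "x - z \<bottom>\<^sub>s L s" unfolding orthogonal_to_def
    proof
      fix w assume "w \<in> L s"
      then have "cinner (x - proj (L (t n)) x) w = 0" for n
        using closed_csubspace.proj_orthogonal[OF L, of x "t n"] mono[of s "t n"] t(1)[of n]
        by (auto simp: orthogonal_to_def)
      moreover have "(\<lambda>n. cinner (x - proj (L (t n)) x) w) \<longlonglongrightarrow> cinner (x - z) w"
        by (intro tendsto_cinner tendsto_intros z)
      ultimately show "cinner (x - z) w = 0" by (simp add: LIMSEQ_const_iff)
    qed
  qed
  have "((\<lambda>r. proj (L r) x) \<longlongrightarrow> proj (L s) x) (at_right s)"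
  proof (rule tendstoI)
    fix e :: real assume "0 < e"
    then obtain n where n: "dist (proj (L (t n)) x) (proj (L s) x) < e"
      using metric_LIMSEQ_D[OF z] \<open>proj (L s) x = z\<close> by blast
    have "eventually (\<lambda>r. r \<in> {s<..<t n}) (at_right s)"
      by (rule eventually_at_right_real) (rule t)
    then show "eventually (\<lambda>r. dist (proj (L r) x) (proj (L s) x) < e) (at_right s)"
    proof eventually_elim
      case (elim r)
      then have "(dist (proj (L r) x) (proj (L s) x))\<^sup>2 \<le> (dist (proj (L (t n)) x) (proj (L s) x))\<^sup>2"
        using dist[of s r] dist[of s "t n"] \<phi>_mono[of r "t n"] t(1)[of n] by simp
      then have "dist (proj (L r) x) (proj (L s) x) \<le> dist (proj (L (t n)) x) (proj (L s) x)"
        by (rule power2_le_imp_le) simp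
      with n show ?case by simp
    qed
  qed
  then show ?thesis by (simp add: continuous_within)
qed

locale invariant_subspace = closed_csubspace V for V :: "'a::complex_hilbert set" +
  fixes T :: "'a \<Rightarrow>\<^sub>L 'a"
  assumes selfadjoint: "selfadjoint T" and invariant: "x \<in> V \<Longrightarrow> T x \<in> V"
begin

lemmas symmetric = selfadjoint_cinner[OF selfadjoint]

lemma orthogonal_invariant: "x \<bottom>\<^sub>s V \<Longrightarrow> T x \<bottom>\<^sub>s V"
  using invariant by (auto simp: orthogonal_to_def symmetric)

lemma proj_T: "proj V (T x) = T (proj V x)"
  by (rule proj_commute) (auto simp: blinfun.diff_right invariant orthogonal_invariant)

end

lemma invariant_subspace_growth_space:
  assumes D: "selfadjoint D" and r: "0 \<le> r" and T: "selfadjoint T" "\<And>x. blinfun_apply T (D x) = D (T x)"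
  shows "invariant_subspace (growth_space D r) T"
proof
  show "T x \<in> growth_space D r" if "x \<in> growth_space D r" for x
    by (rule growth_space_invariant[OF D r _ norm_blinfun _ that]) (use T(2) in auto)
qed (use csubspace_growth_space[OF D r] closed_growth_space T(1) in auto)

lemma growth_space_mono: "0 \<le> r \<Longrightarrow> r \<le> r' \<Longrightarrow> growth_space D r \<subseteq> growth_space D r'"
  unfolding growth_space_def by (auto intro: order_trans[OF _ mult_right_mono[OF power_mono]])

lemma (in invariant_subspace) proj_growth_space:
  assumes D: "selfadjoint D" and r: "0 \<le> r" and DV: "\<And>x. x \<in> V \<Longrightarrow> blinfun_apply D x \<in> V"
  shows "x \<in> growth_space D r \<Longrightarrow> proj V x \<in> growth_space D r"
proof -
  interpret D: invariant_subspace V D by unfold_locales (use D DV in auto)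
  show "x \<in> growth_space D r \<Longrightarrow> proj V x \<in> growth_space D r"
    by (rule growth_space_invariant[OF D r, where K = 1 and f = "proj V"]) (auto simp: norm_proj_le D.proj_T)
qed

text \<open>
  The spectral projections are the projections onto growth spaces of the nonnegative operator
  \<open>T + \<parallel>T\<parallel>\<close>; these are large enough by the splitting of \<open>T\<close> at \<open>s\<close>.
\<close>

theorem (in invariant_subspace) resolution_of_identity_exists:
  "\<exists>P. resolution_of_identity V T P"
proof -
  define K where "K = norm T"
  define H where "H = T - (- K) *\<^sub>R id_blinfun"
  have H: "selfadjoint H" unfolding H_def by (rule selfadjoint_shift[OF selfadjoint])
  have Hx: "H x = T x + K *\<^sub>R x" for x
    unfolding H_def shift_apply by simp
  \<comment> \<open>For a negative rate the growth condition is meaningless, and \<open>T \<ge> - K\<close> leaves only \<open>0\<close> below \<open>- K\<close>.\<close>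
  define L where "L s = (if s < - K then {0} else growth_space H (s + K))" for s
  have zero: "invariant_subspace {0} T" by unfold_locales (auto simp: selfadjoint complex_vector.subspace_def blinfun.zero_right complex_vector.scale_zero_right)
  have L: "invariant_subspace (L s) T" for s
    unfolding L_def using zero
    by (auto intro!: invariant_subspace_growth_space H selfadjoint simp: Hx blinfun.add_right blinfun.scaleR_right)
  then have L': "closed_csubspace (L s)" for s by (simp add: invariant_subspace_def)
  have mono: "L r \<subseteq> L s" if "r \<le> s" for r s
  proof (cases "r < - K")
    case True
    then show ?thesis using closed_csubspace.csubspace[OF L'] complex_vector.subspace_0 by (auto simp: L_def[of r])
  next
    case False
    then show ?thesis using that growth_space_mono[of "r + K" "s + K" H] by (simp add: L_def)
  qed
  have high: "L s = UNIV" if "s \<ge> K" for s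
  proof -
    have K0: "K \<ge> 0" by (simp add: K_def)
    have "norm (H x) \<le> (s + K) * norm x" for x
    proof -
      have "norm (H x) \<le> norm (T x) + K * norm x"
        using norm_triangle_ineq[of "T x" "K *\<^sub>R x"] K0 by (simp add: Hx)
      also have "\<dots> \<le> K * norm x + K * norm x" using norm_blinfun[of T x] by (simp add: K_def mult.commute)
      also have "\<dots> \<le> (s + K) * norm x" using that mult_right_mono[of K s "norm x"] by (simp add: distrib_right)
      finally show ?thesis .
    qed
    then have "UNIV \<subseteq> growth_space H (s + K)" using that K0 by (intro subset_growth_space) auto
    then show ?thesis using that K0 by (auto simp: L_def)
  qed
  have inter: "x \<in> L s" if x: "\<And>r. r > s \<Longrightarrow> x \<in> L r" for s x
  proof (cases "s < - K")
    case True
    then have "x \<in> L ((s - K) / 2)" by (intro x) simp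
    then show ?thesis using True by (simp add: L_def)
  next
    case False
    have "norm ((blinfun_apply H ^^ k) x) \<le> (s + K) ^ k * norm x" for k
    proof (rule LIMSEQ_le_const)
      have "(\<lambda>n. s + inverse (real (Suc n))) \<longlonglongrightarrow> s + 0"
        by (intro tendsto_intros LIMSEQ_inverse_real_of_nat)
      then show "(\<lambda>n. (s + inverse (real (Suc n)) + K) ^ k * norm x) \<longlonglongrightarrow> (s + K) ^ k * norm x"
        by (intro tendsto_intros) simp
      show "\<exists>N. \<forall>n\<ge>N. norm ((blinfun_apply H ^^ k) x) \<le> (s + inverse (real (Suc n)) + K) ^ k * norm x"
      proof (intro exI allI impI)
        fix n :: nat
        have pos: "0 < inverse (real (Suc n))" by simp
        then have "x \<in> L (s + inverse (real (Suc n)))" by (intro x) simp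
        moreover have "\<not> s + inverse (real (Suc n)) < - K" using False pos by linarith
        ultimately show "norm ((blinfun_apply H ^^ k) x) \<le> (s + inverse (real (Suc n)) + K) ^ k * norm x"
          by (simp add: L_def growth_space_def del: of_nat_Suc)
      qed
    qed
    then show ?thesis using False by (simp add: L_def growth_space_def)
  qed
  have upper: "Re (cinner (T x) x) \<le> s * (norm x)\<^sup>2" if "x \<in> L s" for s x
  proof (cases "s < - K")
    case False
    then have "norm (H x) \<le> (s + K) * norm x" using that growth_space_norm by (simp add: L_def)
    then have "norm (H x) * norm x \<le> (s + K) * norm x * norm x" by (rule mult_right_mono) simp
    with Re_cinner_le[of "H x" x] show ?thesis
      by (simp add: Hx cinner_algebra cinner_self power2_eq_square algebra_simps)
  qed (use that in \<open>simp add: L_def\<close>)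
  have lower: "s * (norm x)\<^sup>2 \<le> Re (cinner (T x) x)" if x: "x \<bottom>\<^sub>s L s" for s x
  proof (cases "s \<le> - K")
    case True
    then have "s * (norm x)\<^sup>2 \<le> (- K) * (norm x)\<^sup>2" by (rule mult_right_mono) simp
    then show ?thesis using form_le_norm[of T x] by (simp add: K_def)
  next
    case False
    obtain N where N: "closed N" "csubspace N"
      "\<forall>U. (\<forall>x. blinfun_apply U (T x) = T (U x)) \<longrightarrow> (\<forall>x\<in>N. U x \<in> N)"
      "\<forall>x\<in>N. Re (cinner (T x) x) \<le> s * (norm x)\<^sup>2"
      "\<forall>x. x \<bottom>\<^sub>s N \<longrightarrow> s * (norm x)\<^sup>2 \<le> Re (cinner (T x) x)"
      by (rule spectral_splitting[OF selfadjoint, of s])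
    have TN: "T y \<in> N" if "y \<in> N" for y using N(3) that by blast
    have "N \<subseteq> growth_space H (s + K)"
    proof (rule subset_growth_space)
      fix y assume y: "y \<in> N"
      show "H y \<in> N" unfolding Hx using TN[OF y] y by (intro csubspace_simps N(2))
      have "norm (T y - ((- K + s) / 2) *\<^sub>R y) \<le> (s - - K) / 2 * norm y"
      proof (rule norm_le_of_form_bounds[OF selfadjoint N(2) TN])
        show "- K * (norm x)\<^sup>2 \<le> Re (cinner (T x) x)" for x
          using form_le_norm[of T x] by (simp add: K_def)
      qed (use N(4) y False in auto)
      moreover have "norm (H y) \<le> norm (T y - ((- K + s) / 2) *\<^sub>R y) + (s + K) / 2 * norm y"
      proof -
        have "H y = (T y - ((- K + s) / 2) *\<^sub>R y) + ((s + K) / 2) *\<^sub>R y"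
        proof -
          have "((s + K) / 2) *\<^sub>R y - ((- K + s) / 2) *\<^sub>R y = ((s + K) / 2 - (- K + s) / 2) *\<^sub>R y"
            by (simp only: scaleR_diff_left)
          also have "(s + K) / 2 - (- K + s) / 2 = K" by (simp add: field_simps)
          finally show ?thesis unfolding Hx by (metis add_diff_eq diff_add_eq)
        qed
        then show ?thesis
          using norm_triangle_ineq[of "T y - ((- K + s) / 2) *\<^sub>R y" "((s + K) / 2) *\<^sub>R y"] False by simp
      qed
      moreover have "(s - - K) / 2 * norm y + (s + K) / 2 * norm y = (s + K) * norm y"
        by (simp add: field_simps)
      ultimately show "norm (H y) \<le> (s + K) * norm y" by linarith
    qed (use False in simp)
    then have "N \<subseteq> L s" using False by (simp add: L_def)
    then have "x \<bottom>\<^sub>s N" using x by (auto simp: orthogonal_to_def)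
    then show ?thesis using N(5) by blast
  qed
  define P where "P s = proj (L s)" for s
  have PV: "P s x \<in> V" if x: "x \<in> V" for s x
  proof -
    interpret s: invariant_subspace "L s" T by (rule L)
    have LV: "proj V y \<in> L s" if "y \<in> L s" for y
    proof (cases "s < - K")
      case True
      then show ?thesis using that by (simp add: L_def proj_id mem_simps)
    next
      case False
      have "proj V y \<in> growth_space H (s + K)"
        by (rule proj_growth_space[OF H]) (use that False in \<open>auto simp: L_def Hx intro!: mem_simps invariant\<close>)
      then show ?thesis using False by (simp add: L_def)
    qed
    have "P s x = proj V (P s x)" unfolding P_def
    proof (rule s.proj_unique)
      show "proj V (proj (L s) x) \<in> L s" by (intro LV s.proj_in)
      have "cinner (proj V (x - proj (L s) x)) y = 0" if "y \<in> L s" for y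
      proof -
        have "cinner (x - proj (L s) x) (proj V y) = 0"
          using LV[OF that] s.proj_orthogonal[of x] by (auto simp: orthogonal_to_def)
        then show ?thesis
          by (rule trans[OF cinner_proj_left trans[OF cinner_proj_right[symmetric]]])
      qed
      then show "x - proj V (proj (L s) x) \<bottom>\<^sub>s L s"
        by (simp add: orthogonal_to_def proj_diff proj_id[OF x])
    qed
    then show ?thesis using proj_in by metis
  qed
  have PP: "P s (P s' x) = P s x" if "s \<le> s'" for s s' x
  proof -
    interpret s: closed_csubspace "L s" by (rule L')
    interpret s': closed_csubspace "L s'" by (rule L')
    have "P s (x - P s' x) = 0"
      using s'.proj_orthogonal[of x] mono[OF that] by (auto simp: P_def s.proj_eq_0_iff orthogonal_to_def)
    then show ?thesis by (simp add: P_def s.proj_diff)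
  qed
  have right: "continuous (at_right s) (\<lambda>r. P r x)" for s x
    unfolding P_def by (rule proj_right_continuous[OF L' mono inter]) auto
  have P0: "P s x = 0" if "s < - K" for s x
    using closed_csubspace.proj_in[OF L', of s x] that by (simp add: P_def L_def)
  have P1: "P s x = x" if "s \<ge> K" for s x
    using closed_csubspace.proj_id[OF L', of x s] high[OF that] by (simp add: P_def)
  have integral: "cinner (T x) x = complex_of_real (\<integral>s. s \<partial>interval_measure (\<lambda>s. (norm (P s x))\<^sup>2))" for x
  proof -
    define F where "F s = (norm (P s x))\<^sup>2" for s
    define \<Phi> where "\<Phi> s = Re (cinner (T (P s x)) (P s x))" for s
    have incr: "F v = F u + (norm (P v x - P u x))\<^sup>2" if "u \<le> v" for u v
      using closed_csubspace.proj_pythagoras[OF L', of "P v x" u] PP[OF that, of x]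
      by (simp add: F_def P_def)
    \<comment> \<open>The increment of \<open>P\<close> over \<open>(u,v]\<close> projects onto a subspace on which \<open>u \<le> T \<le> v\<close>.\<close>
    have prim: "stieltjes_primitive F \<Phi>"
      unfolding stieltjes_primitive_def
    proof (intro allI impI)
      fix u v :: real assume uv: "u \<le> v"
      interpret u: invariant_subspace "L u" T by (rule L)
      interpret v: invariant_subspace "L v" T by (rule L)
      define w where "w = P v x - P u x"
      have Pu: "P u x \<in> L u" and Pv: "P v x \<in> L v" by (simp_all add: P_def u.proj_in v.proj_in)
      have w: "w \<bottom>\<^sub>s L u"
        using u.proj_orthogonal[of "P v x"] PP[OF uv, of x] by (simp add: w_def P_def)
      have wv: "w \<in> L v" unfolding w_def by (intro v.mem_simps Pv subsetD[OF mono[OF uv] Pu])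
      have cross: "cinner w (T (P u x)) = 0"
        using w u.invariant[OF Pu] by (auto simp: orthogonal_to_def)
      have "P v x = P u x + w" by (simp add: w_def)
      then have "\<Phi> v = \<Phi> u + Re (cinner (T w) w)"
        using cross Re_cinner_commute[of "T (P u x)" w]
        by (simp add: \<Phi>_def blinfun.add_right cinner_algebra symmetric[of w])
      moreover have "F v - F u = (norm w)\<^sup>2" using incr[OF uv] by (simp add: w_def)
      ultimately show "u * (F v - F u) \<le> \<Phi> v - \<Phi> u \<and> \<Phi> v - \<Phi> u \<le> v * (F v - F u)"
        using upper[OF wv] lower[OF w] by simp
    qed
    have Fmono: "F u \<le> F v" if "u \<le> v" for u v using incr[OF that] by simp
    have Fright: "continuous (at_right s) F" for s
      unfolding F_def by (intro continuous_intros right)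
    obtain J where J: "stieltjes_primitive F J" "\<And>s. s < - K \<Longrightarrow> J s = 0"
      "\<And>s. s \<ge> K \<Longrightarrow> J s = (\<integral>s. s \<partial>interval_measure F)"
      by (rule stieltjes_primitive_integral[of F K, OF Fmono Fright]) (auto simp: F_def P0 P1)
    have K0: "- K - 1 \<le> K" unfolding K_def using norm_ge_zero[of T] by linarith
    have "\<Phi> K - \<Phi> (- K - 1) = J K - J (- K - 1)"
      by (rule stieltjes_primitive_unique[OF prim J(1) K0])
    then have "Re (cinner (T x) x) = (\<integral>s. s \<partial>interval_measure F)"
      using J(2)[of "- K - 1"] J(3)[of K] P0[of "- K - 1"] P1[of K] by (simp add: \<Phi>_def)
    then show ?thesis using cinner_form_real[OF selfadjoint, of x] by (simp add: F_def[abs_def])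
  qed
  have "resolution_of_identity V T P"
    unfolding resolution_of_identity_def
  proof (intro conjI allI impI ballI)
    show "orthogonal_projection_on V (P s)" for s
      unfolding orthogonal_projection_on_def
      using PV PP[of s s] closed_csubspace.cinner_proj_left[OF L'] closed_csubspace.cinner_proj_right[OF L']
      by (auto simp: P_def)
    show "\<exists>M. \<forall>x\<in>V. (\<forall>s < - M. P s x = 0) \<and> (\<forall>s\<ge>M. P s x = x)"
      using P0 P1 by blast
  qed (use PP right integral in auto)
  then show ?thesis by blast
qed

section \<open>Uniqueness of the resolution of the identity\<close>

locale spectral_resolution = invariant_subspace V T
  for V :: "'a::complex_hilbert set" and T :: "'a \<Rightarrow>\<^sub>L 'a" +
  fixes P :: "real \<Rightarrow> 'a \<Rightarrow> 'a"
  assumes resolution: "resolution_of_identity V T P"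
begin

lemma P_in: "x \<in> V \<Longrightarrow> P s x \<in> V"
  and P_idem: "x \<in> V \<Longrightarrow> P s (P s x) = P s x"
  and P_sym: "x \<in> V \<Longrightarrow> y \<in> V \<Longrightarrow> cinner (P s x) y = cinner x (P s y)"
  and P_P: "s \<le> s' \<Longrightarrow> x \<in> V \<Longrightarrow> P s (P s' x) = P s x"
  and P_right: "x \<in> V \<Longrightarrow> continuous (at_right s) (\<lambda>r. P r x)"
  and P_integral: "x \<in> V \<Longrightarrow> cinner (T x) x =
        complex_of_real (\<integral>s. s \<partial>interval_measure (\<lambda>s. (norm (P s x))\<^sup>2))"
  and P_bounded: "\<exists>M. \<forall>x\<in>V. (\<forall>s < - M. P s x = 0) \<and> (\<forall>s \<ge> M. P s x = x)"
  using resolution unfolding resolution_of_identity_def orthogonal_projection_on_def by simp_all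

lemma eq_of_cinner_eq:
  assumes "x \<in> V" "y \<in> V" "\<And>z. z \<in> V \<Longrightarrow> cinner x z = cinner y z"
  shows "x = y"
proof -
  have "cinner (x - y) (x - y) = 0"
    using assms(3)[of "x - y"] mem_simps(3)[OF assms(1,2)] by (simp add: cinner_diff_left)
  then show ?thesis by (simp add: cinner_self_eq_0_iff)
qed

lemma P_add: "x \<in> V \<Longrightarrow> y \<in> V \<Longrightarrow> P s (x + y) = P s x + P s y"
  by (rule eq_of_cinner_eq) (simp_all add: P_in mem_simps P_sym cinner_add_left)

lemma P_scaleC: "x \<in> V \<Longrightarrow> P s (c *\<^sub>C x) = c *\<^sub>C P s x"
  by (rule eq_of_cinner_eq) (simp_all add: P_in mem_simps P_sym cinner_scaleC_left)

lemma P_diff: "x \<in> V \<Longrightarrow> y \<in> V \<Longrightarrow> P s (x - y) = P s x - P s y"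
  by (rule eq_of_cinner_eq) (simp_all add: P_in mem_simps P_sym cinner_diff_left)

lemma P_0: "P s 0 = 0"
  using P_diff[of 0 0] mem_simps(1) by simp

lemma P_P': "s \<le> s' \<Longrightarrow> x \<in> V \<Longrightarrow> P s' (P s x) = P s x"
  by (rule eq_of_cinner_eq) (simp_all add: P_in P_sym P_P)

lemma P_pythagoras:
  assumes "u \<le> v" "x \<in> V"
  shows "(norm (P v x))\<^sup>2 = (norm (P u x))\<^sup>2 + (norm (P v x - P u x))\<^sup>2"
proof -
  have "cinner (P u x) (P v x - P u x) = cinner x (P u (P v x - P u x))"
    using assms by (intro P_sym mem_simps P_in)
  also have "P u (P v x - P u x) = 0"
    using assms by (simp add: P_diff P_in P_P P_idem)
  finally show ?thesis using pythagoras[of "P u x" "P v x - P u x"] by simp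
qed

lemma P_norm_mono: "u \<le> v \<Longrightarrow> x \<in> V \<Longrightarrow> (norm (P u x))\<^sup>2 \<le> (norm (P v x))\<^sup>2"
  using P_pythagoras by simp

lemma norm_complement_le:
  assumes "x \<in> V"
  shows "norm (P s x) \<le> norm x" "norm (x - P s x) \<le> norm x"
proof -
  have "cinner (P s x) (x - P s x) = cinner x (P s (x - P s x))"
    using assms by (intro P_sym mem_simps P_in)
  then have "(norm x)\<^sup>2 = (norm (P s x))\<^sup>2 + (norm (x - P s x))\<^sup>2"
    using pythagoras[of "P s x" "x - P s x"] assms by (simp add: P_diff P_in P_idem)
  then show "norm (P s x) \<le> norm x" "norm (x - P s x) \<le> norm x"
    by (auto intro: power2_le_imp_le)
qed

text \<open>
  The defining integral enters only through its primitive \<open>J\<close>, which is fixed outside \<open>[- M,M]\<close>.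
\<close>

definition form_primitive :: "real \<Rightarrow> 'a \<Rightarrow> (real \<Rightarrow> real) \<Rightarrow> bool" where
  "form_primitive M x J \<longleftrightarrow> stieltjes_primitive (\<lambda>s. (norm (P s x))\<^sup>2) J \<and>
     (\<forall>s < - M. P s x = 0 \<and> J s = 0) \<and> (\<forall>s \<ge> M. P s x = x \<and> J s = Re (cinner (T x) x))"

lemma form_primitive_exists: "\<exists>M. \<forall>x\<in>V. \<exists>J. form_primitive M x J"
proof -
  obtain M where M: "\<forall>x\<in>V. (\<forall>s < - M. P s x = 0) \<and> (\<forall>s \<ge> M. P s x = x)"
    using P_bounded by blast
  have "\<exists>J. form_primitive M x J" if x: "x \<in> V" for x
  proof -
    obtain J where "stieltjes_primitive (\<lambda>s. (norm (P s x))\<^sup>2) J" "\<And>s. s < - M \<Longrightarrow> J s = 0"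
      "\<And>s. s \<ge> M \<Longrightarrow> J s = (\<integral>s. s \<partial>interval_measure (\<lambda>s. (norm (P s x))\<^sup>2))"
    proof (rule stieltjes_primitive_integral[of "\<lambda>s. (norm (P s x))\<^sup>2" M])
      show "continuous (at_right s) (\<lambda>s. (norm (P s x))\<^sup>2)" for s
        by (intro continuous_intros P_right x)
    qed (use M x P_norm_mono in auto)
    then show ?thesis
      unfolding form_primitive_def using M x P_integral[OF x] by (intro exI[of _ J]) auto
  qed
  then show ?thesis by blast
qed

lemma form_primitive_at:
  assumes "x \<in> V"
  obtains J p q where "stieltjes_primitive (\<lambda>s. (norm (P s x))\<^sup>2) J" "p \<le> s" "s \<le> q"
    "P p x = 0" "J p = 0" "P q x = x" "J q = Re (cinner (T x) x)"
proof -
  obtain M J where J: "form_primitive M x J" using form_primitive_exists assms by blast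
  have "min (- M - 1) s < - M" "M \<le> max s M" by auto
  then show thesis
    using J unfolding form_primitive_def
    by (intro that[of J "min (- M - 1) s" "max s M"]) auto
qed

lemma form_le: assumes x: "x \<in> V" "P s x = x" shows "Re (cinner (T x) x) \<le> s * (norm x)\<^sup>2"
proof -
  obtain J p q where J: "stieltjes_primitive (\<lambda>s. (norm (P s x))\<^sup>2) J" "p \<le> s" "s \<le> q"
    "P p x = 0" "J p = 0" "P q x = x" "J q = Re (cinner (T x) x)"
    by (rule form_primitive_at[OF x(1)])
  have "J q - J s \<le> q * ((norm (P q x))\<^sup>2 - (norm (P s x))\<^sup>2)"
    and "J s - J p \<le> s * ((norm (P s x))\<^sup>2 - (norm (P p x))\<^sup>2)"
    using J(1-3) unfolding stieltjes_primitive_def by blast+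
  then show ?thesis using J(4-7) x by simp
qed

lemma form_ge: assumes x: "x \<in> V" "P s x = 0" shows "s * (norm x)\<^sup>2 \<le> Re (cinner (T x) x)"
proof -
  obtain J p q where J: "stieltjes_primitive (\<lambda>s. (norm (P s x))\<^sup>2) J" "p \<le> s" "s \<le> q"
    "P p x = 0" "J p = 0" "P q x = x" "J q = Re (cinner (T x) x)"
    by (rule form_primitive_at[OF x(1)])
  have "s * ((norm (P q x))\<^sup>2 - (norm (P s x))\<^sup>2) \<le> J q - J s"
    and "p * ((norm (P s x))\<^sup>2 - (norm (P p x))\<^sup>2) \<le> J s - J p"
    using J(1-3) unfolding stieltjes_primitive_def by blast+
  then show ?thesis using J(4-7) x by simp
qed

text \<open>
  If all \<open>P s x\<close> and \<open>P s y\<close> are orthogonal, the distribution functions of \<open>x\<close> and \<open>y\<close> add up to that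
  of \<open>x + y\<close>, hence so do the values of the quadratic form of \<open>T\<close>.
\<close>

lemma form_cross_zero:
  assumes x: "x \<in> V" and y: "y \<in> V" and orth: "\<And>s. cinner (P s x) (P s y) = 0"
  shows "Re (cinner (T x) y) = 0"
proof -
  obtain M where M: "\<forall>x\<in>V. \<exists>J. form_primitive M x J" using form_primitive_exists by blast
  have xy: "x + y \<in> V" using x y by (rule mem_simps)
  obtain J1 J2 J3 where J: "form_primitive M x J1" "form_primitive M y J2" "form_primitive M (x + y) J3"
    using M x y xy by blast
  note J1 = J(1)[unfolded form_primitive_def, THEN conjunct1] and J2 = J(2)[unfolded form_primitive_def, THEN conjunct1]
    and J3 = J(3)[unfolded form_primitive_def, THEN conjunct1]
  have "(\<lambda>s. (norm (P s x))\<^sup>2 + (norm (P s y))\<^sup>2) = (\<lambda>s. (norm (P s (x + y)))\<^sup>2)"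
    using pythagoras[OF orth] by (simp add: P_add[OF x y])
  then have J4: "stieltjes_primitive (\<lambda>s. (norm (P s (x + y)))\<^sup>2) (\<lambda>s. J1 s + J2 s)"
    using stieltjes_primitive_add[OF J1 J2] by simp
  \<comment> \<open>a point to the left of the support\<close>
  define p where "p = min (- M - 1) M"
  have p: "p < - M" "p \<le> M" by (auto simp: p_def)
  have "J3 M - J3 p = (J1 M + J2 M) - (J1 p + J2 p)"
    by (rule stieltjes_primitive_unique[OF J3 J4 p(2)])
  then have "Re (cinner (T (x + y)) (x + y)) = Re (cinner (T x) x) + Re (cinner (T y) y)"
    using J p by (simp add: form_primitive_def)
  then show ?thesis
    using Re_cinner_commute[of "T y" x] by (simp add: blinfun.add_right cinner_algebra symmetric[of x])
qed

text \<open>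
  Apply the preceding lemma to \<open>x\<close> in the range of \<open>P s\<close> and \<open>y\<close> in its kernel: \<open>P r y = 0\<close> for \<open>r \<le> s\<close>, and
  \<open>P r x = x\<close> for \<open>r \<ge> s\<close>.
\<close>

lemma T_range:
  assumes x: "x \<in> V" "P s x = x"
  shows "P s (T x) = T x"
proof -
  have Tx: "T x \<in> V" using x invariant by blast
  define y where "y = T x - P s (T x)"
  have y: "y \<in> V" unfolding y_def by (intro mem_simps P_in Tx)
  have Py: "P s y = 0" using Tx by (simp add: y_def P_diff P_in P_idem)
  have "cinner (P r x) (P r y) = 0" for r
  proof (cases "r \<le> s")
    case True
    then have "P r y = 0" using P_P[OF True y] Py P_0 by simp
    then show ?thesis by simp
  next
    case False
    then have "P r x = x" using P_P'[of s r x] x by simp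
    then have "cinner (P r x) (P r y) = cinner x y"
      using P_sym[OF x(1) P_in[OF y], of r r] P_sym[OF x(1) y, of r] P_idem[OF y] by simp
    also have "\<dots> = cinner x (P s y)" using P_sym[OF x(1) y, of s] x(2) by simp
    finally show ?thesis using Py by simp
  qed
  then have "Re (cinner (T x) y) = 0" by (rule form_cross_zero[OF x(1) y])
  moreover have "cinner (P s (T x)) y = 0" using P_sym[OF Tx y, of s] Py by simp
  ultimately have "(norm y)\<^sup>2 = 0"
    unfolding Re_cinner_self[symmetric] by (subst y_def) (simp add: cinner_diff_left)
  then show ?thesis by (simp add: y_def)
qed

lemma T_P: assumes x: "x \<in> V" shows "P s (T x) = T (P s x)"
proof (rule eq_of_cinner_eq)
  fix z assume z: "z \<in> V"
  have "cinner (P s (T x)) z = cinner x (T (P s z))"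
    using x z by (simp add: P_sym invariant symmetric)
  also have "T (P s z) = P s (T (P s z))"
    using T_range[OF P_in[OF z] P_idem[OF z]] by simp
  also have "cinner x \<dots> = cinner (T (P s x)) (P s z)"
    using x z by (simp add: P_sym[symmetric] invariant P_in symmetric)
  also have "\<dots> = cinner (P s (T (P s x))) z"
    using x z by (simp add: P_sym invariant P_in)
  also have "P s (T (P s x)) = T (P s x)"
    by (rule T_range[OF P_in[OF x] P_idem[OF x]])
  finally show "cinner (P s (T x)) z = cinner (T (P s x)) z" .
qed (use x in \<open>simp_all add: P_in invariant\<close>)

text \<open>The spectral subspace for \<open>[c,d]\<close> as computed from \<open>P\<close>.\<close>

definition E :: "real \<Rightarrow> real \<Rightarrow> 'a set" where
  "E c d = {x\<in>V. P d x = x \<and> (\<forall>s<c. P s x = 0)}"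

lemma csubspace_E: "csubspace (E c d)"
  unfolding complex_vector.subspace_def E_def
  by (auto simp: mem_simps P_0 P_add P_scaleC complex_vector.scale_zero_right)

lemma E_invariant: "x \<in> E c d \<Longrightarrow> T x \<in> E c d"
  by (auto simp: E_def invariant T_P blinfun.zero_right)

lemma E_form_ge: assumes x: "x \<in> E c d" shows "c * (norm x)\<^sup>2 \<le> Re (cinner (T x) x)"
proof (rule LIMSEQ_le_const2)
  have "(\<lambda>n. c - inverse (real (Suc n))) \<longlonglongrightarrow> c - 0"
    by (intro tendsto_diff tendsto_const LIMSEQ_inverse_real_of_nat)
  then show "(\<lambda>n. (c - inverse (real (Suc n))) * (norm x)\<^sup>2) \<longlonglongrightarrow> c * (norm x)\<^sup>2"
    by (intro tendsto_intros) simp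
  show "\<exists>N. \<forall>n\<ge>N. (c - inverse (real (Suc n))) * (norm x)\<^sup>2 \<le> Re (cinner (T x) x)"
  proof (intro exI allI impI)
    fix n :: nat
    have "c - inverse (real (Suc n)) < c" by (simp del: of_nat_Suc)
    then show "(c - inverse (real (Suc n))) * (norm x)\<^sup>2 \<le> Re (cinner (T x) x)"
      using x by (intro form_ge) (auto simp: E_def)
  qed
qed

lemma iterate_P:
  assumes x: "x \<in> V"
  shows "(blinfun_apply (T - m *\<^sub>R id_blinfun) ^^ k) x \<in> V"
    "(blinfun_apply (T - m *\<^sub>R id_blinfun) ^^ k) (P s x) = P s ((blinfun_apply (T - m *\<^sub>R id_blinfun) ^^ k) x)"
proof -
  let ?D = "blinfun_apply (T - m *\<^sub>R id_blinfun)"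
  have "(?D ^^ k) x \<in> V \<and> (?D ^^ k) (P s x) = P s ((?D ^^ k) x)"
  proof (induction k)
    case (Suc k)
    define y where "y = (?D ^^ k) x"
    have y: "y \<in> V" using Suc unfolding y_def by blast
    have "P s (m *\<^sub>R y) = m *\<^sub>R P s y" using P_scaleC[OF y] by (simp add: scaleR_scaleC)
    then have "?D (P s y) = P s (?D y)"
      using y by (simp add: P_diff T_P invariant mem_simps)
    moreover have "?D y \<in> V" using y by (simp add: invariant mem_simps)
    moreover have "(?D ^^ k) (P s x) = P s y" using Suc by (simp only: y_def)
    ultimately show ?case by (simp only: funpow.simps o_apply y_def[symmetric] simp_thms)
  qed (use x in simp)
  then show "(?D ^^ k) x \<in> V" "(?D ^^ k) (P s x) = P s ((?D ^^ k) x)" by blast+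
qed

text \<open>
  Any resolution of the identity therefore has the same spectral subspaces: on \<open>E c d\<close> the iterates
  of \<open>T - m\<close> grow at most like \<open>h\<^sup>k\<close>, and a vector whose iterates grow at this rate has no component
  on which \<open>T\<close> stays away from \<open>[c,d]\<close>.
\<close>

lemma E_eq_spectral_space:
  assumes cd: "c < d"
  shows "E c d = V \<inter> spectral_space T c d"
proof (intro equalityI subsetI)
  fix x assume x: "x \<in> E c d"
  have "E c d \<subseteq> spectral_space T c d"
    unfolding spectral_space_def
  proof (rule subset_growth_space)
    fix y assume y: "y \<in> E c d"
    show "(T - ((c + d) / 2) *\<^sub>R id_blinfun) y \<in> E c d"
      unfolding shift_apply using y E_invariant by (intro csubspace_simps csubspace_E) auto
    have "norm (T y - ((c + d) / 2) *\<^sub>R y) \<le> (d - c) / 2 * norm y"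
      by (rule norm_le_of_form_bounds[OF selfadjoint csubspace_E[of c d] E_invariant cd E_form_ge _ y])
        (auto simp: E_def intro: form_le)
    then show "norm ((T - ((c + d) / 2) *\<^sub>R id_blinfun) y) \<le> (d - c) / 2 * norm y" by simp
  qed (use cd in simp)
  then show "x \<in> V \<inter> spectral_space T c d" using x by (auto simp: E_def)
next
  fix x assume x: "x \<in> V \<inter> spectral_space T c d"
  define m h where "m = (c + d) / 2" and "h = (d - c) / 2"
  let ?D = "T - m *\<^sub>R id_blinfun"
  have xV: "x \<in> V" and growth: "norm ((blinfun_apply ?D ^^ k) x) \<le> norm x * h ^ k" for k
    using x growth_space_iterate by (auto simp: spectral_space_def m_def h_def)
  have h: "0 \<le> h" using cd by (simp add: h_def)
  have above: "P r x = x" if r: "r > d" for r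
  proof -
    have "x - P r x = 0"
    proof (rule eq_0_of_expanding[OF h, where q = "r - m" and N = "{y\<in>V. P r y = 0}" and D = "?D" and C = "norm x"])
      show "h < r - m" using r by (simp add: h_def m_def field_simps)
      show "x - P r x \<in> {y\<in>V. P r y = 0}" using xV by (simp add: P_diff P_in P_idem mem_simps)
      fix y assume y: "y \<in> {y\<in>V. P r y = 0}"
      then show "?D y \<in> {y\<in>V. P r y = 0}"
        using P_scaleC[of y r "of_real m"]
        by (simp add: P_diff T_P invariant mem_simps blinfun.zero_right scaleR_scaleC complex_vector.scale_zero_right)
      show "(r - m) * norm y \<le> norm (?D y)"
        unfolding shift_apply by (rule norm_ge_of_form_ge) (use y form_ge in auto)
    next
      fix k
      have "(blinfun_apply ?D ^^ k) (x - P r x) = (blinfun_apply ?D ^^ k) x - P r ((blinfun_apply ?D ^^ k) x)"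
        using iterate_add[of k ?D "x - P r x" "P r x"] iterate_P(2)[OF xV] by (simp add: algebra_simps)
      then have "norm ((blinfun_apply ?D ^^ k) (x - P r x)) \<le> norm ((blinfun_apply ?D ^^ k) x)"
        using norm_complement_le(2)[OF iterate_P(1)[OF xV]] by simp
      then show "norm ((blinfun_apply ?D ^^ k) (x - P r x)) \<le> norm x * h ^ k"
        using growth order_trans by blast
    qed
    then show ?thesis by simp
  qed
  have "P d x = x"
  proof (rule tendsto_unique[OF trivial_limit_at_right_real])
    show "((\<lambda>r. P r x) \<longlongrightarrow> P d x) (at_right d)"
      using P_right[OF xV, of d] by (simp add: continuous_within)
    have "eventually (\<lambda>r. P r x = x) (at_right d)"
      by (auto simp: eventually_at_filter above)
    then show "((\<lambda>r. P r x) \<longlongrightarrow> x) (at_right d)" by (rule tendsto_eventually)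
  qed
  moreover have "P s x = 0" if s: "s < c" for s
  proof (rule eq_0_of_expanding[OF h, where q = "m - s" and N = "{y\<in>V. P s y = y}" and D = "?D" and C = "norm x"])
    show "h < m - s" using s by (simp add: h_def m_def field_simps)
    show "P s x \<in> {y\<in>V. P s y = y}" using xV by (simp add: P_in P_idem)
    fix y assume y: "y \<in> {y\<in>V. P s y = y}"
    then show "?D y \<in> {y\<in>V. P s y = y}"
      using P_scaleC[of y s "of_real m"]
      by (simp add: P_diff T_P invariant mem_simps scaleR_scaleC)
    show "(m - s) * norm y \<le> norm (?D y)"
      unfolding shift_apply by (rule norm_ge_of_form_le) (use y form_le in auto)
  next
    fix k
    have "norm ((blinfun_apply ?D ^^ k) (P s x)) \<le> norm ((blinfun_apply ?D ^^ k) x)"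
      using norm_complement_le(1)[OF iterate_P(1)[OF xV]] iterate_P(2)[OF xV] by simp
    then show "norm ((blinfun_apply ?D ^^ k) (P s x)) \<le> norm x * h ^ k"
      using growth order_trans by blast
  qed
  ultimately show "x \<in> E c d" using xV by (simp add: E_def)
qed

end

section \<open>Spectral subspaces\<close>

context invariant_subspace
begin

lemma spectral_subspace_eq_E:
  obtains P where "spectral_resolution V T P"
    "\<And>c d. spectral_subspace_on V T c d = spectral_resolution.E V P c d"
proof -
  define P where "P = (SOME P. resolution_of_identity V T P)"
  have "resolution_of_identity V T P"
    unfolding P_def using resolution_of_identity_exists by (rule someI_ex)
  then interpret spectral_resolution V T P by unfold_locales
  show thesis
    by (rule that[OF spectral_resolution_axioms]) (simp add: spectral_subspace_on_def P_def[symmetric] E_def Let_def)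
qed

theorem spectral_subspace_eq:
  assumes "c < d"
  shows "spectral_subspace_on V T c d = V \<inter> spectral_space T c d"
proof -
  obtain P where P: "spectral_resolution V T P"
    "\<And>c d. spectral_subspace_on V T c d = spectral_resolution.E V P c d"
    using spectral_subspace_eq_E by blast
  show ?thesis unfolding P(2) by (rule spectral_resolution.E_eq_spectral_space[OF P(1) assms])
qed

end

text \<open>
  For selfadjoint \<open>T\<close> this says that \<open>z\<close> is not in the spectrum; the lower bound is what survives
  perturbation and restriction.
\<close>

definition regular_point :: "'a::complex_hilbert set \<Rightarrow> ('a \<Rightarrow>\<^sub>L 'a) \<Rightarrow> real \<Rightarrow> bool" where
  "regular_point V T z \<longleftrightarrow> (\<exists>\<delta>>0. \<forall>x\<in>V. \<delta> * norm x \<le> norm (T x - z *\<^sub>R x))"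

context invariant_subspace
begin

text \<open>
  A symmetric operator that is bounded below has closed range, and the orthogonal complement of the
  range, being the kernel, vanishes.
\<close>

lemma shift_surjective:
  assumes \<delta>: "\<delta> > 0" "\<And>x. x \<in> V \<Longrightarrow> \<delta> * norm x \<le> norm (T x - z *\<^sub>R x)" and y: "y \<in> V"
  shows "\<exists>x\<in>V. T x - z *\<^sub>R x = y"
proof -
  define f where "f x = T x - z *\<^sub>R x" for x
  have f: "f (x + y) = f x + f y" "f (x - y) = f x - f y" "f (c *\<^sub>C x) = c *\<^sub>C f x" for x y c
    by (simp_all add: f_def blinfun.add_right blinfun.diff_right scaleR_add_right scaleR_diff_right
        selfadjoint_scaleC[OF selfadjoint] scaleC_scaleR_commute scaleC_diff_right)
  have fV: "f x \<in> V" if "x \<in> V" for x unfolding f_def using that by (intro mem_simps invariant)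
  have fsym: "cinner (f u) v = cinner u (f v)" for u v
    by (simp add: f_def cinner_algebra symmetric)
  have "closed_csubspace (f ` V)"
  proof
    have "f 0 = 0" by (simp add: f_def blinfun.zero_right)
    then show "csubspace (f ` V)"
      unfolding complex_vector.subspace_def
      by (auto simp: f(1)[symmetric] f(3)[symmetric] mem_simps intro!: image_eqI[of 0 f 0])
    show "closed (f ` V)" unfolding closed_sequential_limits
    proof (intro allI impI, elim conjE)
      fix w l assume w: "\<forall>n. w n \<in> f ` V" and l: "w \<longlonglongrightarrow> l"
      then have "\<forall>n. \<exists>x. x \<in> V \<and> w n = f x" by blast
      then obtain x where x: "\<And>n. x n \<in> V" "\<And>n. w n = f (x n)" by metis
      have "Cauchy x"
      proof (rule CauchyI)
        fix e :: real assume "0 < e"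
        then obtain M where M: "\<forall>m\<ge>M. \<forall>n\<ge>M. norm (w m - w n) < e * \<delta>"
          using CauchyD[OF LIMSEQ_imp_Cauchy[OF l], of "e * \<delta>"] \<delta>(1) by auto
        show "\<exists>M. \<forall>m\<ge>M. \<forall>n\<ge>M. norm (x m - x n) < e"
        proof (intro exI allI impI)
          fix m n assume "M \<le> m" "M \<le> n"
          then have "\<delta> * norm (x m - x n) < \<delta> * e"
            using M \<delta>(2)[of "x m - x n"] x mem_simps(3)[OF x(1) x(1), of m n]
            by (fastforce simp: f(2)[symmetric] f_def[symmetric] mult.commute)
          then show "norm (x m - x n) < e" using \<delta>(1) by simp
        qed
      qed
      then obtain u where u: "x \<longlonglongrightarrow> u" using Cauchy_convergent_iff convergent_def by blast
      have uV: "u \<in> V" using closed x(1) u closed_sequentially by blast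
      have "(\<lambda>n. f (x n)) \<longlonglongrightarrow> f u" unfolding f_def by (intro tendsto_intros u)
      moreover have "w = (\<lambda>n. f (x n))" using x(2) by (rule ext)
      ultimately have "l = f u" using l LIMSEQ_unique by blast
      then show "l \<in> f ` V" using uV by blast
    qed
  qed
  then interpret W: closed_csubspace "f ` V" .
  define w where "w = y - proj (f ` V) y"
  have pV: "proj (f ` V) y \<in> V" using W.proj_in[of y] fV by auto
  then have wV: "w \<in> V" unfolding w_def using y by (intro mem_simps)
  have "cinner w (f (f w)) = 0"
    using W.proj_orthogonal[of y] fV[OF wV] unfolding w_def[symmetric] orthogonal_to_def by blast
  then have "cinner (f w) (f w) = 0" using fsym[of w "f w"] by simp
  then have "f w = 0" by (simp add: cinner_self_eq_0_iff)
  then have "\<delta> * norm w \<le> 0" using \<delta>(2)[OF wV] by (simp add: f_def)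
  then have "w = 0" using \<delta>(1) by (simp add: mult_le_0_iff)
  then have "y \<in> f ` V" using W.proj_in[of y] by (simp add: w_def)
  then show ?thesis by (auto simp: f_def)
qed

lemma regular_point_iff: "regular_point V T z \<longleftrightarrow> complex_of_real z \<notin> spectrum_on V T"
proof
  assume "complex_of_real z \<notin> spectrum_on V T"
  then obtain B :: "'a \<Rightarrow>\<^sub>L 'a" where B: "\<And>x. x \<in> V \<Longrightarrow> B (T x - z *\<^sub>R x) = x"
    unfolding spectrum_on_def by (auto simp: scaleC_scaleR)
  define \<delta> where "\<delta> = inverse (norm B + 1)"
  have pos: "norm B + 1 > 0" by (simp add: add_nonneg_pos)
  have "\<delta> * norm x \<le> norm (T x - z *\<^sub>R x)" if "x \<in> V" for x
  proof -
    have "norm x \<le> norm B * norm (T x - z *\<^sub>R x)"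
      using norm_blinfun[of B "T x - z *\<^sub>R x"] B[OF that] by simp
    also have "\<dots> \<le> (norm B + 1) * norm (T x - z *\<^sub>R x)" by (intro mult_right_mono) auto
    finally show ?thesis using pos by (simp add: \<delta>_def field_simps)
  qed
  then show "regular_point V T z" unfolding regular_point_def using pos by (intro exI[of _ \<delta>]) (auto simp: \<delta>_def)
next
  assume "regular_point V T z"
  then obtain \<delta> where \<delta>: "\<delta> > 0" "\<And>x. x \<in> V \<Longrightarrow> \<delta> * norm x \<le> norm (T x - z *\<^sub>R x)"
    unfolding regular_point_def by blast
  define f where "f x = T x - z *\<^sub>R x" for x
  have f: "f (x + y) = f x + f y" "f (x - y) = f x - f y" "f (r *\<^sub>R x) = r *\<^sub>R f x" for x y r
    by (simp_all add: f_def blinfun.add_right blinfun.diff_right scaleR_add_right scaleR_diff_right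
        blinfun.scaleR_right)
  have fV: "f x \<in> V" if "x \<in> V" for x unfolding f_def using that by (intro mem_simps invariant)
  have inj: "x = y" if "x \<in> V" "y \<in> V" "f x = f y" for x y
    using \<delta>(2)[of "x - y"] that mem_simps(3)[of x y] \<delta>(1) f(2)[of x y]
    by (simp add: f_def[symmetric] mult_le_0_iff)
  have "\<forall>y\<in>V. \<exists>x\<in>V. f x = y" unfolding f_def using shift_surjective[OF \<delta>] by blast
  then obtain g where g: "\<And>y. y \<in> V \<Longrightarrow> g y \<in> V" "\<And>y. y \<in> V \<Longrightarrow> f (g y) = y" by metis
  have "bounded_linear (\<lambda>x. g (proj V x))"
  proof (rule bounded_linear_intro[of _ "inverse \<delta>"])
    fix x y r
    show "g (proj V (x + y)) = g (proj V x) + g (proj V y)"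
      by (rule inj) (simp_all add: f g proj_in mem_simps proj_add)
    have "proj V (r *\<^sub>R x) = r *\<^sub>R proj V x" by (simp add: scaleR_scaleC proj_scaleC)
    then show "g (proj V (r *\<^sub>R x)) = r *\<^sub>R g (proj V x)"
      using inj[of "g (proj V (r *\<^sub>R x))" "r *\<^sub>R g (proj V x)"] by (simp add: f g proj_in mem_simps)
    have "\<delta> * norm (g (proj V x)) \<le> norm (proj V x)"
      using \<delta>(2)[OF g(1)[OF proj_in], of x] g(2)[OF proj_in, of x] by (simp add: f_def[symmetric])
    then show "norm (g (proj V x)) \<le> norm x * inverse \<delta>"
      using norm_proj_le[of x] \<delta>(1) by (simp add: field_simps)
  qed
  then have B: "blinfun_apply (Blinfun (\<lambda>x. g (proj V x))) = (\<lambda>x. g (proj V x))"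
    by (rule bounded_linear_Blinfun_apply)
  have "g (f x) = x" if "x \<in> V" for x by (rule inj) (use that g fV in auto)
  then have "\<forall>x\<in>V. Blinfun (\<lambda>x. g (proj V x)) x \<in> V \<and> Blinfun (\<lambda>x. g (proj V x)) (f x) = x \<and>
      f (Blinfun (\<lambda>x. g (proj V x)) x) = x"
    unfolding B using g fV by (simp add: proj_id)
  then show "complex_of_real z \<notin> spectrum_on V T"
    unfolding spectrum_on_def scaleC_scaleR f_def[symmetric] mem_Collect_eq not_not by (rule exI)
qed

lemma closed_csubspace_spectral: "c < d \<Longrightarrow> closed_csubspace (V \<inter> spectral_space T c d)"
  unfolding spectral_space_def
  by unfold_locales
    (auto intro!: closed_Int closed complex_vector.subspace_inter csubspace csubspace_growth_space
      closed_growth_space selfadjoint_shift selfadjoint)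

lemma spectral_space_norm:
  "x \<in> spectral_space T c d \<Longrightarrow> norm (T x - ((c + d) / 2) *\<^sub>R x) \<le> (d - c) / 2 * norm x"
  unfolding spectral_space_def using growth_space_norm by fastforce

lemma spectral_space_invariant:
  "c < d \<Longrightarrow> x \<in> spectral_space T c d \<Longrightarrow> T x \<in> spectral_space T c d"
  unfolding spectral_space_def
  by (rule invariant_subspace.invariant[OF invariant_subspace_growth_space])
    (auto intro!: selfadjoint_shift selfadjoint simp: blinfun.diff_right blinfun.scaleR_right)

text \<open>Orthogonality within \<open>V\<close> suffices, since the projection onto \<open>V\<close> preserves growth spaces.\<close>

lemma spectral_space_norm_ge:
  assumes cd: "c < d" and x: "x \<in> V" "x \<bottom>\<^sub>s V \<inter> spectral_space T c d"
  shows "(d - c) / 2 * norm x \<le> norm (T x - ((c + d) / 2) *\<^sub>R x)"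
proof -
  let ?D = "T - ((c + d) / 2) *\<^sub>R id_blinfun"
  have "x \<bottom>\<^sub>s growth_space ?D ((d - c) / 2)" unfolding orthogonal_to_def
  proof
    fix y assume "y \<in> growth_space ?D ((d - c) / 2)"
    then have "proj V y \<in> growth_space ?D ((d - c) / 2)"
      by (intro proj_growth_space selfadjoint_shift selfadjoint) (use cd in \<open>auto intro!: mem_simps invariant\<close>)
    then have "cinner x (proj V y) = 0"
      using x(2) proj_in by (auto simp: orthogonal_to_def spectral_space_def)
    then show "cinner x y = 0" by (simp add: cinner_proj_of_mem[OF x(1)])
  qed
  from norm_ge_of_orthogonal_growth_space[OF selfadjoint_shift[OF selfadjoint] _ this] cd
  show ?thesis by simp
qed

text \<open>
  For the spectral resolution, \<open>x = P b x + (x - P b x)\<close>; the two spectral subspaces could only share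
  eigenvectors for the eigenvalue \<open>b\<close>.
\<close>

lemma cdim_spectral_subspace_split:
  assumes cbd: "c < b" "b < d" and b: "regular_point V T b"
    and fin: "cfinite_dim (spectral_subspace_on V T c d)"
  shows "cdim (spectral_subspace_on V T c d) =
    cdim (spectral_subspace_on V T c b) + cdim (spectral_subspace_on V T b d)"
    "cfinite_dim (spectral_subspace_on V T c b)" "cfinite_dim (spectral_subspace_on V T b d)"
proof -
  obtain P where P: "spectral_resolution V T P"
    "\<And>c d. spectral_subspace_on V T c d = spectral_resolution.E V P c d"
    using spectral_subspace_eq_E by blast
  interpret spectral_resolution V T P by (rule P(1))
  have b0: "P b x = x" if "x \<in> V" "P r x = x" "r < b" for x r
    using P_P'[of r b x] that by simp
  have d0: "P d x = x" if "x \<in> V" "P r x = x" "r < d" for x r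
    using P_P'[of r d x] that by simp
  have down: "P s x = 0" if "x \<in> V" "P r x = 0" "s \<le> r" for x r s
    using P_P[of s r x] that P_0 by simp
  have sub1: "E c b \<subseteq> E c d" using cbd d0 by (auto simp: E_def)
  have sub2: "E b d \<subseteq> E c d" using cbd by (auto simp: E_def)
  show fin1: "cfinite_dim (spectral_subspace_on V T c b)" and fin2: "cfinite_dim (spectral_subspace_on V T b d)"
    using fin sub1 sub2 cfinite_dim_subset unfolding P(2) by blast+
  show "cdim (spectral_subspace_on V T c d) =
    cdim (spectral_subspace_on V T c b) + cdim (spectral_subspace_on V T b d)"
    unfolding P(2)
  proof (rule cdim_direct_sum)
    fix x assume x: "x \<in> E c b" "x \<in> E b d"
    obtain \<delta> where \<delta>: "\<delta> > 0" "\<And>x. x \<in> V \<Longrightarrow> \<delta> * norm x \<le> norm (T x - b *\<^sub>R x)"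
      using b unfolding regular_point_def by blast
    have "x \<in> E (b - \<delta> / 2) b" using x \<delta>(1) by (auto simp: E_def)
    then have xs: "x \<in> V \<inter> spectral_space T (b - \<delta> / 2) b"
      using E_eq_spectral_space[of "b - \<delta> / 2" b] \<delta>(1) by simp
    define m where "m = (b - \<delta> / 2 + b) / 2"
    have "norm (T x - m *\<^sub>R x) \<le> (\<delta> / 4) * norm x"
      using spectral_space_norm[of x "b - \<delta> / 2" b] xs by (simp add: m_def)
    moreover have "norm (T x - b *\<^sub>R x) \<le> norm (T x - m *\<^sub>R x) + (\<delta> / 4) * norm x"
    proof -
      have "T x - b *\<^sub>R x = (T x - m *\<^sub>R x) - (b - m) *\<^sub>R x" by (simp add: scaleR_diff_left)
      moreover have "norm ((b - m) *\<^sub>R x) = (\<delta> / 4) * norm x" using \<delta>(1) by (simp add: m_def field_simps)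
      ultimately show ?thesis by (metis norm_triangle_ineq4)
    qed
    ultimately have "\<delta> * norm x \<le> (\<delta> / 2) * norm x" using \<delta>(2)[of x] xs by simp
    then show "x = 0" using \<delta>(1) by (simp add: field_simps)
  next
    fix x assume x: "x \<in> E c d"
    then have xV: "x \<in> V" by (simp add: E_def)
    have "P b x \<in> E c b" using x cbd by (auto simp: E_def P_in P_idem P_P)
    moreover have "x - P b x \<in> E b d"
      using x xV cbd P_P'[of b d x] P_P[of _ b x] by (auto simp: E_def P_diff P_in mem_simps)
    ultimately show "\<exists>y\<in>E c b. \<exists>z\<in>E b d. x = y + z" by (metis add.commute diff_add_cancel)
  next
    fix x y assume "x \<in> E c b" "y \<in> E b d"
    then show "x + y \<in> E c d"
      using sub1 sub2 by (intro csubspace_simps csubspace_E) auto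
  qed (use fin1 fin2 in \<open>auto simp: P(2) csubspace_E\<close>)
qed

text \<open>
  On the spectral subspace \<open>(T - c)(T - d) = (T - m)\<^sup>2 - h\<^sup>2\<close> is bounded below, and
  \<open>\<parallel>((T - m)\<^sup>2 - h\<^sup>2) x\<parallel>\<^sup>2 \<le> h\<^sup>2 (h\<^sup>2 \<parallel>x\<parallel>\<^sup>2 - \<parallel>(T - m) x\<parallel>\<^sup>2)\<close>.
\<close>

lemma spectral_space_strict:
  assumes cd: "c < d" and reg: "regular_point V T c" "regular_point V T d"
  obtains \<rho> where "\<rho> < (d - c) / 2"
    "\<And>x. x \<in> V \<inter> spectral_space T c d \<Longrightarrow> norm (T x - ((c + d) / 2) *\<^sub>R x) \<le> \<rho> * norm x"
proof -
  define m h where "m = (c + d) / 2" and "h = (d - c) / 2"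
  have h: "h > 0" using cd by (simp add: h_def)
  obtain p where p: "p > 0" "\<And>x. x \<in> V \<Longrightarrow> p * norm x \<le> norm (T x - c *\<^sub>R x)"
    using reg(1) unfolding regular_point_def by blast
  obtain q where q: "q > 0" "\<And>x. x \<in> V \<Longrightarrow> q * norm x \<le> norm (T x - d *\<^sub>R x)"
    using reg(2) unfolding regular_point_def by blast
  define \<eta> where "\<eta> = (p * q / h)\<^sup>2"
  have \<eta>: "\<eta> > 0" using p q h by (simp add: \<eta>_def)
  define \<rho> where "\<rho> = sqrt (max 0 (h\<^sup>2 - \<eta>))"
  have "\<rho> < sqrt (h\<^sup>2)" unfolding \<rho>_def by (rule real_sqrt_less_mono) (use \<eta> h in simp)
  then have \<rho>: "\<rho> < h" using h by simp
  moreover have "norm (T x - m *\<^sub>R x) \<le> \<rho> * norm x" if x: "x \<in> V \<inter> spectral_space T c d" for x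
  proof -
    define U where "U = T - m *\<^sub>R id_blinfun"
    have U: "selfadjoint U" unfolding U_def by (rule selfadjoint_shift[OF selfadjoint])
    have Ux: "U y = T y - m *\<^sub>R y" for y unfolding U_def by (rule shift_apply)
    have UxS: "U x \<in> V \<inter> spectral_space T c d"
      unfolding Ux using x spectral_space_invariant[OF cd] invariant
      by (intro closed_csubspace.mem_simps[OF closed_csubspace_spectral[OF cd]]) auto
    have "norm (U (U x)) \<le> h * norm (U x)"
      using spectral_space_norm[of "U x" c d] UxS unfolding Ux[of "U x"] m_def h_def by simp
    then have UU: "(norm (U (U x)))\<^sup>2 \<le> h\<^sup>2 * (norm (U x))\<^sup>2"
      unfolding power_mult_distrib[symmetric] by (rule power_mono) simp
    have dV: "T x - d *\<^sub>R x \<in> V" using x invariant by (intro mem_simps) auto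
    have "p * (q * norm x) \<le> p * norm (T x - d *\<^sub>R x)"
      using p(1) q(2)[of x] x by (intro mult_left_mono) auto
    also have "\<dots> \<le> norm (T (T x - d *\<^sub>R x) - c *\<^sub>R (T x - d *\<^sub>R x))" by (rule p(2)[OF dV])
    also have "T (T x - d *\<^sub>R x) - c *\<^sub>R (T x - d *\<^sub>R x) = U (U x) - (h\<^sup>2) *\<^sub>R x"
    proof -
      have cm: "c = m - h" and dm: "d = m + h" by (simp_all add: m_def h_def field_simps)
      show ?thesis unfolding Ux cm dm
        by (simp add: blinfun.diff_right blinfun.add_right blinfun.scaleR_right scaleR_diff_right
            scaleR_diff_left scaleR_add_left scaleR_add_right power2_eq_square algebra_simps)
    qed
    finally have "(p * (q * norm x))\<^sup>2 \<le> (norm (U (U x) - (h\<^sup>2) *\<^sub>R x))\<^sup>2"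
      using p(1) q(1) by (intro power_mono) auto
    also have "\<dots> = (norm (U (U x)))\<^sup>2 - 2 * h\<^sup>2 * (norm (U x))\<^sup>2 + h\<^sup>2 * h\<^sup>2 * (norm x)\<^sup>2"
    proof -
      have "Re (cinner (U (U x)) x) = (norm (U x))\<^sup>2"
        using selfadjoint_cinner[OF U, of "U x" x] Re_cinner_self[of "U x"] by simp
      then show ?thesis unfolding norm_diff_square by (simp add: cinner_scaleR_right power_mult_distrib power2_eq_square)
    qed
    also have "\<dots> \<le> h\<^sup>2 * (h\<^sup>2 * (norm x)\<^sup>2 - (norm (U x))\<^sup>2)" using UU by (simp add: algebra_simps)
    finally have "\<eta> * (norm x)\<^sup>2 \<le> h\<^sup>2 * (norm x)\<^sup>2 - (norm (U x))\<^sup>2"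
      using h by (simp add: \<eta>_def power_divide power_mult_distrib pos_divide_le_eq mult_ac)
    then have "(norm (U x))\<^sup>2 \<le> (h\<^sup>2 - \<eta>) * (norm x)\<^sup>2" by (simp add: left_diff_distrib)
    also have "\<dots> \<le> max 0 (h\<^sup>2 - \<eta>) * (norm x)\<^sup>2" by (intro mult_right_mono) auto
    also have "\<dots> = (\<rho> * norm x)\<^sup>2" by (simp add: \<rho>_def power_mult_distrib)
    finally have "norm (U x) \<le> \<rho> * norm x" by (rule power2_le_imp_le) (simp add: \<rho>_def)
    then show ?thesis by (simp add: Ux)
  qed
  ultimately show thesis using that by (auto simp: m_def h_def)
qed

text \<open>
  A vector \<open>x\<close> of the spectral subspace of \<open>T\<close> orthogonal to that of \<open>T'\<close> would satisfy
  \<open>h \<parallel>x\<parallel> \<le> \<parallel>(T' - m) x\<parallel> \<le> (\<rho> + \<parallel>T' - T\<parallel>) \<parallel>x\<parallel>\<close> with \<open>\<rho> < h\<close>.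
\<close>

lemma cdim_spectral_subspace_lower_semicontinuous:
  assumes cd: "c < d" and reg: "regular_point V T c" "regular_point V T d"
  obtains \<epsilon> where "\<epsilon> > 0" "\<And>T'. invariant_subspace V T' \<Longrightarrow> norm (T' - T) < \<epsilon> \<Longrightarrow>
    cfinite_dim (spectral_subspace_on V T' c d) \<Longrightarrow>
    cdim (spectral_subspace_on V T c d) \<le> cdim (spectral_subspace_on V T' c d)"
proof -
  obtain \<rho> where \<rho>: "\<rho> < (d - c) / 2"
    "\<And>x. x \<in> V \<inter> spectral_space T c d \<Longrightarrow> norm (T x - ((c + d) / 2) *\<^sub>R x) \<le> \<rho> * norm x"
    using spectral_space_strict[OF cd reg] by blast
  show thesis
  proof (rule that[of "(d - c) / 2 - \<rho>"])
    fix T' assume T': "invariant_subspace V T'" and small: "norm (T' - T) < (d - c) / 2 - \<rho>"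
      and fin: "cfinite_dim (spectral_subspace_on V T' c d)"
    interpret T': invariant_subspace V T' by (rule T')
    interpret X: closed_csubspace "V \<inter> spectral_space T c d" by (rule closed_csubspace_spectral[OF cd])
    interpret Y: closed_csubspace "V \<inter> spectral_space T' c d" by (rule T'.closed_csubspace_spectral[OF cd])
    show "cdim (spectral_subspace_on V T c d) \<le> cdim (spectral_subspace_on V T' c d)"
      unfolding spectral_subspace_eq[OF cd] T'.spectral_subspace_eq[OF cd]
    proof (rule cdim_le_of_no_orthogonal(2)[OF X.csubspace Y.closed Y.csubspace])
      show "cfinite_dim (V \<inter> spectral_space T' c d)" using fin T'.spectral_subspace_eq[OF cd] by simp
      fix x assume x: "x \<in> V \<inter> spectral_space T c d" and orth: "x \<bottom>\<^sub>s V \<inter> spectral_space T' c d"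
      have "(d - c) / 2 * norm x \<le> norm (T' x - ((c + d) / 2) *\<^sub>R x)"
        using T'.spectral_space_norm_ge[OF cd _ orth] x by simp
      also have "\<dots> \<le> norm (T x - ((c + d) / 2) *\<^sub>R x) + norm ((T' - T) x)"
        using norm_triangle_ineq[of "T x - ((c + d) / 2) *\<^sub>R x" "(T' - T) x"] by (simp add: blinfun.diff_left)
      also have "\<dots> \<le> \<rho> * norm x + norm (T' - T) * norm x"
        by (intro add_mono \<rho>(2)[OF x] norm_blinfun)
      finally have "((d - c) / 2 - \<rho> - norm (T' - T)) * norm x \<le> 0" by (simp add: algebra_simps)
      then show "x = 0" using small by (simp add: mult_le_0_iff)
    qed
  qed (use \<rho>(1) in simp)
qed

end

section \<open>Selfadjoint Fredholm operators\<close>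

text \<open>
  The open mapping theorem for \<open>T\<close> in dual form: every \<open>y\<close> is \<open>T y' + k\<close> with \<open>T k = 0\<close>, so that
  \<open>|\<langle>x,y\<rangle>| \<le> \<parallel>y'\<parallel> \<parallel>T x\<parallel>\<close> for \<open>x\<close> orthogonal to the kernel, and Baire's theorem makes the constant
  \<open>\<parallel>y'\<parallel>\<close> uniform for \<open>y\<close> in a ball.
\<close>

lemma bounded_below_of_closed_range:
  fixes T :: "'a::complex_hilbert \<Rightarrow>\<^sub>L 'a"
  assumes T: "selfadjoint T" and cl: "closed (range T)"
  obtains \<delta> where "\<delta> > 0" "\<And>x. x \<bottom>\<^sub>s {x. T x = 0} \<Longrightarrow> \<delta> * norm x \<le> norm (T x)"
proof -
  define K where "K = {x. T x = 0}"
  define C where "C n = {y. \<forall>x. x \<bottom>\<^sub>s K \<longrightarrow> cmod (cinner x y) \<le> real n * norm (T x)}" for n :: nat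
  have cR: "csubspace (range T)"
    unfolding complex_vector.subspace_def
    using blinfun.zero_right[of T] by (auto simp: blinfun.add_right[symmetric] selfadjoint_scaleC[OF T, symmetric] intro!: image_eqI[of 0 T 0])
  interpret R: closed_csubspace "range T" by unfold_locales (use cl cR in auto)
  have closedC: "closed (C n)" for n
  proof -
    have "C n = (\<Inter>x\<in>{x. x \<bottom>\<^sub>s K}. {y. cmod (cinner x y) \<le> real n * norm (T x)})" by (auto simp: C_def)
    also have "closed \<dots>"
      by (intro closed_INT ballI closed_Collect_le continuous_on_norm continuous_on_cinner continuous_intros)
    finally show ?thesis .
  qed
  have cover: "(\<Union>n. C n) = UNIV"
  proof (intro equalityI subsetI UNIV_I)
    fix y
    obtain y' where y': "proj (range T) y = T y'" using R.proj_in[of y] by blast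
    define k where "k = y - T y'"
    have "cinner k (T (T k)) = 0" using R.proj_orthogonal[of y] by (simp add: k_def y' orthogonal_to_def)
    then have "cinner (T k) (T k) = 0" using selfadjoint_cinner[OF T, of k "T k"] by simp
    then have k: "k \<in> K" by (simp add: K_def cinner_self_eq_0_iff)
    obtain n :: nat where n: "norm y' \<le> real n" using real_arch_simple by blast
    have "cmod (cinner x y) \<le> real n * norm (T x)" if x: "x \<bottom>\<^sub>s K" for x
    proof -
      have "cinner x y = cinner (T x) y'"
        using x k by (auto simp: k_def orthogonal_to_def cinner_diff_right selfadjoint_cinner[OF T])
      also have "cmod \<dots> \<le> norm (T x) * norm y'" by (rule cauchy_schwarz)
      also have "\<dots> \<le> norm (T x) * real n" using n by (rule mult_left_mono) simp
      finally show ?thesis by (simp add: mult.commute)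
    qed
    then show "y \<in> (\<Union>n. C n)" by (auto simp: C_def)
  qed
  have "\<exists>n. interior (C n) \<noteq> {}"
  proof (rule ccontr)
    assume "\<not> ?thesis"
    then have "euclidean interior_of \<Union>(range C) = {}"
      by (intro Baire_category_alt) (auto simp: completely_metrizable_space_euclidean closedC)
    then show False using cover by simp
  qed
  then obtain n y0 where "y0 \<in> interior (C n)" by blast
  then obtain r where r: "r > 0" "ball y0 r \<subseteq> C n" by (meson mem_interior)
  show thesis
  proof (rule that[of "r / (4 * (real n + 1))"])
    fix x assume "x \<bottom>\<^sub>s {x. T x = 0}"
    then have x: "x \<bottom>\<^sub>s K" by (simp add: K_def)
    show "r / (4 * (real n + 1)) * norm x \<le> norm (T x)"
    proof (cases "x = 0")
      case False
      \<comment> \<open>\<open>y0\<close> and \<open>y0 + u\<close> both lie in \<open>C n\<close>, and \<open>u\<close> has the direction of \<open>x\<close>.\<close>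
      define u where "u = (r / (2 * norm x)) *\<^sub>R x"
      have "norm u < r" using r(1) False by (simp add: u_def)
      then have "y0 + u \<in> C n" "y0 \<in> C n" using r by (auto simp: dist_norm intro!: subsetD[OF r(2)])
      then have "cmod (cinner x (y0 + u)) \<le> real n * norm (T x)" "cmod (cinner x y0) \<le> real n * norm (T x)"
        using x by (auto simp: C_def)
      moreover have "cinner x u = cinner x (y0 + u) - cinner x y0" by (simp add: cinner_add_right)
      ultimately have "cmod (cinner x u) \<le> 2 * real n * norm (T x)"
        using norm_triangle_ineq4[of "cinner x (y0 + u)" "cinner x y0"] by simp
      moreover have "cinner x u = complex_of_real (r / 2 * norm x)"
        using False by (simp add: u_def cinner_scaleR_right cinner_self power2_eq_square)
      then have "cmod (cinner x u) = \<bar>r / 2 * norm x\<bar>" by (simp only: norm_of_real)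
      then have "cmod (cinner x u) = r / 2 * norm x" using r(1) by simp
      moreover have "0 \<le> norm (T x)" by simp
      moreover have "2 * (real n + 1) * norm (T x) = 2 * real n * norm (T x) + 2 * norm (T x)"
        by (simp add: algebra_simps)
      ultimately have "r / 2 * norm x \<le> 2 * (real n + 1) * norm (T x)" by linarith
      then show ?thesis by (simp add: field_simps)
    qed simp
  qed (use r(1) in auto)
qed

definition window_dim :: "'a::complex_hilbert set \<Rightarrow> ('a \<Rightarrow>\<^sub>L 'a) \<Rightarrow> real \<Rightarrow> nat \<Rightarrow> bool" where
  "window_dim V T a d \<longleftrightarrow> regular_point V T a \<and> regular_point V T (- a) \<and>
     cfinite_dim (spectral_subspace_on V T (- a) a) \<and> cdim (spectral_subspace_on V T (- a) a) = d"

text \<open>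
  If \<open>T\<close> is bounded below by \<open>\<delta>\<close> on the orthogonal complement of its kernel, then for operators near \<open>T\<close>
  the spectral subspace for \<open>[- \<delta>/2, \<delta>/2]\<close> has the dimension of the kernel: neither contains a nonzero
  vector orthogonal to the other. The choice of \<open>\<delta>\<close> serves all invariant subspaces simultaneously.
\<close>

lemma fredholm_window:
  fixes T :: "'a::complex_hilbert \<Rightarrow>\<^sub>L 'a"
  assumes T: "selfadjoint T" "fredholm T"
  obtains a \<epsilon> where "a > 0" "\<epsilon> > 0"
    "\<And>V T'. invariant_subspace V T \<Longrightarrow> invariant_subspace V T' \<Longrightarrow> norm (T' - T) < \<epsilon> \<Longrightarrow>
      window_dim V T' a (cdim (V \<inter> {x. T x = 0}))"
proof -
  define K where "K = {x. T x = 0}"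
  have finK: "cfinite_dim K" and cl: "closed (range T)" using T(2) by (auto simp: fredholm_def K_def)
  have closedK: "closed K" unfolding K_def by (intro closed_Collect_eq continuous_intros)
  have subK: "csubspace K"
    unfolding K_def by (auto simp: complex_vector.subspace_def blinfun.zero_right blinfun.add_right selfadjoint_scaleC[OF T(1)] complex_vector.scale_zero_right)
  interpret K: closed_csubspace K by unfold_locales (use closedK subK in auto)
  obtain \<delta> where \<delta>: "\<delta> > 0" "\<And>x. x \<bottom>\<^sub>s K \<Longrightarrow> \<delta> * norm x \<le> norm (T x)"
    using bounded_below_of_closed_range[OF T(1) cl] unfolding K_def by blast
  define a where "a = \<delta> / 2"
  have a: "a > 0" using \<delta>(1) by (simp add: a_def)
  \<comment> \<open>\<open>T - z\<close> is \<open>- z\<close> on the kernel and at least \<open>\<delta> - a = a\<close> on its orthogonal complement.\<close>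
  have below: "a * norm x \<le> norm (T x - z *\<^sub>R x)" if z: "\<bar>z\<bar> = a" for x z
  proof -
    define k y where "k = proj K x" and "y = x - k"
    have k: "T k = 0" "k \<in> K" using K.proj_in[of x] by (auto simp: k_def K_def)
    have y: "y \<bottom>\<^sub>s K" using K.proj_orthogonal[of x] by (simp add: k_def y_def)
    then have ky: "cinner k y = 0" using k cinner_eq_0_commute by (auto simp: orthogonal_to_def)
    have "cinner k (T y) = cinner (T k) y" by (simp add: selfadjoint_cinner[OF T(1)])
    then have "cinner ((- z) *\<^sub>R k) (T y - z *\<^sub>R y) = 0" using ky k by (simp add: cinner_algebra)
    from pythagoras[OF this] have "(norm (T x - z *\<^sub>R x))\<^sup>2 = a\<^sup>2 * (norm k)\<^sup>2 + (norm (T y - z *\<^sub>R y))\<^sup>2"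
      using k z by (simp add: y_def blinfun.diff_right scaleR_diff_right power_mult_distrib algebra_simps)
    moreover have "a * norm y \<le> norm (T y - z *\<^sub>R y)"
      using \<delta>(2)[OF y] norm_triangle_ineq2[of "T y" "z *\<^sub>R y"] z by (simp add: a_def)
    then have "(a * norm y)\<^sup>2 \<le> (norm (T y - z *\<^sub>R y))\<^sup>2" using a by (intro power_mono) auto
    moreover have "(norm x)\<^sup>2 = (norm k)\<^sup>2 + (norm y)\<^sup>2" using pythagoras[OF ky] by (simp add: y_def)
    ultimately have "(a * norm x)\<^sup>2 \<le> (norm (T x - z *\<^sub>R x))\<^sup>2"
      by (simp add: power_mult_distrib distrib_left)
    then show ?thesis by (rule power2_le_imp_le) simp
  qed
  show thesis
  proof (rule that[of a "a / 2"])
    fix V T' assume VT: "invariant_subspace V T" and VT': "invariant_subspace V T'" and small: "norm (T' - T) < a / 2"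
    interpret V: invariant_subspace V T by (rule VT)
    interpret V': invariant_subspace V T' by (rule VT')
    have close: "norm (T' x - T x) \<le> a / 2 * norm x" for x
      using norm_blinfun[of "T' - T" x] mult_right_mono[of "norm (T' - T)" "a / 2" "norm x"] small
      by (simp add: blinfun.diff_left)
    have reg: "regular_point V T' z" if z: "\<bar>z\<bar> = a" for z
      unfolding regular_point_def
    proof (intro exI conjI ballI)
      show "a / 2 > 0" using a by simp
      fix x
      have "norm (T x - z *\<^sub>R x) \<le> norm (T' x - z *\<^sub>R x) + norm (T' x - T x)"
        using norm_triangle_ineq4[of "T' x - z *\<^sub>R x" "T' x - T x"] by simp
      then show "a / 2 * norm x \<le> norm (T' x - z *\<^sub>R x)" using below[OF z, of x] close[of x] by simp
    qed
    have aa: "- a < a" using a by simp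
    interpret X: closed_csubspace "V \<inter> spectral_space T' (- a) a" by (rule V'.closed_csubspace_spectral[OF aa])
    interpret Y: closed_csubspace "V \<inter> K"
      by unfold_locales (auto intro: closed_Int V.closed closedK complex_vector.subspace_inter V.csubspace subK)
    have fin: "cfinite_dim (V \<inter> K)" by (rule cfinite_dim_subset[OF finK]) auto
    have XY: "x = 0" if x: "x \<in> V \<inter> spectral_space T' (- a) a" and orth: "x \<bottom>\<^sub>s V \<inter> K" for x
    proof -
      have "x \<bottom>\<^sub>s K" unfolding orthogonal_to_def
      proof
        fix y assume "y \<in> K"
        then have "proj V y \<in> V \<inter> K" using V.proj_T[of y] V.proj_in[of y] V.proj_id[of 0] V.mem_simps(1) by (simp add: K_def)
        then have "cinner x (proj V y) = 0" using orth unfolding orthogonal_to_def by blast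
        then show "cinner x y = 0" using x V.cinner_proj_of_mem[of x y] by simp
      qed
      then have "2 * a * norm x \<le> norm (T x)" using \<delta>(2)[of x] by (simp add: a_def)
      moreover have "norm (T' x) \<le> a * norm x" using V'.spectral_space_norm[of x "- a" a] x by simp
      moreover have "norm (T x) \<le> norm (T' x) + norm (T' x - T x)"
        using norm_triangle_ineq4[of "T' x" "T' x - T x"] by simp
      ultimately have "(a / 2) * norm x \<le> 0" using close[of x] by (simp add: algebra_simps)
      then show ?thesis using a by (simp add: mult_le_0_iff)
    qed
    note 1 = cdim_le_of_no_orthogonal[OF X.csubspace Y.closed Y.csubspace fin XY]
    have YX: "x = 0" if x: "x \<in> V \<inter> K" and orth: "x \<bottom>\<^sub>s V \<inter> spectral_space T' (- a) a" for x
    proof -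
      have "a * norm x \<le> norm (T' x)" using V'.spectral_space_norm_ge[OF aa _ orth] x by simp
      moreover have "T x = 0" using x by (simp add: K_def)
      ultimately have "(a / 2) * norm x \<le> 0" using close[of x] by (simp add: algebra_simps)
      then show ?thesis using a by (simp add: mult_le_0_iff)
    qed
    note 2 = cdim_le_of_no_orthogonal[OF Y.csubspace X.closed X.csubspace 1(1) YX]
    show "window_dim V T' a (cdim (V \<inter> {x. T x = 0}))"
      unfolding window_dim_def V'.spectral_subspace_eq[OF aa] K_def[symmetric] using reg[of a] reg[of "- a"] a 1 2 by simp
  qed (use a in auto)
qed

section \<open>Spectral flow along a path\<close>

lemma spectral_subspace_subset: "c \<le> c' \<Longrightarrow> spectral_subspace_on V T c' d \<subseteq> spectral_subspace_on V T c d"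
  unfolding spectral_subspace_on_def Let_def by auto

text \<open>The condition that \<open>spectral_flow_partition\<close> imposes on one interval.\<close>

definition spectral_window ::
    "'a::complex_hilbert set \<Rightarrow> (real \<Rightarrow> 'a \<Rightarrow>\<^sub>L 'a) \<Rightarrow> real \<Rightarrow> real \<Rightarrow> real \<Rightarrow> bool" where
  "spectral_window V A \<alpha> p q \<longleftrightarrow> \<alpha> > 0 \<and>
     (\<exists>d. \<forall>s\<in>{p..q}. window_dim V (A s) \<alpha> d)"

lemma spectral_window_subinterval:
  "spectral_window V A \<alpha> p q \<Longrightarrow> p \<le> p' \<Longrightarrow> q' \<le> q \<Longrightarrow> spectral_window V A \<alpha> p' q'"
  unfolding spectral_window_def by fastforce

definition nonneg_dim :: "'a::complex_hilbert set \<Rightarrow> (real \<Rightarrow> 'a \<Rightarrow>\<^sub>L 'a) \<Rightarrow> real \<Rightarrow> real \<Rightarrow> int" where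
  "nonneg_dim V A \<alpha> s = int (cdim (spectral_subspace_on V (A s) 0 \<alpha>))"

definition flow_sum ::
    "'a::complex_hilbert set \<Rightarrow> (real \<Rightarrow> 'a \<Rightarrow>\<^sub>L 'a) \<Rightarrow> nat \<Rightarrow> (nat \<Rightarrow> real) \<Rightarrow> (nat \<Rightarrow> real) \<Rightarrow> int" where
  "flow_sum V A N t \<alpha> = (\<Sum>i=1..N. nonneg_dim V A (\<alpha> i) (t i) - nonneg_dim V A (\<alpha> i) (t (i - 1)))"

text \<open>
  The flow sum over \<open>[t 0, s]\<close>: moving \<open>s\<close> into \<open>[t (i - 1), t i]\<close> gives the full contribution to intervals on
  its left and none to those on its right.
\<close>

definition partial_flow ::
    "'a::complex_hilbert set \<Rightarrow> (real \<Rightarrow> 'a \<Rightarrow>\<^sub>L 'a) \<Rightarrow> nat \<Rightarrow> (nat \<Rightarrow> real) \<Rightarrow> (nat \<Rightarrow> real) \<Rightarrow> real \<Rightarrow> int" where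
  "partial_flow V A N t \<alpha> s =
     (\<Sum>i=1..N. nonneg_dim V A (\<alpha> i) (max (t (i - 1)) (min s (t i))) - nonneg_dim V A (\<alpha> i) (t (i - 1)))"

locale invariant_path =
  fixes V :: "'a::complex_hilbert set" and A :: "real \<Rightarrow> 'a \<Rightarrow>\<^sub>L 'a"
  assumes continuous: "continuous_on {0..1} A"
    and invariant: "s \<in> {0..1} \<Longrightarrow> invariant_subspace V (A s)"
begin

lemma partition_iff:
  "spectral_flow_partition V A 0 1 N t \<alpha> \<longleftrightarrow>
     t 0 = 0 \<and> t N = 1 \<and> (\<forall>i\<in>{1..N}. t (i - 1) < t i) \<and>
     (\<forall>i\<in>{1..N}. spectral_window V A (\<alpha> i) (t (i - 1)) (t i))"
proof -
  have nodes: "0 \<le> t i \<and> t i \<le> 1" if t: "t 0 = 0" "t N = 1" "\<forall>i\<in>{1..N}. t (i - 1) < t i" "i \<le> N" for i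
  proof -
    have up: "t j \<le> t k" if "j \<le> k" "k \<le> N" for j k
      using that(1,2)
    proof (induction k rule: dec_induct)
      case (step k)
      then have "t (Suc k - 1) < t (Suc k)" using t(3) by (intro bspec[of _ _ "Suc k"]) auto
      then show ?case using step by simp
    qed simp
    show ?thesis using up[of 0 i] up[of i N] t by simp
  qed
  have "s \<in> {0..1}" if "t 0 = 0" "t N = 1" "\<forall>i\<in>{1..N}. t (i - 1) < t i" "i \<in> {1..N}"
    "s \<in> {t (i - 1)..t i}" for s i
  proof -
    have "i - 1 \<le> N" "i \<le> N" using that(4) by auto
    then show ?thesis using nodes[OF that(1-3), of i] nodes[OF that(1-3), of "i - 1"] that(5) by auto
  qed
  then show ?thesis
    unfolding spectral_flow_partition_def spectral_window_def window_dim_def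
    by (auto simp: invariant_subspace.regular_point_iff[OF invariant])
qed

lemma continuous_close:
  assumes "s \<in> S" "S \<subseteq> {0..1}" "\<epsilon> > 0"
  shows "eventually (\<lambda>u. norm (A u - A s) < \<epsilon>) (at s within S)"
proof -
  have "(A \<longlongrightarrow> A s) (at s within S)"
    using continuous_on_subset[OF continuous assms(2)] assms(1) by (simp add: continuous_on_def)
  from tendstoD[OF this assms(3)] show ?thesis by (simp add: dist_norm)
qed

text \<open>
  Enlarging a window from \<open>\<alpha>\<close> to \<open>\<beta>\<close> adds the dimension for \<open>[\<alpha>,\<beta>]\<close> to the count. This dimension
  and the one for \<open>[- \<beta>,- \<alpha>]\<close> are lower semicontinuous and have constant sum, so both are constant.
\<close>

lemma window_difference_less:
  assumes pq: "0 \<le> p" "p \<le> q" "q \<le> 1" and w: "spectral_window V A \<alpha> p q" "spectral_window V A \<beta> p q"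
    and less: "\<alpha> < \<beta>"
  shows "nonneg_dim V A \<alpha> q - nonneg_dim V A \<alpha> p = nonneg_dim V A \<beta> q - nonneg_dim V A \<beta> p"
proof -
  have \<alpha>: "0 < \<alpha>" using w by (simp add: spectral_window_def)
  obtain d where d: "\<And>s. s \<in> {p..q} \<Longrightarrow> window_dim V (A s) \<alpha> d"
    using w(1) unfolding spectral_window_def by blast
  obtain d' where d': "\<And>s. s \<in> {p..q} \<Longrightarrow> window_dim V (A s) \<beta> d'"
    using w(2) unfolding spectral_window_def by blast
  define f where "f s = cdim (spectral_subspace_on V (A s) \<alpha> \<beta>)" for s
  define g where "g s = cdim (spectral_subspace_on V (A s) (- \<beta>) (- \<alpha>))" for s
  have inv: "invariant_subspace V (A s)" if "s \<in> {p..q}" for s using that pq by (intro invariant) auto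
  have parts: "g s + d + f s = d'" "cfinite_dim (spectral_subspace_on V (A s) \<alpha> \<beta>)"
    "cfinite_dim (spectral_subspace_on V (A s) (- \<beta>) (- \<alpha>))"
    "nonneg_dim V A \<beta> s = nonneg_dim V A \<alpha> s + int (f s)" if s: "s \<in> {p..q}" for s
  proof -
    interpret invariant_subspace V "A s" by (rule inv[OF s])
    have lt: "- \<beta> < - \<alpha>" "- \<alpha> < \<beta>" "- \<alpha> < \<alpha>" "0 < \<alpha>" using \<alpha> less by auto
    have reg: "regular_point V (A s) \<alpha>" "regular_point V (A s) (- \<alpha>)" using d[OF s] by (auto simp: window_dim_def)
    have fin: "cfinite_dim (spectral_subspace_on V (A s) (- \<beta>) \<beta>)" using d'[OF s] by (auto simp: window_dim_def)
    note outer = cdim_spectral_subspace_split[OF lt(1,2) reg(2) fin]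
    note inner = cdim_spectral_subspace_split[OF lt(3) less reg(1) outer(3)]
    have "cfinite_dim (spectral_subspace_on V (A s) 0 \<beta>)"
      by (rule cfinite_dim_subset[OF fin spectral_subspace_subset]) (use \<alpha> less in simp)
    note upper = cdim_spectral_subspace_split(1)[OF lt(4) less reg(1) this]
    show "g s + d + f s = d'" using outer(1) inner(1) d[OF s] d'[OF s] by (simp add: f_def g_def window_dim_def)
    show "cfinite_dim (spectral_subspace_on V (A s) \<alpha> \<beta>)" by (rule inner(3))
    show "cfinite_dim (spectral_subspace_on V (A s) (- \<beta>) (- \<alpha>))" by (rule outer(2))
    show "nonneg_dim V A \<beta> s = nonneg_dim V A \<alpha> s + int (f s)"
      using upper by (simp add: nonneg_dim_def f_def)
  qed
  have "f p = f q"
  proof (rule connected_local_const[of "{p..q}"])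
    show "\<forall>s\<in>{p..q}. eventually (\<lambda>u. f s = f u) (at s within {p..q})"
    proof
      fix s assume s: "s \<in> {p..q}"
      interpret invariant_subspace V "A s" by (rule inv[OF s])
      have lt: "- \<beta> < - \<alpha>" using less by simp
      have reg: "regular_point V (A s) \<alpha>" "regular_point V (A s) (- \<alpha>)"
        "regular_point V (A s) \<beta>" "regular_point V (A s) (- \<beta>)" using d[OF s] d'[OF s] by (auto simp: window_dim_def)
      obtain \<epsilon> where \<epsilon>: "\<epsilon> > 0" "\<And>T'. invariant_subspace V T' \<Longrightarrow> norm (T' - A s) < \<epsilon> \<Longrightarrow>
          cfinite_dim (spectral_subspace_on V T' \<alpha> \<beta>) \<Longrightarrow>
          cdim (spectral_subspace_on V (A s) \<alpha> \<beta>) \<le> cdim (spectral_subspace_on V T' \<alpha> \<beta>)"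
        using cdim_spectral_subspace_lower_semicontinuous[OF less reg(1,3)] by blast
      obtain \<epsilon>' where \<epsilon>': "\<epsilon>' > 0" "\<And>T'. invariant_subspace V T' \<Longrightarrow> norm (T' - A s) < \<epsilon>' \<Longrightarrow>
          cfinite_dim (spectral_subspace_on V T' (- \<beta>) (- \<alpha>)) \<Longrightarrow>
          cdim (spectral_subspace_on V (A s) (- \<beta>) (- \<alpha>)) \<le> cdim (spectral_subspace_on V T' (- \<beta>) (- \<alpha>))"
        using cdim_spectral_subspace_lower_semicontinuous[OF lt reg(4,2)] by blast
      have sub: "{p..q} \<subseteq> {0..1}" using pq by auto
      have "eventually (\<lambda>u. u \<in> {p..q}) (at s within {p..q})" by (simp add: eventually_at_filter)
      with continuous_close[OF s sub \<epsilon>(1)] continuous_close[OF s sub \<epsilon>'(1)]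
      show "eventually (\<lambda>u. f s = f u) (at s within {p..q})"
      proof eventually_elim
        case (elim u)
        have "f s \<le> f u" "g s \<le> g u"
          unfolding f_def g_def using \<epsilon>(2) \<epsilon>'(2) elim inv parts(2,3) by blast+
        then show ?case using parts(1)[OF s] parts(1)[of u] elim by simp
      qed
    qed
  qed (use pq in auto)
  then show ?thesis using parts(4)[of p] parts(4)[of q] pq by simp
qed

lemma window_difference:
  assumes "0 \<le> p" "p \<le> q" "q \<le> 1" "spectral_window V A \<alpha> p q" "spectral_window V A \<beta> p q"
  shows "nonneg_dim V A \<alpha> q - nonneg_dim V A \<alpha> p = nonneg_dim V A \<beta> q - nonneg_dim V A \<beta> p"
proof (cases \<alpha> \<beta> rule: linorder_cases)
  case less
  show ?thesis by (rule window_difference_less[OF assms less])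
next
  case greater
  show ?thesis by (rule window_difference_less[OF assms(1-3,5,4) greater, symmetric])
qed simp

context
  fixes N t \<alpha>
  assumes partition: "spectral_flow_partition V A 0 1 N t \<alpha>"
begin

lemma nodes: "t 0 = 0" "t N = 1" and nodes_less: "i \<in> {1..N} \<Longrightarrow> t (i - 1) < t i"
  and window: "i \<in> {1..N} \<Longrightarrow> spectral_window V A (\<alpha> i) (t (i - 1)) (t i)"
  using iffD1[OF partition_iff partition] by simp_all

lemma nodes_mono: "j \<le> k \<Longrightarrow> k \<le> N \<Longrightarrow> t j \<le> t k"
proof (induction k rule: dec_induct)
  case (step k)
  have "t (Suc k - 1) < t (Suc k)" by (rule nodes_less) (use step in auto)
  then show ?case using step by simp
qed simp

lemma nodes_bounds: "i \<le> N \<Longrightarrow> 0 \<le> t i" "i \<le> N \<Longrightarrow> t i \<le> 1"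
  using nodes_mono[of 0 i] nodes_mono[of i N] nodes by auto

lemma partial_flow_0: "partial_flow V A N t \<alpha> 0 = 0"
  unfolding partial_flow_def
proof (rule sum.neutral, rule ballI)
  fix i assume "i \<in> {1..N}"
  then have "0 \<le> t (i - 1)" "0 \<le> t i" by (auto intro: nodes_bounds)
  then show "nonneg_dim V A (\<alpha> i) (max (t (i - 1)) (min 0 (t i))) - nonneg_dim V A (\<alpha> i) (t (i - 1)) = 0"
    by simp
qed

lemma partial_flow_1: "partial_flow V A N t \<alpha> 1 = flow_sum V A N t \<alpha>"
  unfolding partial_flow_def flow_sum_def
proof (rule sum.cong[OF refl])
  fix i assume i: "i \<in> {1..N}"
  then have "t i \<le> 1" by (auto intro: nodes_bounds)
  then have "max (t (i - 1)) (min 1 (t i)) = t i" using nodes_less[OF i] by simp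
  then show "nonneg_dim V A (\<alpha> i) (max (t (i - 1)) (min 1 (t i))) - nonneg_dim V A (\<alpha> i) (t (i - 1)) =
    nonneg_dim V A (\<alpha> i) (t i) - nonneg_dim V A (\<alpha> i) (t (i - 1))" by simp
qed

lemma partial_flow_difference:
  assumes k: "k \<in> {1..N}" and pq: "t (k - 1) \<le> p" "p \<le> q" "q \<le> t k"
  shows "partial_flow V A N t \<alpha> q - partial_flow V A N t \<alpha> p = nonneg_dim V A (\<alpha> k) q - nonneg_dim V A (\<alpha> k) p"
proof -
  define c where "c i s = max (t (i - 1)) (min s (t i))" for i s
  have ck: "c k p = p" "c k q = q" using pq by (auto simp: c_def)
  have ci: "c i p = c i q" if i: "i \<in> {1..N} - {k}" for i
  proof (cases "i < k")
    case True
    then have "t i \<le> t (k - 1)" using k by (intro nodes_mono) auto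
    then show ?thesis using pq by (simp add: c_def)
  next
    case False
    then have "t k \<le> t (i - 1)" using i by (intro nodes_mono) auto
    then show ?thesis using pq by (simp add: c_def)
  qed
  have "partial_flow V A N t \<alpha> q - partial_flow V A N t \<alpha> p =
      (\<Sum>i=1..N. nonneg_dim V A (\<alpha> i) (c i q) - nonneg_dim V A (\<alpha> i) (c i p))"
    unfolding partial_flow_def c_def[symmetric] sum_subtractf[symmetric] by (intro sum.cong) auto
  also have "\<dots> = nonneg_dim V A (\<alpha> k) (c k q) - nonneg_dim V A (\<alpha> k) (c k p) +
      (\<Sum>i\<in>{1..N} - {k}. nonneg_dim V A (\<alpha> i) (c i q) - nonneg_dim V A (\<alpha> i) (c i p))"
    using k by (intro sum.remove) auto
  also have "(\<Sum>i\<in>{1..N} - {k}. nonneg_dim V A (\<alpha> i) (c i q) - nonneg_dim V A (\<alpha> i) (c i p)) = 0"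
    by (rule sum.neutral) (use ci in simp)
  finally show ?thesis by (simp add: ck)
qed

lemma interval_right:
  assumes "0 \<le> s" "s < 1"
  obtains k where "k \<in> {1..N}" "t (k - 1) \<le> s" "s < t k"
proof -
  define k where "k = (LEAST i. s < t i)"
  have ex: "s < t N" using assms nodes by simp
  have "s < t k" unfolding k_def using ex by (rule LeastI)
  moreover have "k \<le> N" unfolding k_def using ex by (rule Least_le)
  moreover have "k \<noteq> 0" using \<open>s < t k\<close> assms nodes by (intro notI) simp
  moreover have "\<not> s < t (k - 1)" using \<open>k \<noteq> 0\<close> not_less_Least[of "k - 1" "\<lambda>i. s < t i"] by (simp add: k_def)
  ultimately show thesis by (intro that[of k]) auto
qed

lemma interval_left:
  assumes "0 < s" "s \<le> 1"
  obtains k where "k \<in> {1..N}" "t (k - 1) < s" "s \<le> t k"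
proof -
  define k where "k = (LEAST i. s \<le> t i)"
  have ex: "s \<le> t N" using assms nodes by simp
  have "s \<le> t k" unfolding k_def using ex by (rule LeastI)
  moreover have "k \<le> N" unfolding k_def using ex by (rule Least_le)
  moreover have "k \<noteq> 0" using \<open>s \<le> t k\<close> assms nodes by (intro notI) simp
  moreover have "\<not> s \<le> t (k - 1)" using \<open>k \<noteq> 0\<close> not_less_Least[of "k - 1" "\<lambda>i. s \<le> t i"] by (simp add: k_def)
  ultimately show thesis by (intro that[of k]) auto
qed

end

text \<open>
  The difference of the partial flows of two partitions is locally constant: immediately to the left
  and to the right of any point both are given by a window on a common interval.
\<close>

lemma flow_sum_unique:
  assumes 1: "spectral_flow_partition V A 0 1 N t \<alpha>" and 2: "spectral_flow_partition V A 0 1 N' t' \<alpha>'"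
  shows "flow_sum V A N t \<alpha> = flow_sum V A N' t' \<alpha>'"
proof -
  define D where "D s = partial_flow V A N t \<alpha> s - partial_flow V A N' t' \<alpha>' s" for s
  have agree: "D p = D q" if k: "k \<in> {1..N}" "t (k - 1) \<le> p" "p \<le> q" "q \<le> t k"
    and k': "k' \<in> {1..N'}" "t' (k' - 1) \<le> p" "q \<le> t' k'" for k k' p q
  proof -
    have "0 \<le> t (k - 1)" "t k \<le> 1" using k(1) nodes_bounds[OF 1] by auto
    then have "nonneg_dim V A (\<alpha> k) q - nonneg_dim V A (\<alpha> k) p = nonneg_dim V A (\<alpha>' k') q - nonneg_dim V A (\<alpha>' k') p"
      using k k' by (intro window_difference) (auto intro: spectral_window_subinterval[OF window[OF 1]]
          spectral_window_subinterval[OF window[OF 2]])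
    then show ?thesis
      using partial_flow_difference[OF 1 k] partial_flow_difference[OF 2 k'(1,2) k(3) k'(3)]
      by (simp add: D_def)
  qed
  have "D 0 = D 1"
  proof (rule connected_local_const[where A = "{0..1}" and a = 0 and b = 1 and f = D])
    show "\<forall>s\<in>{0..1}. eventually (\<lambda>u. D s = D u) (at s within {0..1})"
    proof
      fix s :: real assume s: "s \<in> {0..1}"
      have right: "\<exists>b>s. \<forall>u\<in>{0..1}. s \<le> u \<and> u < b \<longrightarrow> D s = D u"
      proof (cases "s < 1")
        case True
        obtain k where k: "k \<in> {1..N}" "t (k - 1) \<le> s" "s < t k"
          using interval_right[OF 1, of s] s True by auto
        obtain k' where k': "k' \<in> {1..N'}" "t' (k' - 1) \<le> s" "s < t' k'"
          using interval_right[OF 2, of s] s True by auto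
        show ?thesis
          by (rule exI[of _ "min (t k) (t' k')"]) (use k k' in \<open>auto intro!: agree[of k _ _ k']\<close>)
      next
        case False
        then show ?thesis using s by (intro exI[of _ "s + 1"]) auto
      qed
      have left: "\<exists>b<s. \<forall>u\<in>{0..1}. u \<le> s \<and> b < u \<longrightarrow> D s = D u"
      proof (cases "0 < s")
        case True
        obtain k where k: "k \<in> {1..N}" "t (k - 1) < s" "s \<le> t k"
          using interval_left[OF 1, of s] s True by auto
        obtain k' where k': "k' \<in> {1..N'}" "t' (k' - 1) < s" "s \<le> t' k'"
          using interval_left[OF 2, of s] s True by auto
        show ?thesis
          by (rule exI[of _ "max (t (k - 1)) (t' (k' - 1))"]) (use k k' in \<open>auto intro!: agree[symmetric, of k _ _ k']\<close>)
      next
        case False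
        then show ?thesis using s by (intro exI[of _ "s - 1"]) auto
      qed
      obtain b b' where b: "b > s" "\<forall>u\<in>{0..1}. s \<le> u \<and> u < b \<longrightarrow> D s = D u"
        and b': "b' < s" "\<forall>u\<in>{0..1}. u \<le> s \<and> b' < u \<longrightarrow> D s = D u"
        using left right by blast
      have "D s = D u" if "u \<in> {0..1}" "dist u s < min (b - s) (s - b')" for u
        using b(2) b'(2) that by (cases "u \<le> s") (auto simp: dist_real_def)
      then show "eventually (\<lambda>u. D s = D u) (at s within {0..1})"
        unfolding eventually_at using b(1) b'(1) by (intro exI[of _ "min (b - s) (s - b')"]) auto
    qed
  qed auto
  then show ?thesis
    using partial_flow_0[OF 1] partial_flow_0[OF 2] partial_flow_1[OF 1] partial_flow_1[OF 2] by (simp add: D_def)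
qed

theorem spectral_flow_eq:
  assumes "spectral_flow_partition V A 0 1 N t \<alpha>"
  shows "spectral_flow_on V A 0 1 = flow_sum V A N t \<alpha>"
  unfolding spectral_flow_on_def
proof (rule the_equality)
  show "\<exists>N' t' \<alpha>'. spectral_flow_partition V A 0 1 N' t' \<alpha>' \<and> flow_sum V A N t \<alpha> =
      (\<Sum>i=1..N'. int (cdim (spectral_subspace_on V (A (t' i)) 0 (\<alpha>' i)))
                     - int (cdim (spectral_subspace_on V (A (t' (i - 1))) 0 (\<alpha>' i))))"
    using assms by (intro exI[of _ N] exI[of _ t] exI[of _ \<alpha>]) (simp add: flow_sum_def nonneg_dim_def)
next
  fix m
  assume "\<exists>N' t' \<alpha>'. spectral_flow_partition V A 0 1 N' t' \<alpha>' \<and> m =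
      (\<Sum>i=1..N'. int (cdim (spectral_subspace_on V (A (t' i)) 0 (\<alpha>' i)))
                     - int (cdim (spectral_subspace_on V (A (t' (i - 1))) 0 (\<alpha>' i))))"
  then obtain N' t' \<alpha>' where "spectral_flow_partition V A 0 1 N' t' \<alpha>'" "m = flow_sum V A N' t' \<alpha>'"
    by (auto simp: flow_sum_def nonneg_dim_def)
  then show "m = flow_sum V A N t \<alpha>" using flow_sum_unique[OF assms] by simp
qed

end

text \<open>
  The windows around the points of \<open>[0,1]\<close> are chosen before \<open>V\<close>; a partition finer than a Lebesgue
  number of this cover works for every \<open>V\<close>.
\<close>

lemma common_partition_exists:
  fixes A :: "real \<Rightarrow> 'a::complex_hilbert \<Rightarrow>\<^sub>L 'a"
  assumes cont: "continuous_on {0..1} A" and F: "\<And>s. s \<in> {0..1} \<Longrightarrow> selfadjoint (A s) \<and> fredholm (A s)"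
  obtains N t \<alpha> where "\<And>V. invariant_path V A \<Longrightarrow> spectral_flow_partition V A 0 1 N t \<alpha>"
proof -
  define good where "good a r s \<longleftrightarrow> r > 0 \<and> a > 0 \<and> (\<forall>V. invariant_path V A \<longrightarrow>
      (\<forall>u\<in>{0..1} \<inter> ball s r. window_dim V (A u) a (cdim (V \<inter> {x. A s x = 0}))))" for a r s
  have "\<exists>a r. good a r s" if s: "s \<in> {0..1}" for s
  proof -
    obtain a \<epsilon> where a: "a > 0" "\<epsilon> > 0"
      "\<And>V T'. invariant_subspace V (A s) \<Longrightarrow> invariant_subspace V T' \<Longrightarrow> norm (T' - A s) < \<epsilon> \<Longrightarrow>
      window_dim V T' a (cdim (V \<inter> {x. A s x = 0}))"
      using fredholm_window[of "A s"] F[OF s] by blast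
    obtain r where r: "r > 0" "\<forall>u\<in>{0..1}. dist u s < r \<longrightarrow> dist (A u) (A s) < \<epsilon>"
      using cont s a(2) unfolding continuous_on_iff by blast
    have "good a r s"
      unfolding good_def using a r s
      by (auto simp: dist_norm norm_minus_commute invariant_path.invariant)
    then show ?thesis by blast
  qed
  then obtain a r where good: "\<And>s. s \<in> {0..1} \<Longrightarrow> good (a s) (r s) s" by metis
  obtain e where e: "e > 0" "\<And>x. x \<in> {0..1} \<Longrightarrow> \<exists>G\<in>(\<lambda>s. ball s (r s)) ` {0..1::real}. ball x e \<subseteq> G"
  proof (rule Heine_Borel_lemma[of "{0..1::real}" "(\<lambda>s. ball s (r s)) ` {0..1}"])
    show "{0..1} \<subseteq> \<Union> ((\<lambda>s. ball s (r s)) ` {0..1})" using good by (force simp: good_def)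
  qed auto
  then have "\<forall>x\<in>{0..1}. \<exists>s\<in>{0..1}. ball x e \<subseteq> ball s (r s)" by blast
  then obtain c where c: "\<And>x. x \<in> {0..1} \<Longrightarrow> c x \<in> {0..1}" "\<And>x. x \<in> {0..1} \<Longrightarrow> ball x e \<subseteq> ball (c x) (r (c x))"
    by metis
  obtain N :: nat where N: "inverse (real (Suc N)) < e" using reals_Archimedean[OF e(1)] by blast
  define t where "t i = real i / real (Suc N)" for i :: nat
  have step: "t i - t (i - 1) = inverse (real (Suc N))" if "i \<in> {1..Suc N}" for i
    using that by (simp add: t_def field_simps of_nat_diff)
  show thesis
  proof (rule that[of "Suc N" t "\<lambda>i. a (c (t (i - 1)))"])
    fix V assume V: "invariant_path V A"
    have pos: "0 < inverse (real (Suc N))" by simp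
    have "spectral_window V A (a (c (t (i - 1)))) (t (i - 1)) (t i)" if i: "i \<in> {1..Suc N}" for i
    proof -
      have x: "t (i - 1) \<in> {0..1}" and ti: "t i \<le> 1" using i by (auto simp: t_def)
      define s where "s = c (t (i - 1))"
      have g: "good (a s) (r s) s" unfolding s_def by (intro good c x)
      have "u \<in> {0..1} \<inter> ball s (r s)" if u: "u \<in> {t (i - 1)..t i}" for u
      proof -
        have "u \<in> ball (t (i - 1)) e" using u step[OF i] N by (simp add: dist_real_def)
        then show ?thesis using c(2)[OF x] u x ti unfolding s_def by auto
      qed
      then show ?thesis
        using g V unfolding spectral_window_def good_def s_def[symmetric]
        by (intro conjI exI[of _ "cdim (V \<inter> {x. A s x = 0})"]) auto
    qed
    moreover have "t (i - 1) < t i" if "i \<in> {1..Suc N}" for i using step[OF that] pos by linarith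
    ultimately show "spectral_flow_partition V A 0 1 (Suc N) t (\<lambda>i. a (c (t (i - 1))))"
      unfolding invariant_path.partition_iff[OF V] by (auto simp: t_def)
  qed
qed

section \<open>Unitary representations of dihedral groups\<close>

locale dihedral_rep =
  fixes n :: nat and R S :: "'a::complex_hilbert \<Rightarrow> 'a"
  assumes n: "n \<ge> 1" and rep: "dihedral_unitary_rep n R S"
begin

lemma R_add: "R (x + y) = R x + R y" and R_scaleC: "R (c *\<^sub>C x) = c *\<^sub>C R x"
  and S_add: "S (x + y) = S x + S y" and S_scaleC: "S (c *\<^sub>C x) = c *\<^sub>C S x"
  and R_power_n: "(R ^^ n) x = x" and S_S: "S (S x) = x" and SRSR: "S (R (S (R x))) = x"
  and clinear_S: "clinear_op S"
  using rep unfolding dihedral_unitary_rep_def unitary_def clinear_op_def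
  by (simp_all add: fun_eq_iff numeral_2_eq_2)

lemma norm_R: "norm (R x) = norm x" and norm_S: "norm (S x) = norm x"
proof -
  have "cinner (R x) (R x) = cinner x x" "cinner (S x) (S x) = cinner x x"
    using rep unfolding dihedral_unitary_rep_def unitary_def by blast+
  then show "norm (R x) = norm x" "norm (S x) = norm x"
    unfolding cinner_self of_real_eq_iff by (auto intro: power2_eq_imp_eq)
qed

lemma bounded_linear_R: "bounded_linear R"
  by (rule bounded_linear_intro[of _ 1]) (simp_all add: R_add R_scaleC scaleR_scaleC norm_R)

definition \<zeta> :: complex where "\<zeta> = exp (2 * of_real pi * \<i> / of_nat n)"

lemma \<zeta>_power_eq_1_iff: "\<zeta> ^ k = 1 \<longleftrightarrow> n dvd k"
proof -
  have "\<zeta> ^ k = exp (2 * of_real pi * \<i> * of_nat k / of_nat n)"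
    unfolding \<zeta>_def exp_of_nat_mult[symmetric] by (rule arg_cong[of _ _ exp]) simp
  then show ?thesis using complex_root_unity_eq_1[OF n, of k] by simp
qed

lemma \<zeta>_power_n [simp]: "\<zeta> ^ n = 1"
  by (simp add: \<zeta>_power_eq_1_iff)

lemma \<zeta>_character_sum: "(\<Sum>j<n. (\<zeta> ^ i) ^ j) = (if n dvd i then of_nat n else 0)"
proof (cases "n dvd i")
  case True
  then show ?thesis using \<zeta>_power_eq_1_iff[of i] by simp
next
  case False
  have "(\<zeta> ^ i) ^ n = 1" by (metis \<zeta>_power_n mult.commute power_mult power_one)
  then show ?thesis using False geometric_sum[of "\<zeta> ^ i" n] \<zeta>_power_eq_1_iff[of i] by simp
qed

abbreviation Eig :: "nat \<Rightarrow> 'a set" where "Eig k \<equiv> rotation_eigenspace n R k"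

lemma mem_Eig_iff: "x \<in> Eig k \<longleftrightarrow> R x = \<zeta> ^ k *\<^sub>C x"
  by (simp add: rotation_eigenspace_def \<zeta>_def)

lemma csubspace_Eig: "csubspace (Eig k)"
  using R_scaleC[of 0 0]
  by (auto simp: complex_vector.subspace_def mem_Eig_iff R_add R_scaleC scaleC_add_right scaleC_scaleC mult.commute
      complex_vector.scale_zero_left complex_vector.scale_zero_right)

lemma closed_Eig: "closed (Eig k)"
proof -
  have "Eig k = {x. R x = \<zeta> ^ k *\<^sub>C x}" by (auto simp: mem_Eig_iff)
  also have "closed \<dots>"
    by (intro closed_Collect_eq linear_continuous_on bounded_linear_R bounded_linear_scaleC)
  finally show ?thesis .
qed

text \<open>The isotypical projection onto \<open>Eig k\<close>; the exponent \<open>n - k\<close> stands for \<open>- k\<close>.\<close>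

definition isotypical :: "nat \<Rightarrow> 'a \<Rightarrow> 'a" where
  "isotypical k x = (1 / of_nat n) *\<^sub>C (\<Sum>j<n. (\<zeta> ^ (n - k)) ^ j *\<^sub>C (R ^^ j) x)"

lemma R_power_add: "(R ^^ j) (x + y) = (R ^^ j) x + (R ^^ j) y"
  by (induction j) (auto simp: R_add)

lemma R_0: "R 0 = 0" using R_add[of 0 0] by simp

lemma R_diff: "R (x - y) = R x - R y"
  using R_add[of "x - y" y] by (simp add: algebra_simps)

lemma R_sum: "R (\<Sum>j\<in>J. f j) = (\<Sum>j\<in>J. R (f j))"
  by (induction J rule: infinite_finite_induct) (auto simp: R_0 R_add)

lemma isotypical_diff: "isotypical k (x - y) = isotypical k x - isotypical k y"
proof -
  have "(R ^^ j) (x - y) = (R ^^ j) x - (R ^^ j) y" for j by (induction j) (auto simp: R_diff)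
  then show ?thesis by (simp add: isotypical_def scaleC_diff_right sum_subtractf)
qed

lemma isotypical_add: "isotypical k (x + y) = isotypical k x + isotypical k y"
  by (simp add: isotypical_def R_power_add scaleC_add_right sum.distrib)

lemma isotypical_scaleC: "isotypical k (c *\<^sub>C x) = c *\<^sub>C isotypical k x"
proof -
  have "(R ^^ j) (c *\<^sub>C x) = c *\<^sub>C (R ^^ j) x" for j by (induction j) (auto simp: R_scaleC)
  then show ?thesis
    by (simp add: isotypical_def complex_vector.scale_sum_right scaleC_scaleC mult_ac)
qed

lemma isotypical_in_Eig: assumes k: "k \<le> n" shows "isotypical k x \<in> Eig k"
proof -
  define f where "f j = (\<zeta> ^ (n - k)) ^ j *\<^sub>C (R ^^ j) x" for j
  have inv: "\<zeta> ^ k * \<zeta> ^ (n - k) = 1" using k by (simp flip: power_add)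
  have "(\<zeta> ^ (n - k)) ^ n = 1" by (metis \<zeta>_power_n mult.commute power_mult power_one)
  then have "f n = f 0" by (simp add: f_def R_power_n)
  then have shift: "(\<Sum>j<n. f (Suc j)) = (\<Sum>j<n. f j)"
    using sum.lessThan_Suc_shift[of f n] by simp
  have "R (f j) = \<zeta> ^ k *\<^sub>C f (Suc j)" for j
  proof -
    have "\<zeta> ^ k *\<^sub>C f (Suc j) = (\<zeta> ^ k * \<zeta> ^ (n - k) * (\<zeta> ^ (n - k)) ^ j) *\<^sub>C R ((R ^^ j) x)"
      by (simp add: f_def scaleC_scaleC mult.assoc)
    then show ?thesis by (simp add: inv f_def R_scaleC)
  qed
  then have "R (\<Sum>j<n. f j) = \<zeta> ^ k *\<^sub>C (\<Sum>j<n. f j)"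
    by (simp add: R_sum complex_vector.scale_sum_right[symmetric] shift)
  then show ?thesis
    unfolding mem_Eig_iff isotypical_def f_def[symmetric] by (simp add: R_scaleC scaleC_scaleC mult.commute)
qed

lemma isotypical_on_Eig:
  assumes "k < n" "l < n" "x \<in> Eig l"
  shows "isotypical k x = (if k = l then x else 0)"
proof -
  have "(R ^^ j) x = (\<zeta> ^ l) ^ j *\<^sub>C x" for j
    using assms(3) by (induction j) (auto simp: mem_Eig_iff R_scaleC scaleC_scaleC mult.commute scaleC_one)
  then have "isotypical k x = (1 / of_nat n * (\<Sum>j<n. (\<zeta> ^ (n - k + l)) ^ j)) *\<^sub>C x"
    by (simp add: isotypical_def scaleC_scaleC power_add power_mult_distrib
        flip: complex_vector.scale_sum_left)
  moreover have "n dvd n - k + l \<longleftrightarrow> k = l"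
  proof
    assume "n dvd n - k + l"
    then obtain m where m: "n - k + l = n * m" by blast
    have "0 < n - k + l" "n - k + l < n * 2" using assms(1,2) by auto
    then have "m \<noteq> 0" "m < 2" unfolding m by auto
    then have "m = 1" by linarith
    then show "k = l" using m assms by simp
  qed (use assms in simp)
  ultimately show ?thesis using n by (simp add: \<zeta>_character_sum scaleC_one complex_vector.scale_zero_left)
qed

text \<open>Orthogonality of characters: only the term \<open>j = 0\<close> survives the summation over \<open>k\<close>.\<close>

lemma sum_isotypical: "(\<Sum>k<n. isotypical k x) = x"
proof -
  have char: "(\<Sum>k<n. (\<zeta> ^ (n - k)) ^ j) = (if j = 0 then of_nat n else 0)" if j: "j < n" for j
  proof -
    have "(\<Sum>k<n. (\<zeta> ^ (n - k)) ^ j) = (\<Sum>k<n. \<zeta> ^ j * (\<zeta> ^ j) ^ (n - Suc k))"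
    proof (rule sum.cong[OF refl])
      fix k assume "k \<in> {..<n}"
      then have "n - k = Suc (n - Suc k)" by auto
      then show "(\<zeta> ^ (n - k)) ^ j = \<zeta> ^ j * (\<zeta> ^ j) ^ (n - Suc k)"
        by (metis mult.commute power_Suc power_mult)
    qed
    also have "\<dots> = \<zeta> ^ j * (\<Sum>k<n. (\<zeta> ^ j) ^ k)"
      unfolding sum_distrib_left[symmetric] by (subst sum.nat_diff_reindex) simp
    also have "\<dots> = (if j = 0 then of_nat n else 0)"
      using j by (auto simp: \<zeta>_character_sum dest: dvd_imp_le)
    finally show ?thesis .
  qed
  have "(\<Sum>k<n. isotypical k x) = (1 / of_nat n) *\<^sub>C (\<Sum>j<n. (\<Sum>k<n. (\<zeta> ^ (n - k)) ^ j) *\<^sub>C (R ^^ j) x)"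
    unfolding isotypical_def complex_vector.scale_sum_right[symmetric] complex_vector.scale_sum_left
    by (subst sum.swap) simp
  also have "(\<Sum>j<n. (\<Sum>k<n. (\<zeta> ^ (n - k)) ^ j) *\<^sub>C (R ^^ j) x) = (\<Sum>j<n. if j = 0 then of_nat n *\<^sub>C x else 0)"
    by (rule sum.cong) (auto simp: char complex_vector.scale_zero_left)
  also have "\<dots> = of_nat n *\<^sub>C x" using n by (simp add: sum.delta)
  finally show ?thesis using n by (simp add: scaleC_scaleC scaleC_one)
qed

text \<open>The subspaces \<open>U m\<close> without components in \<open>Eig m, \<dots>, Eig (n - 1)\<close> grow by one eigenspace per step.\<close>

lemma cdim_eq_sum_Eig:
  assumes W: "csubspace W" "cfinite_dim W" and RW: "\<And>x. x \<in> W \<Longrightarrow> R x \<in> W"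
  shows "cdim W = (\<Sum>k<n. cdim (W \<inter> Eig k))"
proof -
  have "(R ^^ j) x \<in> W" if "x \<in> W" for j x using that by (induction j) (auto intro: RW)
  then have isoW: "isotypical k x \<in> W" if "x \<in> W" for k x
    unfolding isotypical_def using that
    by (intro complex_vector.subspace_scale[OF W(1)] complex_vector.subspace_sum[OF W(1)])
  define U where "U m = {x\<in>W. \<forall>k. m \<le> k \<and> k < n \<longrightarrow> isotypical k x = 0}" for m
  have iso0: "isotypical k 0 = 0" for k using isotypical_diff[of k 0 0] by simp
  have U: "csubspace (U m)" for m
    unfolding complex_vector.subspace_def U_def
    by (auto simp: iso0 isotypical_add isotypical_scaleC complex_vector.scale_zero_right csubspace_simps[OF W(1)])
  have finU: "cfinite_dim (U m)" for m by (rule cfinite_dim_subset[OF W(2)]) (auto simp: U_def)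
  have "cdim (U m) = (\<Sum>k<m. cdim (W \<inter> Eig k))" if "m \<le> n" for m
    using that
  proof (induction m)
    case 0
    have "x = 0" if "x \<in> U 0" for x using that sum_isotypical[of x] by (simp add: U_def)
    then have "U 0 = {0}" using complex_vector.subspace_0[OF U[of 0]] by auto
    then show ?case by (simp add: cdim_zero_subspace)
  next
    case (Suc m)
    then have m: "m < n" by simp
    have "cdim (U (Suc m)) = cdim (U m) + cdim (W \<inter> Eig m)"
    proof (rule cdim_direct_sum[OF U finU])
      show "csubspace (W \<inter> Eig m)" by (intro complex_vector.subspace_inter W csubspace_Eig)
      show "cfinite_dim (W \<inter> Eig m)" by (rule cfinite_dim_subset[OF W(2)]) auto
      show "x = 0" if "x \<in> U m" "x \<in> W \<inter> Eig m" for x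
        using that isotypical_on_Eig[OF m m, of x] m by (auto simp: U_def)
      show "x + y \<in> U (Suc m)" if "x \<in> U m" "y \<in> W \<inter> Eig m" for x y
        using that isotypical_on_Eig[OF _ m, of _ y] by (auto simp: U_def isotypical_add csubspace_simps[OF W(1)])
      show "\<exists>x\<in>U m. \<exists>y\<in>W \<inter> Eig m. z = x + y" if z: "z \<in> U (Suc m)" for z
      proof (intro bexI)
        have zW: "z \<in> W" using z by (simp add: U_def)
        show y: "isotypical m z \<in> W \<inter> Eig m" using isoW[OF zW] isotypical_in_Eig m by simp
        have "isotypical k (z - isotypical m z) = 0" if "m \<le> k" "k < n" for k
          using isotypical_on_Eig[OF that(2) m, of "isotypical m z"] y z that
          by (cases "k = m") (auto simp: isotypical_diff U_def)
        then show "z - isotypical m z \<in> U m"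
          using zW isoW[OF zW] by (auto simp: U_def csubspace_simps[OF W(1)])
      qed simp
    qed
    then show ?case using Suc by simp
  qed
  moreover have "U n = W" by (auto simp: U_def)
  ultimately show ?thesis by (metis order_refl)
qed

text \<open>The relation \<open>S R S R = 1\<close> says that \<open>S\<close> conjugates \<open>R\<close> to its inverse.\<close>

lemma S_Eig: assumes "k \<le> n" "x \<in> Eig k" shows "S x \<in> Eig (n - k)"
proof -
  have "\<zeta> ^ k *\<^sub>C S (R (S x)) = x"
    using SRSR[of x] assms(2) by (simp add: mem_Eig_iff R_scaleC S_scaleC)
  then have "S (\<zeta> ^ k *\<^sub>C S (R (S x))) = S x" by simp
  then have "\<zeta> ^ k *\<^sub>C R (S x) = S x" by (simp add: S_scaleC S_S)
  then have "\<zeta> ^ (n - k) *\<^sub>C S x = (\<zeta> ^ (n - k) * \<zeta> ^ k) *\<^sub>C R (S x)" by (simp flip: scaleC_scaleC)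
  also have "\<zeta> ^ (n - k) * \<zeta> ^ k = 1" using assms(1) by (simp flip: power_add)
  finally show ?thesis by (simp add: mem_Eig_iff scaleC_one)
qed

lemma cdim_Eig_reflect:
  assumes W: "csubspace W" "cfinite_dim W" and SW: "\<And>x. x \<in> W \<Longrightarrow> S x \<in> W" and k: "k \<le> n"
  shows "cdim (W \<inter> Eig (n - k)) = cdim (W \<inter> Eig k)"
proof (rule cdim_eq_of_bijection[OF clinear_S clinear_S])
  have S0: "x = 0" if "S x = 0" for x using norm_S[of x] that by simp
  show "x = 0" if "S x = 0" for x using S0 that .
  show "x = 0" if "S x = 0" for x using S0 that .
  show "S x \<in> W \<inter> Eig k" if "x \<in> W \<inter> Eig (n - k)" for x
    using S_Eig[of "n - k" x] that SW k by auto
  show "S x \<in> W \<inter> Eig (n - k)" if "x \<in> W \<inter> Eig k" for x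
    using S_Eig[OF k, of x] that SW by auto
qed (auto intro!: complex_vector.subspace_inter W csubspace_Eig cfinite_dim_subset[OF W(2)])

end

section \<open>Parity of the spectral flow\<close>

text \<open>The involution \<open>k \<mapsto> n - k\<close> of \<open>{1..n - 1}\<close> pairs equal terms and can only fix \<open>n / 2\<close>.\<close>

lemma sum_reflection_mod_2:
  fixes w :: "nat \<Rightarrow> nat"
  assumes n: "n \<ge> 1" and w: "\<And>k. 0 < k \<Longrightarrow> k < n \<Longrightarrow> w (n - k) = w k"
  shows "\<exists>m. (\<Sum>k<n. w k) = w 0 + (if even n then w (n div 2) else 0) + 2 * m"
proof -
  define P M Q where "P = {k. 0 < k \<and> k < n \<and> 2 * k < n}" and "M = {k. 0 < k \<and> k < n \<and> 2 * k = n}"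
    and "Q = {k. 0 < k \<and> k < n \<and> n < 2 * k}"
  have fin: "finite P" "finite M" "finite Q"
    by (auto simp: P_def M_def Q_def intro: finite_subset[of _ "{..<n}"])
  have "{..<n} = insert 0 (P \<union> M \<union> Q)" using n by (auto simp: P_def M_def Q_def)
  then have "(\<Sum>k<n. w k) = w 0 + (\<Sum>k\<in>P \<union> M \<union> Q. w k)"
    using fin by (simp add: P_def M_def Q_def)
  also have "(\<Sum>k\<in>P \<union> M \<union> Q. w k) = (\<Sum>k\<in>P. w k) + (\<Sum>k\<in>M. w k) + (\<Sum>k\<in>Q. w k)"
    using fin by (subst sum.union_disjoint, auto simp: P_def M_def Q_def)+
  also have "(\<Sum>k\<in>Q. w k) = (\<Sum>k\<in>P. w k)"
    by (rule sum.reindex_bij_witness[of _ "\<lambda>k. n - k" "\<lambda>k. n - k"]) (auto simp: P_def Q_def w)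
  also have "(\<Sum>k\<in>M. w k) = (if even n then w (n div 2) else 0)"
  proof (cases "even n")
    case True
    then have "M = {n div 2}" using n by (auto simp: M_def)
    then show ?thesis using True by simp
  next
    case False
    then have "M = {}" by (auto simp: M_def)
    then show ?thesis using False by simp
  qed
  finally show ?thesis by (intro exI[of _ "\<Sum>k\<in>P. w k"]) simp
qed

lemma (in dihedral_rep) cdim_mod_2:
  assumes W: "csubspace W" "cfinite_dim W"
    and RW: "\<And>x. x \<in> W \<Longrightarrow> R x \<in> W" and SW: "\<And>x. x \<in> W \<Longrightarrow> S x \<in> W"
  shows "\<exists>m. cdim W = cdim (W \<inter> Eig 0) + (if even n then cdim (W \<inter> Eig (n div 2)) else 0) + 2 * m"
proof -
  have "cdim (W \<inter> Eig (n - k)) = cdim (W \<inter> Eig k)" if "0 < k" "k < n" for k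
    by (rule cdim_Eig_reflect[OF W SW]) (use that in auto)
  from sum_reflection_mod_2[where w = "\<lambda>k. cdim (W \<inter> Eig k)", OF n this] show ?thesis using cdim_eq_sum_Eig[OF W RW] by simp
qed

text \<open>
  A growth space of \<open>A s - \<alpha>/2\<close> is stable under the isometries \<open>R\<close> and \<open>S\<close>, as they commute with \<open>A s\<close>,
  and its intersections with the eigenspaces of \<open>R\<close> are the spectral subspaces of the restrictions.
\<close>

lemma (in dihedral_rep) nonneg_dim_mod_2:
  assumes T: "selfadjoint (A s)" and RA: "\<And>x. A s (R x) = R (A s x)" and SA: "\<And>x. A s (S x) = S (A s x)"
    and \<alpha>: "\<alpha> > 0" and fin: "cfinite_dim (spectral_subspace_on UNIV (A s) 0 \<alpha>)"
    and inv: "\<And>k. invariant_subspace (Eig k) (A s)" "invariant_subspace UNIV (A s)"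
  shows "even (nonneg_dim UNIV A \<alpha> s - nonneg_dim (Eig 0) A \<alpha> s
      - (if even n then nonneg_dim (Eig (n div 2)) A \<alpha> s else 0))"
proof -
  define W where "W = spectral_space (A s) 0 \<alpha>"
  have U: "spectral_subspace_on UNIV (A s) 0 \<alpha> = W"
    using invariant_subspace.spectral_subspace_eq[OF inv(2) \<alpha>] by (simp add: W_def)
  have Ek: "spectral_subspace_on (Eig k) (A s) 0 \<alpha> = W \<inter> Eig k" for k
    using invariant_subspace.spectral_subspace_eq[OF inv(1) \<alpha>] by (auto simp: W_def)
  let ?D = "A s - ((0 + \<alpha>) / 2) *\<^sub>R id_blinfun"
  have D: "selfadjoint ?D" by (rule selfadjoint_shift[OF T])
  have W: "csubspace W" unfolding W_def spectral_space_def by (rule csubspace_growth_space[OF D]) (use \<alpha> in simp)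
  have S_diff: "S (x - y) = S x - S y" for x y using S_add[of "x - y" y] by (simp add: algebra_simps)
  have RW: "R x \<in> W" if "x \<in> W" for x
    using that unfolding W_def spectral_space_def
    by (intro growth_space_invariant[OF D, where f = R and K = 1])
      (use \<alpha> in \<open>auto simp: RA R_diff R_scaleC scaleR_scaleC norm_R\<close>)
  have SW: "S x \<in> W" if "x \<in> W" for x
    using that unfolding W_def spectral_space_def
    by (intro growth_space_invariant[OF D, where f = S and K = 1])
      (use \<alpha> in \<open>auto simp: SA S_diff S_scaleC scaleR_scaleC norm_S\<close>)
  obtain m where "cdim W = cdim (W \<inter> Eig 0) + (if even n then cdim (W \<inter> Eig (n div 2)) else 0) + 2 * m"
    using cdim_mod_2[OF W _ RW SW] fin U by auto
  then have "int (cdim W) - int (cdim (W \<inter> Eig 0)) - (if even n then int (cdim (W \<inter> Eig (n div 2))) else 0) = 2 * int m"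
    by simp
  then show ?thesis unfolding nonneg_dim_def U Ek by simp
qed

theorem proposition2:
  fixes R S :: "'a::complex_hilbert \<Rightarrow> 'a"
    and A :: "real \<Rightarrow> 'a \<Rightarrow>\<^sub>L 'a"
    and n :: nat
  assumes "n \<ge> 1"
    and "separable_space (euclidean :: 'a topology)"
    and "dihedral_unitary_rep n R S"
    and "\<forall>l\<in>{0..1}. selfadjoint (A l) \<and> fredholm (A l)"
    and "continuous_on {0..1} A"
    and "\<forall>l\<in>{0..1}. \<forall>x. A l (R x) = R (A l x) \<and> A l (S x) = S (A l x)"
  shows "(odd n \<longrightarrow>
            [spectral_flow A 0 1 =
             spectral_flow_on (rotation_eigenspace n R 0) A 0 1] (mod 2)) \<and>
         (even n \<longrightarrow>
            [spectral_flow A 0 1 =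
             spectral_flow_on (rotation_eigenspace n R 0) A 0 1
             + spectral_flow_on (rotation_eigenspace n R (n div 2)) A 0 1] (mod 2))"
proof -
  interpret dihedral_rep n R S by unfold_locales (use assms in auto)
  have inv: "invariant_subspace (Eig k) (A s)" "invariant_subspace UNIV (A s)" if s: "s \<in> {0..1}" for k s
  proof -
    have sa: "selfadjoint (A s)" using assms(4) s by blast
    show "invariant_subspace (Eig k) (A s)"
    proof
      show "A s x \<in> Eig k" if "x \<in> Eig k" for x
        using that assms(6) s selfadjoint_scaleC[OF sa] by (metis mem_Eig_iff)
    qed (auto simp: sa closed_Eig csubspace_Eig)
    show "invariant_subspace UNIV (A s)" by unfold_locales (auto simp: sa)
  qed
  have pathE: "invariant_path (Eig k) A" for k by (rule invariant_path.intro[OF assms(5) inv(1)])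
  have pathU: "invariant_path UNIV A" by (rule invariant_path.intro[OF assms(5) inv(2)])
  obtain N t \<alpha> where part: "\<And>V. invariant_path V A \<Longrightarrow> spectral_flow_partition V A 0 1 N t \<alpha>"
    using common_partition_exists[OF assms(5)] assms(4) by blast
  have flow: "spectral_flow_on V A 0 1 = flow_sum V A N t \<alpha>" if "invariant_path V A" for V
    by (rule invariant_path.spectral_flow_eq[OF that part[OF that]])
  define c where "c i s = nonneg_dim UNIV A (\<alpha> i) s - nonneg_dim (Eig 0) A (\<alpha> i) s
      - (if even n then nonneg_dim (Eig (n div 2)) A (\<alpha> i) s else 0)" for i s
  have c: "even (c i (t j))" if i: "i \<in> {1..N}" and j: "j = i \<or> j = i - 1" for i j
  proof -
    have s: "t j \<in> {0..1}"
      using invariant_path.nodes_bounds[OF pathU part[OF pathU], of j] i j by auto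
    have win: "spectral_window UNIV A (\<alpha> i) (t (i - 1)) (t i)" "t (i - 1) < t i"
      using invariant_path.window[OF pathU part[OF pathU] i] invariant_path.nodes_less[OF pathU part[OF pathU] i] by auto
    then have \<alpha>: "\<alpha> i > 0" and "cfinite_dim (spectral_subspace_on UNIV (A (t j)) (- \<alpha> i) (\<alpha> i))"
      using j unfolding spectral_window_def window_dim_def by auto
    then have fin: "cfinite_dim (spectral_subspace_on UNIV (A (t j)) 0 (\<alpha> i))"
      using cfinite_dim_subset spectral_subspace_subset[of "- \<alpha> i" 0] by (metis less_imp_le neg_le_0_iff_le)
    show ?thesis unfolding c_def
      by (rule nonneg_dim_mod_2[where A = A and s = "t j", OF _ _ _ \<alpha> fin inv[OF s]]) (use s assms(4,6) in auto)
  qed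
  have "flow_sum UNIV A N t \<alpha> - flow_sum (Eig 0) A N t \<alpha>
      - (if even n then flow_sum (Eig (n div 2)) A N t \<alpha> else 0) = (\<Sum>i=1..N. c i (t i) - c i (t (i - 1)))"
    unfolding flow_sum_def c_def by (cases "even n") (auto simp: sum_subtractf[symmetric] intro!: sum.cong)
  moreover have "even (\<Sum>i=1..N. c i (t i) - c i (t (i - 1)))"
    by (rule dvd_sum) (use c in auto)
  ultimately have "even (flow_sum UNIV A N t \<alpha> - flow_sum (Eig 0) A N t \<alpha>
      - (if even n then flow_sum (Eig (n div 2)) A N t \<alpha> else 0))" by simp
  then show ?thesis
    unfolding flow[OF pathU] flow[OF pathE] cong_iff_dvd_diff by (auto simp: algebra_simps)
qed

end
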